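(* Let $3\le s\le k$ be integers and $u$ a totally real algebraic integer with $2<u<14$. Consider the $4\times4$ symmetric matrix $A$ indexed by $e_1,\dots,e_4$ with diagonal entries $-2$ and off-diagonal entries $a_{12}=u$, $a_{13}=2\cos\frac{\pi}{s}$, $a_{24}=2\cos\frac{\pi}{k}$, $a_{14}=a_{23}=a_{34}=0$ (a path $e_3-e_1-e_2-e_4$). Assume $A$ is V-arithmetic with ground field $\mathbb K$. Then $[\mathbb K:\mathbb Q]\le25$ for $s=k=3$; $[\mathbb K:\mathbb Q]\le21$ for $s=3,k=7$; $[\mathbb K:\mathbb Q]\le21$ for $s=k=7$; and $[\mathbb K:\mathbb Q]\le20$ for all other $3\le s\le k$. In particular $[\mathbb K:\mathbb Q]\le25$ always.
   Context: A fundamental matrix is a real symmetric matrix $A=(a_{ij})$ with $a_{ii}=-2$, $a_{ij}\ge0$ for $i\ne j$, and $a_{ij}=2\cos(\pi/m_{ij})$ for an integer $m_{ij}\ge2$ whenever $a_{ij}<2$. It is hyperbolic if it has exactly one positive eigenvalue. Its cyclic products are $a_{i_1i_2}a_{i_2i_3}\cdots a_{i_ki_1}$; its ground field $\mathbb K$ is the field generated over $\mathbb Q$ by all cyclic products. A hyperbolic fundamental matrix is V-arithmetic if all cyclic products are algebraic integers, the field $\mathbb Q(\{a_{ij}\})$ is totally real, and for every embedding $\varphi:\mathbb Q(\{a_{ij}\})\to\mathbb R$ whose restriction to $\mathbb K$ is not the identity inclusion, the matrix $(\varphi(a_{ij}))$ is negative definite. All fields are regarded as subfields of $\mathbb R$.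 *)

theory Defs
  imports Complex_Main "HOL-Computational_Algebra.Polynomial" "Jordan_Normal_Form.Char_Poly"
begin

definition is_subfield :: "real set \<Rightarrow> bool" where
  "is_subfield F \<longleftrightarrow> 0 \<in> F \<and> 1 \<in> F \<and>
     (\<forall>x\<in>F. \<forall>y\<in>F. x + y \<in> F \<and> x * y \<in> F) \<and>
     (\<forall>x\<in>F. - x \<in> F \<and> inverse x \<in> F)"

definition gen_field :: "real set \<Rightarrow> real set" where
  "gen_field S = \<Inter>{F. is_subfield F \<and> S \<subseteq> F}"

text \<open>Field embeddings of a subfield F of the reals into a field of characteristic 0
  (here complex or real numbers); only the values on F matter.\<close>
definition field_embedding :: "real set \<Rightarrow> (real \<Rightarrow> 'b::field) \<Rightarrow> bool" where
  "field_embedding F \<phi> \<longleftrightarrow> \<phi> 1 = 1 \<and>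
     (\<forall>x\<in>F. \<forall>y\<in>F. \<phi> (x + y) = \<phi> x + \<phi> y \<and> \<phi> (x * y) = \<phi> x * \<phi> y)"

definition totally_real_field :: "real set \<Rightarrow> bool" where
  "totally_real_field F \<longleftrightarrow>
     (\<forall>\<phi> :: real \<Rightarrow> complex. field_embedding F \<phi> \<longrightarrow> (\<forall>x\<in>F. \<phi> x \<in> \<real>))"

definition algebraic_integer :: "'a::field_char_0 \<Rightarrow> bool" where
  "algebraic_integer x \<longleftrightarrow>
     (\<exists>p :: int poly. lead_coeff p = 1 \<and> poly (map_poly of_int p) x = 0)"

definition totally_real_algebraic_integer :: "real \<Rightarrow> bool" where
  "totally_real_algebraic_integer u \<longleftrightarrow>
     algebraic_integer u \<and> totally_real_field (gen_field {u})"

definition q_span :: "real set \<Rightarrow> real set" where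
  "q_span B = {\<Sum>x\<in>T. of_rat (c x) * x | T c. finite T \<and> T \<subseteq> B}"

definition q_independent :: "real set \<Rightarrow> bool" where
  "q_independent B \<longleftrightarrow> (\<forall>T c. finite T \<and> T \<subseteq> B \<and> (\<Sum>x\<in>T. of_rat (c x) * x) = 0
       \<longrightarrow> (\<forall>x\<in>T. c x = 0))"

definition q_basis :: "real set \<Rightarrow> real set \<Rightarrow> bool" where
  "q_basis B K \<longleftrightarrow> q_independent B \<and> q_span B = K"

definition degree_over_Q_le :: "real set \<Rightarrow> nat \<Rightarrow> bool" where
  "degree_over_Q_le K n \<longleftrightarrow> (\<exists>B. finite B \<and> q_basis B K \<and> card B \<le> n)"

definition entries :: "real mat \<Rightarrow> real set" where
  "entries A = {A $$ (i, j) | i j. i < dim_row A \<and> j < dim_row A}"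

definition fundamental_matrix :: "real mat \<Rightarrow> bool" where
  "fundamental_matrix A \<longleftrightarrow> A \<in> carrier_mat (dim_row A) (dim_row A) \<and>
     (\<forall>i<dim_row A. \<forall>j<dim_row A. A $$ (i, j) = A $$ (j, i)) \<and>
     (\<forall>i<dim_row A. A $$ (i, i) = -2) \<and>
     (\<forall>i<dim_row A. \<forall>j<dim_row A. i \<noteq> j \<longrightarrow> A $$ (i, j) \<ge> 0 \<and>
        (A $$ (i, j) < 2 \<longrightarrow> (\<exists>m::nat. m \<ge> 2 \<and> A $$ (i, j) = 2 * cos (pi / real m))))"

definition hyperbolic :: "real mat \<Rightarrow> bool" where
  "hyperbolic A \<longleftrightarrow>
     (\<Sum>x\<in>{x. x > 0 \<and> poly (char_poly A) x = 0}. order x (char_poly A)) = 1"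

definition cyclic_products :: "real mat \<Rightarrow> real set" where
  "cyclic_products A = {(\<Prod>t<length l. A $$ (l ! t, l ! ((t + 1) mod length l))) | l.
       l \<noteq> [] \<and> (\<forall>i\<in>set l. i < dim_row A)}"

definition ground_field :: "real mat \<Rightarrow> real set" where
  "ground_field A = gen_field (cyclic_products A)"

definition negative_definite :: "real mat \<Rightarrow> bool" where
  "negative_definite M \<longleftrightarrow>
     (\<forall>v \<in> carrier_vec (dim_row M). v \<noteq> 0\<^sub>v (dim_row M) \<longrightarrow> v \<bullet> (M *\<^sub>v v) < 0)"

definition V_arithmetic :: "real mat \<Rightarrow> bool" where
  "V_arithmetic A \<longleftrightarrow> fundamental_matrix A \<and> hyperbolic A \<and>
     (\<forall>c\<in>cyclic_products A. algebraic_integer c) \<and>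
     totally_real_field (gen_field (entries A)) \<and>
     (\<forall>\<phi> :: real \<Rightarrow> real. field_embedding (gen_field (entries A)) \<phi> \<and>
        \<not> (\<forall>x\<in>ground_field A. \<phi> x = x) \<longrightarrow> negative_definite (map_mat \<phi> A))"

text \<open>The matrix of the theorem: path e3 - e1 - e2 - e4 (indices 0..3 for e1..e4).\<close>
definition path_matrix :: "real \<Rightarrow> nat \<Rightarrow> nat \<Rightarrow> real mat" where
  "path_matrix u s k = mat 4 4 (\<lambda>(i, j).
     if i = j then -2
     else if {i, j} = {0, 1} then u
     else if {i, j} = {0, 2} then 2 * cos (pi / real s)
     else if {i, j} = {1, 3} then 2 * cos (pi / real k)
     else 0)"

end

theory Submission
  imports Defs "HOL-Computational_Algebra.Fundamental_Theorem_Algebra"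
begin

text \<open>
  Put \<open>\<alpha> = u\<^sup>2\<close>, \<open>y = 4 - a\<^sub>1\<^sub>3\<^sup>2 = 4 sin\<^sup>2 (\<pi> / s)\<close> and \<open>z = 4 - a\<^sub>2\<^sub>4\<^sup>2 = 4 sin\<^sup>2 (\<pi> / k)\<close>. Negative
  definiteness of a conjugate matrix says that \<open>0 < \<alpha> < y z / 4\<close> and \<open>0 < y, z < 4\<close> there, whereas
  \<open>4 < \<alpha> < 196\<close> for the given matrix. Hence an embedding that fixes \<open>\<alpha>\<close> is the identity on the ground
  field \<open>K\<close>, so \<open>K = \<rat>(\<alpha>)\<close>, and the degree is the number of conjugates of \<open>\<alpha>\<close>.

  A nonzero algebraic integer \<open>P(\<alpha>, y, z)\<close> with \<open>P\<close> an integer polynomial has norm at least 1 in absolute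
  value. If weights \<open>w\<^sub>P \<ge> 0\<close> make \<open>\<Sum> w\<^sub>P ln \<bar>P\<bar> \<le> - E\<close> on the whole region of conjugates and
  \<open>\<Sum> w\<^sub>P ln \<bar>P\<bar> \<le> C\<close> at the given matrix, then all but one of the embeddings contribute at most \<open>- E\<close>
  and \<open>[K : \<rat>] - 1 \<le> C / E\<close>. The weights below come from linear programming.
      A single family of linear forms
  covers all \<open>k \<ge> 4\<close> when \<open>y\<close> is one of the constants 1, 2, 3 (\<open>s = 6, 4, 3\<close>); \<open>s = 5\<close> only needs
  \<open>\<alpha> < y\<close>; for all other pairs
  except (7, 7) the inequality \<open>\<alpha>\<^sup>4 (y z - 4 \<alpha>) \<le> (y z / 5)\<^sup>5\<close> separates the variables and leaves a
  problem in one variable. No information on cyclotomic fields is needed beyond \<open>0 < y, z < 4\<close> and the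
  minimal polynomials for \<open>s = 5\<close> and \<open>s = 7\<close>.
\<close>

text \<open>The weights must come from polynomials that do not vanish at the given matrix, and this
  shapes the case distinction. The natural factors in \<open>y\<close> alone, namely
  \<open>y - 4\<close>, \<open>y - 3\<close>, \<open>y - 2\<close>, \<open>y^2 - 5 y + 5\<close>,
  \<open>y - 1\<close> and the cubic \<open>sept\<close>, vanish at \<open>4 sin^2 (pi / n)\<close>
  for n = 2, 3, 4, 5, 6, 7. For n >= 8 all of them are available and one inequality serves every n;
  for a smaller n a factor is lost, and the equation that \<open>y\<close> then satisfies has to
  make up for it. Total reality is what makes negative definiteness applicable. A conjugate of
  \<alpha> only gives a complex embedding of the field of \<alpha>; it has to be extended to the
  field of all entries, where it becomes real-valued. No absolute values appear in the sums of
  logarithms because \<open>ln (- t) = ln t\<close> for real \<open>t\<close>. The logarithms are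
  measured in units of \<open>lam\<close>, the logarithm of 21 / 20, so that after a choice of
  tangents each estimate is a problem of linear arithmetic.\<close>

section \<open>Polynomials over a subfield\<close>

text \<open>Polymorphic, unlike \<open>is_subfield\<close>, because norms are shown to be rational
  inside the complex numbers.\<close>

definition subfield :: "'a::field set \<Rightarrow> bool" where
  "subfield F \<longleftrightarrow> 0 \<in> F \<and> 1 \<in> F \<and>
     (\<forall>x\<in>F. \<forall>y\<in>F. x + y \<in> F \<and> x * y \<in> F) \<and> (\<forall>x\<in>F. - x \<in> F \<and> inverse x \<in> F)"

lemma is_subfield_eq_subfield: "is_subfield F \<longleftrightarrow> subfield F"
  by (simp add: is_subfield_def subfield_def)

lemma subfield_Rats: "subfield (\<rat> :: 'a::field_char_0 set)"
  by (auto simp: subfield_def)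

lemma subfieldD:
  assumes "subfield F"
  shows "0 \<in> F" "1 \<in> F" "x \<in> F \<Longrightarrow> y \<in> F \<Longrightarrow> x + y \<in> F" "x \<in> F \<Longrightarrow> y \<in> F \<Longrightarrow> x * y \<in> F"
    "x \<in> F \<Longrightarrow> - x \<in> F" "x \<in> F \<Longrightarrow> inverse x \<in> F" "x \<in> F \<Longrightarrow> y \<in> F \<Longrightarrow> x - y \<in> F"
    "x \<in> F \<Longrightarrow> y \<in> F \<Longrightarrow> x / y \<in> F" "x \<in> F \<Longrightarrow> x ^ n \<in> F"
proof -
  show *: "0 \<in> F" "1 \<in> F" "x \<in> F \<Longrightarrow> y \<in> F \<Longrightarrow> x + y \<in> F" "x \<in> F \<Longrightarrow> y \<in> F \<Longrightarrow> x * y \<in> F"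
    "x \<in> F \<Longrightarrow> - x \<in> F" "x \<in> F \<Longrightarrow> inverse x \<in> F" for x y
    using assms by (auto simp: subfield_def)
  show "x \<in> F \<Longrightarrow> y \<in> F \<Longrightarrow> x - y \<in> F"
    using *(3)[of x "-y"] *(5)[of y] by simp
  show "x \<in> F \<Longrightarrow> y \<in> F \<Longrightarrow> x / y \<in> F"
    using *(4)[of x "inverse y"] *(6)[of y] by (simp add: divide_inverse)
  show "x \<in> F \<Longrightarrow> x ^ n \<in> F"
    by (induction n) (auto intro: *)
qed

lemma subfield_sum: "subfield F \<Longrightarrow> (\<And>i. i \<in> A \<Longrightarrow> f i \<in> F) \<Longrightarrow> sum f A \<in> F"
  by (induction A rule: infinite_finite_induct) (auto intro: subfieldD)

lemma subfield_of_nat: "subfield F \<Longrightarrow> of_nat n \<in> F"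
  by (induction n) (auto intro: subfieldD)

lemma subfield_numeral: "subfield F \<Longrightarrow> numeral n \<in> F"
  using subfield_of_nat[of F "numeral n"] by simp

lemma subfield_of_int: "subfield F \<Longrightarrow> of_int n \<in> F"
  by (cases n) (auto intro!: subfieldD subfield_of_nat simp del: of_nat_Suc)

lemma Rats_subset_subfield:
  fixes F :: "'a::field_char_0 set"
  assumes "subfield F" shows "\<rat> \<subseteq> F"
  by (auto elim!: Rats_cases' intro!: subfieldD subfield_of_int assms)

text \<open>Subfields are sets and not types, so a polynomial over \<open>F\<close> is a polynomial
  over the ambient field with a condition on its coefficients.\<close>

definition poly_over :: "'a::field set \<Rightarrow> 'a poly set" where
  "poly_over F = {p. \<forall>i. coeff p i \<in> F}"

lemma poly_over_mono: "F \<subseteq> G \<Longrightarrow> poly_over F \<subseteq> poly_over G"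
  by (auto simp: poly_over_def)

context
  fixes F :: "'a::field set"
  assumes F: "subfield F"
begin

lemma poly_over_0: "0 \<in> poly_over F"
  by (simp add: poly_over_def subfieldD(1)[OF F])

lemma poly_over_add: "p \<in> poly_over F \<Longrightarrow> q \<in> poly_over F \<Longrightarrow> p + q \<in> poly_over F"
  by (auto simp: poly_over_def intro: subfieldD[OF F])

lemma poly_over_diff: "p \<in> poly_over F \<Longrightarrow> q \<in> poly_over F \<Longrightarrow> p - q \<in> poly_over F"
  by (auto simp: poly_over_def intro: subfieldD[OF F])

lemma poly_over_uminus: "p \<in> poly_over F \<Longrightarrow> - p \<in> poly_over F"
  by (auto simp: poly_over_def intro: subfieldD[OF F])

lemma poly_over_mult: "p \<in> poly_over F \<Longrightarrow> q \<in> poly_over F \<Longrightarrow> p * q \<in> poly_over F"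
  by (auto simp: poly_over_def coeff_mult intro!: subfield_sum[OF F] subfieldD[OF F])

lemma poly_over_smult: "c \<in> F \<Longrightarrow> p \<in> poly_over F \<Longrightarrow> Polynomial.smult c p \<in> poly_over F"
  by (auto simp: poly_over_def intro: subfieldD[OF F])

lemma poly_over_monom: "c \<in> F \<Longrightarrow> Polynomial.monom c n \<in> poly_over F"
  by (auto simp: poly_over_def intro: subfieldD[OF F])

lemma poly_over_pCons: "c \<in> F \<Longrightarrow> p \<in> poly_over F \<Longrightarrow> pCons c p \<in> poly_over F"
  by (auto simp: poly_over_def coeff_pCons split: nat.splits)

lemma poly_over_const: "c \<in> F \<Longrightarrow> [:c:] \<in> poly_over F"
  by (intro poly_over_pCons poly_over_0)

lemma poly_over_pderiv: "p \<in> poly_over F \<Longrightarrow> pderiv p \<in> poly_over F"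
  by (auto simp: poly_over_def coeff_pderiv intro!: subfieldD[OF F] subfield_of_nat[OF F]
      simp del: of_nat_Suc)

text \<open>Long division stays over \<open>F\<close> because each step divides only by the leading
  coefficient of \<open>q\<close>.\<close>

lemma poly_over_division:
  assumes "q \<in> poly_over F" "q \<noteq> 0" "p \<in> poly_over F"
  shows "\<exists>d\<in>poly_over F. \<exists>r\<in>poly_over F. p = d * q + r \<and> (r = 0 \<or> degree r < degree q)"
  using assms(3)
proof (induction "degree p" arbitrary: p rule: less_induct)
  case less
  show ?case
  proof (cases "p = 0 \<or> degree p < degree q")
    case True
    then show ?thesis
      using less.prems poly_over_0 by (intro bexI[of _ 0] bexI[of _ p]) auto
  next
    case False
    define c where "c = lead_coeff p / lead_coeff q"
    define n where "n = degree p - degree q"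
    define p' where "p' = p - Polynomial.monom c n * q"
    have c: "c \<in> F" "c \<noteq> 0"
      using assms less.prems False by (auto simp: c_def poly_over_def intro: subfieldD[OF F])
    have p': "p' \<in> poly_over F"
      unfolding p'_def by (intro poly_over_diff poly_over_mult poly_over_monom c assms less.prems)
    have deg: "degree (Polynomial.monom c n * q) = degree p"
      using False c assms by (simp add: degree_mult_eq degree_monom_eq n_def)
    have "coeff (Polynomial.monom c n * q) (degree p) = lead_coeff (Polynomial.monom c n * q)"
      by (simp add: deg)
    also have "\<dots> = lead_coeff p"
      using assms c by (simp add: lead_coeff_mult c_def degree_monom_eq)
    finally have lc: "coeff p' (degree p) = 0"
      by (simp add: p'_def)
    have "p' = 0 \<or> degree p' < degree p"
    proof (rule disjCI)
      assume "\<not> degree p' < degree p"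
      moreover have "degree p' \<le> degree p"
        unfolding p'_def by (rule degree_diff_le) (auto simp: deg)
      ultimately show "p' = 0"
        using lc by (metis leading_coeff_0_iff le_antisym not_less)
    qed
    then obtain d r where dr: "d \<in> poly_over F" "r \<in> poly_over F" "p' = d * q + r"
        "r = 0 \<or> degree r < degree q"
      using less.hyps[OF _ p'] poly_over_0 by (metis add_0 mult_zero_left)
    have "p = (d + Polynomial.monom c n) * q + r"
      using dr(3) by (simp add: p'_def algebra_simps)
    then show ?thesis
      using dr by (intro bexI[of _ "d + Polynomial.monom c n"] bexI[of _ r] conjI poly_over_add
          poly_over_monom c) auto
  qed
qed

end

text \<open>The Euclidean algorithm for the resultant: exchanging the two polynomials only costs powers of
  leading coefficients and signs, and reducing one modulo the other does not change the product.\<close>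

lemma prod_over_roots_in_subfield:
  fixes F :: "complex set"
  assumes F: "subfield F" and "f \<in> poly_over F" "f \<noteq> 0" "g \<in> poly_over F"
  shows "(\<Prod>x\<in>#proots f. poly g x) \<in> F"
  using assms(2-)
proof (induction "degree f" arbitrary: f g rule: less_induct)
  case less
  obtain d r where dr: "d \<in> poly_over F" "r \<in> poly_over F" "g = d * f + r"
      "r = 0 \<or> degree r < degree f"
    using poly_over_division[OF F less.prems(1,2,3)] by auto
  have "(\<Prod>x\<in>#proots f. poly g x) = (\<Prod>x\<in>#proots f. poly r x)"
  proof (intro arg_cong[where f = prod_mset] image_mset_cong)
    fix x assume "x \<in># proots f"
    then show "poly g x = poly r x"
      using less.prems by (simp add: dr(3))
  qed
  also have "\<dots> \<in> F"
  proof (cases "r = 0")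
    case True
    \<comment> \<open>All factors are 0 here, so the product is 0, or 1 if \<open>f\<close> has no
      roots.\<close>
    then show ?thesis
      by (cases "proots f") (auto intro: subfieldD[OF F])
  next
    case False
    define n where "n = size (proots f)"
    define a where "a = (-1) ^ n / lead_coeff f"
    have IH: "(\<Prod>y\<in>#proots r. poly f y) \<in> F"
      using less.hyps[of r f] dr False less.prems by auto
    have split: "poly p x = lead_coeff p * (\<Prod>y\<in>#proots p. x - y)" for p :: "complex poly" and x
      by (subst complex_poly_decompose_multiset[symmetric])
        (simp add: poly_prod_mset image_mset.compositionality o_def del: complex_poly_decompose_multiset)
    have swap: "(\<Prod>x\<in>#proots f. x - y) = a * poly f y" for y
    proof -
      have "(\<Prod>x\<in>#proots f. x - y) = (\<Prod>x\<in>#proots f. (-1) * (y - x))"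
        by simp
      also have "\<dots> = (-1) ^ n * (\<Prod>x\<in>#proots f. y - x)"
        by (simp only: prod_mset.distrib) (simp add: n_def)
      also have "\<dots> = a * poly f y"
        using less.prems by (simp add: split[of f] a_def)
      finally show ?thesis .
    qed
    have "(\<Prod>x\<in>#proots f. poly r x) = (\<Prod>x\<in>#proots f. lead_coeff r * (\<Prod>y\<in>#proots r. x - y))"
      by (subst split) simp
    also have "\<dots> = lead_coeff r ^ n * (\<Prod>x\<in>#proots f. \<Prod>y\<in>#proots r. x - y)"
      by (simp add: prod_mset.distrib n_def)
    also have "(\<Prod>x\<in>#proots f. \<Prod>y\<in>#proots r. x - y) = (\<Prod>y\<in>#proots r. \<Prod>x\<in>#proots f. x - y)"
      by (rule prod_mset.swap)
    also have "\<dots> = (\<Prod>y\<in>#proots r. a * poly f y)"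
      by (simp only: swap)
    also have "\<dots> = a ^ size (proots r) * (\<Prod>y\<in>#proots r. poly f y)"
      by (simp add: prod_mset.distrib)
    also have "lead_coeff r ^ n * \<dots> \<in> F"
      using IH less.prems dr unfolding a_def poly_over_def
      by (auto intro!: subfieldD[OF F])
    finally show ?thesis .
  qed
  finally show ?case .
qed

section \<open>Minimal polynomials and extension of embeddings\<close>

definition adjoin :: "'a::field set \<Rightarrow> 'a \<Rightarrow> 'a set" where
  "adjoin F x = {poly p x | p. p \<in> poly_over F}"

definition is_minpoly :: "'a::field set \<Rightarrow> 'a \<Rightarrow> 'a poly \<Rightarrow> bool" where
  "is_minpoly F x m \<longleftrightarrow> m \<in> poly_over F \<and> lead_coeff m = 1 \<and> poly m x = 0 \<and>
     (\<forall>p\<in>poly_over F. p \<noteq> 0 \<longrightarrow> poly p x = 0 \<longrightarrow> degree m \<le> degree p)"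

definition algebraic_over :: "'a::field set \<Rightarrow> 'a \<Rightarrow> bool" where
  "algebraic_over F x \<longleftrightarrow> (\<exists>p\<in>poly_over F. p \<noteq> 0 \<and> poly p x = 0)"

lemma algebraic_over_mono: "F \<subseteq> G \<Longrightarrow> algebraic_over F x \<Longrightarrow> algebraic_over G x"
  using poly_over_mono[of F G] by (auto simp: algebraic_over_def)

lemma algebraic_over_Rats:
  fixes x :: "'a::field_char_0"
  assumes "algebraic_integer x" shows "algebraic_over \<rat> x"
proof -
  obtain p :: "int poly" where p: "lead_coeff p = 1" "poly (map_poly of_int p) x = 0"
    using assms by (auto simp: algebraic_integer_def)
  have "map_poly of_int p \<noteq> (0 :: 'a poly)"
    using p by auto
  then show ?thesis
    unfolding algebraic_over_def using p
    by (intro bexI[of _ "map_poly of_int p"]) (auto simp: poly_over_def coeff_map_poly)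
qed

text \<open>Substitute the square of the variable into an annihilator of \<open>x ^ 2\<close>.
  Integrality of the cyclic products concerns only the squares of the entries, whereas the entries
  themselves have to be adjoined.\<close>

lemma algebraic_over_square_root:
  assumes F: "subfield F" and "algebraic_over F (x ^ 2)" shows "algebraic_over F x"
proof -
  obtain p where p: "p \<in> poly_over F" "p \<noteq> 0" "poly p (x ^ 2) = 0"
    using assms by (auto simp: algebraic_over_def)
  have coeffs: "r \<in> poly_over F \<Longrightarrow> pcompose r [:0, 0, 1:] \<in> poly_over F" for r
  proof (induction r)
    case (pCons a r)
    then have "a \<in> F" "r \<in> poly_over F"
      by (auto simp: poly_over_def coeff_pCons split: nat.splits)
    then show ?case
      using pCons.IH
      by (auto simp: pcompose_pCons intro!: poly_over_add[OF F] poly_over_mult[OF F]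
          poly_over_const[OF F] poly_over_pCons[OF F] poly_over_0[OF F] subfieldD[OF F])
  qed (simp add: poly_over_0[OF F])
  have "pcompose p [:0, 0, 1:] \<noteq> 0"
    using p(2) by (simp add: pcompose_eq_0_iff)
  then show ?thesis
    unfolding algebraic_over_def using coeffs[OF p(1)] p(3)
    by (intro bexI[of _ "pcompose p [:0, 0, 1:]"]) (auto simp: poly_pcompose power2_eq_square)
qed

context
  fixes F :: "'a::field set" and x :: 'a
  assumes F: "subfield F"
begin

lemma subset_adjoin: "F \<subseteq> adjoin F x"
proof
  fix a assume "a \<in> F"
  then show "a \<in> adjoin F x"
    unfolding adjoin_def using poly_over_const[OF F] by (auto intro!: exI[of _ "[:a:]"])
qed

lemma in_adjoin: "x \<in> adjoin F x"
  unfolding adjoin_def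
  by (auto intro!: exI[of _ "[:0, 1:]"] poly_over_pCons[OF F] poly_over_0[OF F] subfieldD[OF F])

lemma minpoly_exists:
  assumes "algebraic_over F x" shows "\<exists>m. is_minpoly F x m"
proof -
  define P where "P p \<longleftrightarrow> p \<in> poly_over F \<and> p \<noteq> 0 \<and> poly p x = 0" for p
  obtain p where p: "P p" "\<And>q. P q \<Longrightarrow> degree p \<le> degree q"
    using assms ex_has_least_nat[of P _ degree] by (auto simp: algebraic_over_def P_def)
  define m where "m = Polynomial.smult (inverse (lead_coeff p)) p"
  have "is_minpoly F x m"
    using p unfolding is_minpoly_def m_def
    by (auto simp: P_def intro!: poly_over_smult[OF F] subfieldD[OF F]) (auto simp: poly_over_def)
  then show ?thesis ..
qed

lemma minpoly_dvd:
  assumes m: "is_minpoly F x m" and p: "p \<in> poly_over F" "poly p x = 0"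
  shows "\<exists>d\<in>poly_over F. p = d * m"
proof -
  have "m \<noteq> 0"
    using m by (auto simp: is_minpoly_def)
  then obtain d r where dr: "d \<in> poly_over F" "r \<in> poly_over F" "p = d * m + r"
      "r = 0 \<or> degree r < degree m"
    using poly_over_division[OF F _ _ p(1), of m] m by (auto simp: is_minpoly_def)
  have "poly r x = 0"
    using dr(3) p(2) m by (simp add: is_minpoly_def)
  then have "r = 0"
    using m dr by (auto simp: is_minpoly_def)
  then show ?thesis
    using dr by auto
qed

text \<open>Euclidean descent: \<open>m = d * p + r\<close> gives \<open>d(x) p(x) = - r(x)\<close>,
  so the inverse of \<open>p(x)\<close> is \<open>- d(x)\<close> times the inverse of
  \<open>r(x)\<close>, and \<open>r\<close> has smaller degree than \<open>p\<close>.\<close>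

lemma adjoin_inverse:
  assumes m: "is_minpoly F x m" and "p \<in> poly_over F"
  shows "inverse (poly p x) \<in> adjoin F x"
proof -
  have m0: "m \<noteq> 0"
    using m by (auto simp: is_minpoly_def)
  have low: "inverse (poly p x) \<in> adjoin F x"
    if "p \<in> poly_over F" "p \<noteq> 0" "degree p < degree m" for p
    using that
  proof (induction "degree p" arbitrary: p rule: less_induct)
    case less
    have px: "poly p x \<noteq> 0"
      using m less.prems by (auto simp: is_minpoly_def)
    obtain d r where dr: "d \<in> poly_over F" "r \<in> poly_over F" "m = d * p + r"
        "r = 0 \<or> degree r < degree p"
      using poly_over_division[OF F less.prems(1,2), of m] m by (auto simp: is_minpoly_def)
    have eq: "poly d x * poly p x + poly r x = 0"
      using m dr(3) by (metis is_minpoly_def poly_add poly_mult)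
    show ?case
    proof (cases "degree p = 0")
      case True
      then obtain c where "p = [:c:]"
        by (metis degree_eq_zeroE)
      moreover from this have "c \<in> F"
        using less.prems(1) by (auto simp: poly_over_def coeff_pCons split: nat.splits)
      ultimately show ?thesis
        using subset_adjoin subfieldD(6)[OF F] by auto
    next
      case False
      \<comment> \<open>Otherwise \<open>d\<close> would annihilate \<open>x\<close> in a degree
        below that of \<open>m\<close>.\<close>
      have "r \<noteq> 0"
      proof
        assume "r = 0"
        then have "poly d x = 0" "m = d * p"
          using eq px dr by auto
        moreover from this have "degree d < degree m" "d \<noteq> 0"
          using m0 False by (auto simp: degree_mult_eq)
        ultimately show False
          using m dr(1) by (auto simp: is_minpoly_def)
      qed
      then have "inverse (poly r x) \<in> adjoin F x"
        using less.hyps[of r] dr less.prems by auto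
      then obtain w where w: "w \<in> poly_over F" "inverse (poly r x) = poly w x"
        by (auto simp: adjoin_def)
      have "poly r x \<noteq> 0"
        using m dr less.prems \<open>r \<noteq> 0\<close> by (auto simp: is_minpoly_def)
      then have "inverse (poly p x) = - poly d x * inverse (poly r x)"
        using eq px by (simp add: field_simps) (metis add.inverse_inverse add_eq_0_iff2
            mult.commute)
      then have "inverse (poly p x) = poly (- d * w) x"
        by (simp add: w)
      then show ?thesis
        unfolding adjoin_def
        using poly_over_mult[OF F poly_over_uminus[OF F dr(1)] w(1)] by blast
    qed
  qed
  obtain d r where dr: "d \<in> poly_over F" "r \<in> poly_over F" "p = d * m + r"
      "r = 0 \<or> degree r < degree m"
    using poly_over_division[OF F _ m0 assms(2)] m by (auto simp: is_minpoly_def)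
  have "poly p x = poly r x"
    using m by (simp add: dr(3) is_minpoly_def)
  then show ?thesis
    using low[OF dr(2)] dr(4) subset_adjoin subfieldD(1)[OF F] by (cases "r = 0") auto
qed

lemma subfield_adjoin:
  assumes "algebraic_over F x" shows "subfield (adjoin F x)"
proof -
  obtain m where m: "is_minpoly F x m"
    using minpoly_exists[OF assms] ..
  have "0 \<in> adjoin F x" "1 \<in> adjoin F x"
    using subset_adjoin subfieldD[OF F] by auto
  moreover have "a + b \<in> adjoin F x" "a * b \<in> adjoin F x" "- a \<in> adjoin F x"
    if ab: "a \<in> adjoin F x" "b \<in> adjoin F x" for a b
  proof -
    obtain p q where pq: "p \<in> poly_over F" "q \<in> poly_over F" "a = poly p x" "b = poly q x"
      using ab by (auto simp: adjoin_def)
    show "a + b \<in> adjoin F x" "a * b \<in> adjoin F x" "- a \<in> adjoin F x"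
      unfolding adjoin_def
      using poly_over_add[OF F pq(1,2)] poly_over_mult[OF F pq(1,2)] poly_over_uminus[OF F pq(1)]
      by (force simp: pq)+
  qed
  moreover have "inverse a \<in> adjoin F x" if "a \<in> adjoin F x" for a
    using that adjoin_inverse[OF m] by (auto simp: adjoin_def)
  ultimately show ?thesis
    by (auto simp: subfield_def)
qed

end

section \<open>Field embeddings and their extension to simple extensions\<close>

lemma embedding_0:
  assumes "subfield F" "field_embedding F \<sigma>" shows "\<sigma> 0 = 0"
proof -
  have "\<sigma> (0 + 0) = \<sigma> 0 + \<sigma> 0"
    using assms subfieldD(1)[OF assms(1)] unfolding field_embedding_def by blast
  then have "\<sigma> 0 + \<sigma> 0 = \<sigma> 0 + 0"
    by simp
  then show ?thesis
    by (rule add_left_imp_eq)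
qed

context
  fixes F :: "real set" and \<sigma> :: "real \<Rightarrow> 'b::field"
  assumes F: "subfield F" and \<sigma>: "field_embedding F \<sigma>"
begin

lemma embedding_1: "\<sigma> 1 = 1"
  using \<sigma> by (simp add: field_embedding_def)

lemma embedding_add: "a \<in> F \<Longrightarrow> b \<in> F \<Longrightarrow> \<sigma> (a + b) = \<sigma> a + \<sigma> b"
  using \<sigma> by (simp add: field_embedding_def)

lemma embedding_mult: "a \<in> F \<Longrightarrow> b \<in> F \<Longrightarrow> \<sigma> (a * b) = \<sigma> a * \<sigma> b"
  using \<sigma> by (simp add: field_embedding_def)

lemma embedding_uminus: "a \<in> F \<Longrightarrow> \<sigma> (- a) = - \<sigma> a"
  using embedding_add[of a "- a"] embedding_0[OF F \<sigma>] subfieldD(5)[OF F, of a]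
  by (simp add: add_eq_0_iff)

lemma embedding_diff: "a \<in> F \<Longrightarrow> b \<in> F \<Longrightarrow> \<sigma> (a - b) = \<sigma> a - \<sigma> b"
  using embedding_add[of a "- b"] embedding_uminus[of b] subfieldD(5)[OF F, of b] by simp

lemma embedding_power: "a \<in> F \<Longrightarrow> \<sigma> (a ^ n) = \<sigma> a ^ n"
  by (induction n) (auto simp: embedding_1 embedding_mult subfieldD[OF F])

lemma embedding_of_nat: "\<sigma> (of_nat n) = of_nat n"
  by (induction n) (auto simp: embedding_0[OF F \<sigma>] embedding_1 embedding_add subfieldD[OF F]
      subfield_of_nat[OF F])

lemma embedding_numeral: "\<sigma> (numeral n) = numeral n"
  using embedding_of_nat[of "numeral n"] by simp

lemma embedding_of_int: "\<sigma> (of_int n) = of_int n"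
proof (cases n)
  case (neg k)
  then have "\<sigma> (of_int n) = \<sigma> (- of_nat (Suc k))"
    by simp
  also have "\<dots> = - of_nat (Suc k)"
    by (metis embedding_uminus embedding_of_nat subfield_of_nat[OF F])
  finally show ?thesis
    using neg by simp
qed (simp add: embedding_of_nat)

lemma embedding_nonzero:
  assumes "a \<in> F" "a \<noteq> 0" shows "\<sigma> a \<noteq> 0"
proof
  assume "\<sigma> a = 0"
  moreover have "\<sigma> (a * inverse a) = \<sigma> a * \<sigma> (inverse a)"
    using assms by (intro embedding_mult subfieldD[OF F])
  ultimately show False
    using assms embedding_1 by simp
qed

lemma embedding_sum: "(\<And>i. i \<in> A \<Longrightarrow> f i \<in> F) \<Longrightarrow> \<sigma> (sum f A) = (\<Sum>i\<in>A. \<sigma> (f i))"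
  by (induction A rule: infinite_finite_induct)
    (auto simp: embedding_0[OF F \<sigma>] embedding_add subfield_sum[OF F])

lemma coeff_map_embedding: "coeff (map_poly \<sigma> p) i = \<sigma> (coeff p i)"
  by (simp add: coeff_map_poly embedding_0[OF F \<sigma>])

lemma map_embedding_pCons: "map_poly \<sigma> (pCons a p) = pCons (\<sigma> a) (map_poly \<sigma> p)"
  by (intro poly_eqI) (auto simp: coeff_map_embedding coeff_pCons split: nat.splits)

lemma map_embedding_add:
  "p \<in> poly_over F \<Longrightarrow> q \<in> poly_over F \<Longrightarrow> map_poly \<sigma> (p + q) = map_poly \<sigma> p + map_poly \<sigma> q"
  by (intro poly_eqI) (simp add: coeff_map_embedding embedding_add poly_over_def)

lemma map_embedding_mult:
  "p \<in> poly_over F \<Longrightarrow> q \<in> poly_over F \<Longrightarrow> map_poly \<sigma> (p * q) = map_poly \<sigma> p * map_poly \<sigma> q"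
  by (intro poly_eqI)
    (simp add: coeff_map_embedding coeff_mult embedding_sum embedding_mult poly_over_def
      subfieldD(4)[OF F])

lemma embedding_poly:
  assumes "p \<in> poly_over F" "x \<in> F"
  shows "\<sigma> (poly p x) = poly (map_poly \<sigma> p) (\<sigma> x)"
  using assms(1)
proof (induction p)
  case (pCons a p)
  then have ap: "a \<in> F" "p \<in> poly_over F"
    by (auto simp: poly_over_def coeff_pCons split: nat.splits)
  have px: "poly p x \<in> F"
    using ap(2) assms(2) unfolding poly_altdef poly_over_def
    by (auto intro!: subfield_sum[OF F] subfieldD[OF F])
  show ?case
    using pCons.IH[OF ap(2)] ap px assms(2)
    by (simp add: map_embedding_pCons embedding_add embedding_mult subfieldD(4)[OF F])
qed (simp add: embedding_0[OF F \<sigma>])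

lemma embedding_algebraic_integer:
  assumes "x \<in> F" "algebraic_integer x" shows
      "\<exists>p :: int poly. lead_coeff p = 1 \<and> poly (map_poly of_int p) (\<sigma> x) = 0"
proof -
  obtain p :: "int poly" where p: "lead_coeff p = 1" "poly (map_poly of_int p) x = 0"
    using assms by (auto simp: algebraic_integer_def)
  have "map_poly \<sigma> (map_poly of_int p) = map_poly of_int p"
    by (intro poly_eqI) (simp add: coeff_map_embedding coeff_map_poly embedding_of_int)
  moreover have "map_poly of_int p \<in> poly_over F"
    by (simp add: poly_over_def coeff_map_poly subfield_of_int[OF F])
  ultimately have "poly (map_poly of_int p) (\<sigma> x) = 0"
    using embedding_poly[of "map_poly of_int p" x] assms p embedding_0[OF F \<sigma>] by simp
  with p show ?thesis
    by blast
qed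

text \<open>The extension applies \<sigma> to the coefficients of a polynomial that represents the
  element and evaluates at \<open>c\<close>. Two representing polynomials differ by a multiple of
  \<open>m\<close>, whose image vanishes at \<open>c\<close>, so the arbitrary choice in the
  definition of \<tau> does no harm.\<close>

lemma extend_embedding:
  assumes m: "is_minpoly F x m" and c: "poly (map_poly \<sigma> m) c = 0"
  shows "\<exists>\<tau>. field_embedding (adjoin F x) \<tau> \<and> (\<forall>a\<in>F. \<tau> a = \<sigma> a) \<and> \<tau> x = c"
proof -
  define \<tau> where "\<tau> t = poly (map_poly \<sigma> (SOME p. p \<in> poly_over F \<and> poly p x = t)) c" for t
  have \<tau>: "\<tau> (poly p x) = poly (map_poly \<sigma> p) c" if p: "p \<in> poly_over F" for p
  proof -
    define q where "q = (SOME q. q \<in> poly_over F \<and> poly q x = poly p x)"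
    have q: "q \<in> poly_over F" "poly q x = poly p x"
      using someI[of "\<lambda>q. q \<in> poly_over F \<and> poly q x = poly p x" p] p by (auto
          simp: q_def)
    obtain d where d: "d \<in> poly_over F" "q - p = d * m"
      using minpoly_dvd[OF F m poly_over_diff[OF F q(1) p]] q by auto
    have "map_poly \<sigma> q = map_poly \<sigma> (d * m + p)"
      using d by (metis diff_add_cancel)
    also have "\<dots> = map_poly \<sigma> d * map_poly \<sigma> m + map_poly \<sigma> p"
      using d m p by (simp add: map_embedding_add map_embedding_mult poly_over_mult[OF F]
          is_minpoly_def)
    finally show ?thesis
      using c by (simp add: \<tau>_def q_def[symmetric])
  qed
  have hom: "\<tau> (a + b) = \<tau> a + \<tau> b" "\<tau> (a * b) = \<tau> a * \<tau> b" if ab: "a \<in> adjoin F x" "b \<in> adjoin F x" for a b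
  proof -
    obtain p q where pq: "p \<in> poly_over F" "q \<in> poly_over F" "a = poly p x" "b = poly q x"
      using ab by (auto simp: adjoin_def)
    show "\<tau> (a + b) = \<tau> a + \<tau> b"
      using \<tau>[OF poly_over_add[OF F pq(1,2)]] pq by (simp add: \<tau> map_embedding_add)
    show "\<tau> (a * b) = \<tau> a * \<tau> b"
      using \<tau>[OF poly_over_mult[OF F pq(1,2)]] pq by (simp add: \<tau> map_embedding_mult)
  qed
  have "\<tau> a = \<sigma> a" if "a \<in> F" for a
    using \<tau>[OF poly_over_const[OF F that]] by (simp add: map_embedding_pCons)
  moreover have "\<tau> x = c"
    using \<tau>[of "[:0, 1:]"] poly_over_pCons[OF F] poly_over_0[OF F] subfieldD(1,2)[OF F]
    by (simp add: map_embedding_pCons embedding_0[OF F \<sigma>] embedding_1)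
  ultimately show ?thesis
    using hom subfieldD(2)[OF F] embedding_1 by (intro exI[of _ \<tau>] ) (auto simp:
        field_embedding_def)
qed

end

lemma minpoly_degree_pos:
  assumes "is_minpoly F x m" shows "degree m > 0"
proof (rule ccontr)
  assume "\<not> degree m > 0"
  then obtain c where "m = [:c:]"
    by (auto elim: degree_eq_zeroE)
  then show False
    using assms by (auto simp: is_minpoly_def)
qed

lemma degree_map_minpoly:
  assumes "subfield F" "field_embedding F \<sigma>" "is_minpoly F x m"
  shows "degree (map_poly \<sigma> m) = degree m" "lead_coeff (map_poly \<sigma> m) = 1"
proof -
  have "coeff (map_poly \<sigma> m) (degree m) = 1"
    using assms coeff_map_embedding[OF assms(1,2)] embedding_1[OF assms(1,2)]
    by (simp add: is_minpoly_def)
  moreover have "degree (map_poly \<sigma> m) \<le> degree m"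
    by (rule degree_map_poly_le)
  ultimately show "degree (map_poly \<sigma> m) = degree m"
    by (metis le_antisym le_degree zero_neq_one)
  with \<open>coeff _ _ = 1\<close> show "lead_coeff (map_poly \<sigma> m) = 1"
    by simp
qed

lemma extend_complex_embedding:
  fixes \<sigma> :: "real \<Rightarrow> complex"
  assumes F: "subfield F" "field_embedding F \<sigma>" and x: "algebraic_over F x"
  shows "\<exists>\<tau>. field_embedding (adjoin F x) \<tau> \<and> (\<forall>a\<in>F. \<tau> a = \<sigma> a)"
proof -
  obtain m where m: "is_minpoly F x m"
    using minpoly_exists[OF F(1) x] ..
  have "degree (map_poly \<sigma> m) > 0"
    using degree_map_minpoly[OF F m] minpoly_degree_pos[OF m] by simp
  then obtain c where "poly (map_poly \<sigma> m) c = 0"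
    using fundamental_theorem_of_algebra constant_degree by (metis less_numeral_extra(3))
  then show ?thesis
    using extend_embedding[OF F m] by blast
qed

text \<open>In characteristic 0 a minimal polynomial with only one root is linear: the coefficient next to
  the leading one of \<open>(X - x) ^ n\<close> is \<open>- n x\<close>.\<close>

lemma conjugate_exists:
  fixes x :: real
  assumes F: "subfield F" and m: "is_minpoly F x m" and x: "x \<notin> F"
  shows "\<exists>c. c \<noteq> complex_of_real x \<and> poly (map_poly of_real m) c = 0"
proof (rule ccontr)
  assume contra: "\<not> ?thesis"
  define M where "M = map_poly complex_of_real m"
  define n where "n = degree m"
  have deg: "degree M = n" and lead: "lead_coeff M = 1"
    using m by (simp_all add: M_def n_def degree_map_poly coeff_map_poly is_minpoly_def)
  have "M \<noteq> 0"
    using lead by auto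
  have "proots M = replicate_mset n (of_real x)"
  proof -
    have "set_mset (proots M) \<subseteq> {of_real x}"
      using contra \<open>M \<noteq> 0\<close> by (auto simp: M_def[symmetric])
    then show ?thesis
      using size_proots_complex[of M] deg by (metis set_mset_subset_singletonD)
  qed
  then have "M = [:- of_real x, 1:] ^ n"
    using complex_poly_decompose_multiset[of M] lead by simp
  then have "coeff M (n - 1) = of_real (- of_nat n * x)"
    using minpoly_degree_pos[OF m] n_def
        coeff_linear_poly_power[of "n - 1" n "- complex_of_real x" 1]
      binomial_symmetric[of 1 n] by simp
  then have "of_real (coeff m (n - 1)) = complex_of_real (- of_nat n * x)"
    by (simp add: M_def coeff_map_poly)
  then have "coeff m (n - 1) = - of_nat n * x"
    by (simp only: of_real_eq_iff)
  moreover have "coeff m (n - 1) \<in> F"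
    using m by (simp add: is_minpoly_def poly_over_def)
  ultimately have "- (of_nat n * x) / of_nat n \<in> F"
    using subfieldD(8)[OF F _ subfield_of_nat[OF F], of "- (of_nat n * x)" n] by simp
  moreover have "n > 0"
    using minpoly_degree_pos[OF m] by (simp add: n_def)
  ultimately have "- x \<in> F"
    by simp
  then show False
    using subfieldD(5)[OF F, of "- x"] x by simp
qed

section \<open>Algebraic integers\<close>

text \<open>The characteristic polynomial of an integer matrix is monic with integer coefficients
  and has every eigenvalue as a root.\<close>

lemma algebraic_integer_eigenvalue:
  fixes x :: "'a::field_char_0" and v :: "nat \<Rightarrow> 'a" and M :: "nat \<Rightarrow> nat \<Rightarrow> int"
  assumes eig: "\<And>i. i < n \<Longrightarrow> x * v i = (\<Sum>j<n. of_int (M i j) * v j)" and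
      v: "k < n" "v k \<noteq> 0"
  shows "algebraic_integer x"
proof -
  define A where "A = mat n n (\<lambda>(i, j). M i j)"
  define B where "B = map_mat (of_int :: int \<Rightarrow> 'a) A"
  define w where "w = vec n v"
  have A: "A \<in> carrier_mat n n" and B: "B \<in> carrier_mat n n"
    by (auto simp: A_def B_def)
  have "B *\<^sub>v w = x \<cdot>\<^sub>v w"
    by (intro eq_vecI)
      (auto simp: B_def A_def w_def eig scalar_prod_def mult.commute atLeast0LessThan intro!: sum.cong)
  moreover have "w \<noteq> 0\<^sub>v n"
    using v by (metis index_vec index_zero_vec(1) w_def)
  ultimately have "eigenvalue B x"
    using B by (auto simp: eigenvalue_def eigenvector_def w_def intro!: exI[of _ w])
  then have "poly (char_poly B) x = 0"
    using eigenvalue_root_char_poly[OF B] by simp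
  moreover have "char_poly B = map_poly of_int (char_poly A)"
    unfolding B_def by (rule of_int_hom.char_poly_hom[OF A])
  moreover have "lead_coeff (char_poly A) = 1"
    using degree_monic_char_poly[OF A] by simp
  ultimately show ?thesis
    by (auto simp: algebraic_integer_def)
qed

definition zspan :: "'a::field_char_0 set \<Rightarrow> 'a set" where
  "zspan S = {\<Sum>s\<in>S. of_int (c s) * s | c. True}"

lemma zspan_0: "0 \<in> zspan S"
  by (auto simp: zspan_def intro!: exI[of _ "\<lambda>_. 0"])

lemma zspan_add: "a \<in> zspan S \<Longrightarrow> b \<in> zspan S \<Longrightarrow> a + b \<in> zspan S"
proof -
  assume "a \<in> zspan S" "b \<in> zspan S"
  then obtain c d where "a = (\<Sum>s\<in>S. of_int (c s) * s)" "b = (\<Sum>s\<in>S. of_int (d s) * s)"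
    by (auto simp: zspan_def)
  then show "a + b \<in> zspan S"
    by (auto simp: zspan_def sum.distrib algebra_simps intro!: exI[of _ "\<lambda>s. c s + d s"])
qed

lemma zspan_scale: "a \<in> zspan S \<Longrightarrow> of_int k * a \<in> zspan S"
proof -
  assume "a \<in> zspan S"
  then obtain c where "a = (\<Sum>s\<in>S. of_int (c s) * s)"
    by (auto simp: zspan_def)
  then show "of_int k * a \<in> zspan S"
    by (auto simp: zspan_def sum_distrib_left mult.assoc intro!: exI[of _ "\<lambda>s. k * c s"])
qed

lemma zspan_sum: "(\<And>i. i \<in> I \<Longrightarrow> f i \<in> zspan S) \<Longrightarrow> sum f I \<in> zspan S"
  by (induction I rule: infinite_finite_induct) (auto intro: zspan_0 zspan_add)

lemma zspan_base:
  assumes "finite S" "s \<in> S" shows "s \<in> zspan S"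
proof -
  have "s = (\<Sum>t\<in>S. of_int (if t = s then 1 else 0) * t)"
    using assms by (simp add: if_distrib if_distribR cong: if_cong)
  then show ?thesis
    unfolding zspan_def by (intro CollectI exI[of _ "\<lambda>t. if t = s then 1 else 0"]) simp
qed

lemma zspan_mult_closed:
  assumes "\<And>s. s \<in> S \<Longrightarrow> a * s \<in> zspan S" "t \<in> zspan S"
  shows "a * t \<in> zspan S"
proof -
  obtain c where "t = (\<Sum>s\<in>S. of_int (c s) * s)"
    using assms(2) by (auto simp: zspan_def)
  then have "a * t = (\<Sum>s\<in>S. of_int (c s) * (a * s))"
    by (simp add: sum_distrib_left algebra_simps)
  then show ?thesis
    by (simp add: zspan_sum zspan_scale assms(1))
qed

text \<open>The determinant trick: multiplication by \<open>x\<close> acts on the generators of a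
  finitely generated module by an integer matrix, and the vector of generators is an
  eigenvector.\<close>

lemma algebraic_integer_if_zspan:
  assumes "finite S" "s \<in> S" "s \<noteq> 0" and
      "\<And>s. s \<in> S \<Longrightarrow> x * s \<in> zspan S"
  shows "algebraic_integer x"
proof -
  define n where "n = card S"
  obtain v where v: "bij_betw v {..<n} S"
    using ex_bij_betw_nat_finite[OF assms(1)] by (auto simp: n_def atLeast0LessThan)
  obtain k where k: "k < n" "v k \<noteq> 0"
    using v assms(2,3) by (metis bij_betw_iff_bijections lessThan_iff)
  have "\<forall>s\<in>S. \<exists>c. x * s = (\<Sum>t\<in>S. of_int (c t) * t)"
    using assms(4) by (auto simp: zspan_def)
  then obtain c where c: "\<And>s. s \<in> S \<Longrightarrow> x * s = (\<Sum>t\<in>S. of_int (c s t) * t)"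
    by metis
  have "x * v i = (\<Sum>j<n. of_int (c (v i) (v j)) * v j)" if "i < n" for i
    using c[of "v i"] v that sum.reindex_bij_betw[OF v, of "\<lambda>t. of_int (c (v i) t) * t"]
    by (auto simp: bij_betw_def)
  then show ?thesis
    using algebraic_integer_eigenvalue[of n x v "\<lambda>i j. c (v i) (v j)"] k by blast
qed

text \<open>The products of low powers of \<open>a\<close> and \<open>b\<close> generate a module
  that is stable under multiplication by \<open>a\<close> and by \<open>b\<close>, hence also under
  \<open>a + b\<close> and \<open>a * b\<close>.\<close>

lemma algebraic_integer_ring:
  fixes a b :: "'a::field_char_0"
  assumes "algebraic_integer a" "algebraic_integer b"
  shows "algebraic_integer (a + b)" "algebraic_integer (a * b)"
proof -
  have powers: "\<exists>m>0. a ^ m \<in> zspan ((^) a ` {..<m})" if a: "algebraic_integer a" for a :: 'a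
  proof -
    obtain p :: "int poly" where p: "lead_coeff p = 1" "poly (map_poly of_int p) a = 0"
      using a by (auto simp: algebraic_integer_def)
    define m where "m = degree p"
    have "m \<noteq> 0"
    proof
      assume "m = 0"
      then have "p = [:1:]"
        using p(1) by (metis degree_eq_zeroE lead_coeff_pCons(2) m_def)
      then show False
        using p(2) by simp
    qed
    have "degree (map_poly (of_int :: int \<Rightarrow> 'a) p) = m"
      using p by (simp add: m_def degree_map_poly)
    then have "0 = (\<Sum>i\<le>m. of_int (coeff p i) * a ^ i)"
      using p(2) by (simp add: poly_altdef coeff_map_poly)
    also have "{..m} = insert m {..<m}"
      by auto
    finally have "a ^ m = (\<Sum>i<m. of_int (- coeff p i) * a ^ i)"
      using p(1) by (simp add: m_def add_eq_0_iff sum_negf)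
    also have "\<dots> \<in> zspan ((^) a ` {..<m})"
      by (intro zspan_sum zspan_scale zspan_base) auto
    finally show ?thesis
      using \<open>m \<noteq> 0\<close> by auto
  qed
  obtain m where m: "m > 0" "a ^ m \<in> zspan ((^) a ` {..<m})"
    using powers[OF assms(1)] by blast
  obtain n where n: "n > 0" "b ^ n \<in> zspan ((^) b ` {..<n})"
    using powers[OF assms(2)] by blast
  \<comment> \<open>Coincidences between these products are harmless: they have to generate, not to
    be independent.\<close>
  define S where "S = (\<lambda>(i, j). a ^ i * b ^ j) ` ({..<m} \<times> {..<n})"
  have fin: "finite S"
    by (simp add: S_def)
  have mem: "a ^ i * b ^ j \<in> S" "b ^ j * a ^ i \<in> S" if "i < m" "j < n" for i j
    using that unfolding S_def by (auto intro!: image_eqI[of _ _ "(i, j)"] simp: mult.commute)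
  have sub: "t * u \<in> zspan S" if "t \<in> zspan A" "finite A" "\<And>s. s \<in> A \<Longrightarrow> s * u \<in> S" for t u A
  proof -
    obtain c where "t = (\<Sum>s\<in>A. of_int (c s) * s)"
      using \<open>t \<in> zspan A\<close> by (auto simp: zspan_def)
    then have "t * u = (\<Sum>s\<in>A. of_int (c s) * (s * u))"
      by (simp add: sum_distrib_right mult.assoc)
    also have "\<dots> \<in> zspan S"
      using that(3) by (intro zspan_sum zspan_scale zspan_base fin) auto
    finally show ?thesis .
  qed
  have a: "a * s \<in> zspan S" if s: "s \<in> S" for s
  proof -
    obtain i j where ij: "i < m" "j < n" "s = a ^ i * b ^ j"
      using s by (auto simp: S_def)
    show ?thesis
    proof (cases "Suc i < m")
      case True
      then have "a * s \<in> S"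
        using ij unfolding S_def by (intro image_eqI[of _ _ "(Suc i, j)"]) auto
      then show ?thesis
        using zspan_base[OF fin] by blast
    next
      case False
      then have "a * s = a ^ m * b ^ j"
        using ij by (metis Suc_lessI power_Suc mult.assoc)
      moreover have "a ^ m * b ^ j \<in> zspan S"
        using ij by (intro sub[OF m(2)]) (auto intro: mem)
      ultimately show ?thesis
        by simp
    qed
  qed
  have b: "b * s \<in> zspan S" if s: "s \<in> S" for s
  proof -
    obtain i j where ij: "i < m" "j < n" "s = a ^ i * b ^ j"
      using s by (auto simp: S_def)
    show ?thesis
    proof (cases "Suc j < n")
      case True
      then have "b * s \<in> S"
        using ij unfolding S_def by (intro image_eqI[of _ _ "(i, Suc j)"]) (auto simp: mult_ac)
      then show ?thesis
        using zspan_base[OF fin] by blast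
    next
      case False
      then have "b * s = b ^ n * a ^ i"
        using ij by (metis Suc_lessI power_Suc mult.assoc mult.commute)
      moreover have "b ^ n * a ^ i \<in> zspan S"
        using ij by (intro sub[OF n(2)]) (auto intro: mem)
      ultimately show ?thesis
        by simp
    qed
  qed
  have one: "1 \<in> S"
    using m n unfolding S_def by (intro image_eqI[of _ _ "(0, 0)"]) auto
  have "(a + b) * s \<in> zspan S" if "s \<in> S" for s
    using a[OF that] b[OF that] by (simp add: distrib_right zspan_add)
  then show "algebraic_integer (a + b)"
    using algebraic_integer_if_zspan[OF fin one] by simp
  have "(a * b) * s \<in> zspan S" if "s \<in> S" for s
    using zspan_mult_closed[OF a b[OF that]] by (simp add: mult.assoc)
  then show "algebraic_integer (a * b)"
    using algebraic_integer_if_zspan[OF fin one] by simp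
qed

lemma algebraic_integer_of_int: "algebraic_integer (of_int k)"
  unfolding algebraic_integer_def by (intro exI[of _ "[:- k, 1:]"]) simp

lemma algebraic_integer_numeral: "algebraic_integer (numeral k)"
  using algebraic_integer_of_int[of "numeral k"] by simp

lemma algebraic_integer_1: "algebraic_integer 1"
  using algebraic_integer_of_int[of 1] by simp

lemma algebraic_integer_diff:
  fixes a b :: "'a::field_char_0"
  shows "algebraic_integer a \<Longrightarrow> algebraic_integer b \<Longrightarrow> algebraic_integer (a - b)"
  using algebraic_integer_ring(1)[of a "- b"] algebraic_integer_ring(2)[of "- 1" b]
    algebraic_integer_of_int[of "- 1", where ?'a = 'a] by simp

lemma algebraic_integer_prod_mset:
  "(\<And>x. x \<in># A \<Longrightarrow> algebraic_integer (f x)) \<Longrightarrow> algebraic_integer (\<Prod>x\<in>#A. f x)"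
  by (induction A) (auto intro: algebraic_integer_1 algebraic_integer_ring)

lemma rational_algebraic_integer:
  fixes x :: "'a::field_char_0"
  assumes "algebraic_integer x" "x \<in> \<rat>" shows "x \<in> \<int>"
  using assms rational_algebraic_int_is_int[of x]
  by (auto simp: algebraic_integer_def algebraic_int_altdef_ipoly)

section \<open>Conjugates of a generator\<close>

lemma subfield_gen_field: "subfield (gen_field S)"
  unfolding gen_field_def subfield_def is_subfield_eq_subfield by (auto intro: subfieldD)

lemma gen_field_base: "S \<subseteq> gen_field S"
  by (auto simp: gen_field_def)

lemma gen_field_least: "subfield F \<Longrightarrow> S \<subseteq> F \<Longrightarrow> gen_field S \<subseteq> F"
  by (auto simp: gen_field_def is_subfield_eq_subfield)

lemma field_embedding_subset: "field_embedding F \<sigma> \<Longrightarrow> G \<subseteq> F \<Longrightarrow> field_embedding G \<sigma>"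
  unfolding field_embedding_def by blast

lemma field_embedding_of_real: "field_embedding F (of_real :: real \<Rightarrow> 'a::{real_algebra_1,field})"
  by (simp add: field_embedding_def)

text \<open>Adjoins the generators one at a time. The field reached need not be the one they
  generate; it is enough that it contains it, since the embedding can be restricted
  afterwards.\<close>

lemma extend_embedding_list:
  fixes \<sigma> :: "real \<Rightarrow> complex"
  assumes "subfield E" "field_embedding E \<sigma>" "\<forall>x\<in>set xs. algebraic_over \<rat> x"
  shows "\<exists>E' \<tau>. subfield E' \<and> E \<subseteq> E' \<and> set xs \<subseteq> E' \<and> field_embedding E' \<tau> \<and> (\<forall>a\<in>E. \<tau> a = \<sigma> a)"
  using assms
proof (induction xs arbitrary: E \<sigma>)
  case Nil
  then show ?case
    by auto
next
  case (Cons x xs)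
  have x: "algebraic_over E x"
    using Cons.prems Rats_subset_subfield algebraic_over_mono by (metis list.set_intros(1))
  obtain \<tau> where \<tau>: "field_embedding (adjoin E x) \<tau>" "\<forall>a\<in>E. \<tau> a = \<sigma> a"
    using extend_complex_embedding[OF Cons.prems(1,2) x] by blast
  obtain E' \<tau>' where "subfield E'" "adjoin E x \<subseteq> E'" "set xs \<subseteq> E'" "field_embedding E' \<tau>'"
      "\<forall>a\<in>adjoin E x. \<tau>' a = \<tau> a"
    using Cons.IH[OF subfield_adjoin[OF Cons.prems(1) x] \<tau>(1)] Cons.prems(3) by auto
  then show ?case
    using \<tau> subset_adjoin[OF Cons.prems(1), of x] in_adjoin[OF Cons.prems(1), of x]
    by (intro exI[of _ E'] exI[of _ \<tau>']) (auto simp: subset_iff)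
qed

text \<open>A basis is a set of reals, so the powers of \<alpha> below the degree must be shown
  distinct, and \<open>e\<close> recovers the exponent from a power.\<close>

lemma q_basis_powers:
  assumes m: "is_minpoly \<rat> \<alpha> m"
  shows "degree_over_Q_le (adjoin \<rat> \<alpha>) (degree m)"
proof -
  define N where "N = degree m"
  have R: "subfield (\<rat> :: real set)"
    by (rule subfield_Rats)
  \<comment> \<open>Minimality of \<open>m\<close> in the form that yields both the distinctness and
    the independence of the powers.\<close>
  have low: "p = 0" if "p \<in> poly_over \<rat>" "poly p \<alpha> = 0" "\<And>i. i \<ge> N \<Longrightarrow> coeff p i = 0" for p
  proof (rule ccontr)
    assume "p \<noteq> 0"
    then have "N \<le> degree p"
      using m that by (auto simp: is_minpoly_def N_def)
    then show False
      using that(3)[of "degree p"] \<open>p \<noteq> 0\<close> by simp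
  qed
  have inj: "inj_on (\<lambda>i. \<alpha> ^ i) {..<N}"
  proof (rule inj_onI)
    fix i j assume ij: "i \<in> {..<N}" "j \<in> {..<N}" "\<alpha> ^ i = \<alpha> ^ j"
    have "Polynomial.monom 1 i - Polynomial.monom 1 j = (0 :: real poly)"
      using ij by (intro low poly_over_diff[OF R] poly_over_monom[OF R]) (auto simp: poly_monom)
    then show "i = j"
      by (simp add: monom_eq_iff')
  qed
  define B where "B = (\<lambda>i. \<alpha> ^ i) ` {..<N}"
  have fin: "finite B" and card: "card B \<le> N"
    using inj by (auto simp: B_def card_image)
  define e where "e x = the_inv_into {..<N} (\<lambda>i. \<alpha> ^ i) x" for x
  have e: "e (\<alpha> ^ i) = i" if "i < N" for i
    using the_inv_into_f_f[OF inj] that by (simp add: e_def)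
  have "q_independent B"
    unfolding q_independent_def
  proof (intro allI impI ballI)
    fix T c x assume T: "finite T \<and> T \<subseteq> B \<and> (\<Sum>x\<in>T. of_rat (c x) * x) = (0 :: real)" and x: "x \<in> T"
    define p where "p = (\<Sum>x\<in>T. Polynomial.monom (of_rat (c x) :: real) (e x))"
    have pow: "e x < N" "x = \<alpha> ^ e x" if "x \<in> T" for x
      using T that e by (auto simp: B_def)
    have coeff: "coeff p i = (\<Sum>x\<in>T. if e x = i then of_rat (c x) else 0)" for i
      by (simp add: p_def coeff_sum)
    have "p = 0"
    proof (rule low)
      show "p \<in> poly_over \<rat>"
        by (auto simp: poly_over_def coeff intro!: subfield_sum[OF R])
      have "poly p \<alpha> = (\<Sum>x\<in>T. of_rat (c x) * \<alpha> ^ e x)"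
        by (simp add: p_def poly_sum poly_monom)
      also have "\<dots> = (\<Sum>x\<in>T. of_rat (c x) * x)"
        using pow(2) by (intro sum.cong) auto
      finally show "poly p \<alpha> = 0"
        using T by simp
      show "coeff p i = 0" if "i \<ge> N" for i
        using pow(1) that unfolding coeff by (intro sum.neutral) fastforce
    qed
    then have "0 = (\<Sum>y\<in>T. if e y = e x then of_rat (c y) else (0 :: real))"
      using coeff[of "e x"] by simp
    also have "\<dots> = (\<Sum>y\<in>T. if y = x then of_rat (c y) else 0)"
      using pow(2) x by (intro sum.cong refl if_cong) metis+
    also have "\<dots> = of_rat (c x)"
      using T x by simp
    finally show "c x = 0"
      by simp
  qed
  moreover have "q_span B = adjoin \<rat> \<alpha>"
  proof (intro equalityI subsetI)
    fix t assume "t \<in> q_span B"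
    then obtain T c where T: "finite T" "T \<subseteq> B" "t = (\<Sum>x\<in>T. of_rat (c x) * x)"
      unfolding q_span_def by blast
    define p where "p = (\<Sum>x\<in>T. Polynomial.monom (of_rat (c x) :: real) (e x))"
    have "p \<in> poly_over \<rat>"
      unfolding poly_over_def p_def by (auto simp: coeff_sum intro!: subfield_sum[OF R])
    moreover have "poly p \<alpha> = t"
      using T(2) e unfolding T(3) p_def by (auto simp: poly_sum poly_monom B_def intro!: sum.cong)
    ultimately show "t \<in> adjoin \<rat> \<alpha>"
      unfolding adjoin_def by auto
  next
    fix t assume "t \<in> adjoin \<rat> \<alpha>"
    then obtain g where g: "g \<in> poly_over \<rat>" "t = poly g \<alpha>"
      by (auto simp: adjoin_def)
    have "m \<in> poly_over \<rat>" "m \<noteq> 0"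
      using m by (auto simp: is_minpoly_def)
    then obtain d r where r: "r \<in> poly_over \<rat>" "g = d * m + r" "r = 0 \<or> degree r < N"
      using poly_over_division[OF R _ _ g(1)] unfolding N_def by blast
    have "t = poly r \<alpha>"
      using m by (simp add: g r(2) is_minpoly_def)
    also have "\<dots> = (\<Sum>i<N. coeff r i * \<alpha> ^ i)"
    proof (cases "r = 0")
      case False
      then have "(\<Sum>i<N. coeff r i * \<alpha> ^ i) = (\<Sum>i\<le>degree r. coeff r i * \<alpha> ^ i)"
        using r(3) by (intro sum.mono_neutral_right) (auto simp: coeff_eq_0)
      then show ?thesis
        by (simp add: poly_altdef)
    qed auto
    also have "\<dots> = (\<Sum>x\<in>B. coeff r (e x) * x)"
      unfolding B_def by (subst sum.reindex[OF inj]) (simp add: e)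
    finally have t: "t = (\<Sum>x\<in>B. coeff r (e x) * x)" .
    have "\<forall>x. \<exists>c. coeff r (e x) = of_rat c"
      using r(1) by (auto simp: poly_over_def Rats_def)
    then obtain c where "\<And>x. coeff r (e x) = of_rat (c x)"
      by metis
    then show "t \<in> q_span B"
      unfolding q_span_def using t fin by auto
  qed
  ultimately show ?thesis
    unfolding degree_over_Q_le_def q_basis_def using fin card N_def by blast
qed

text \<open>If no embedding of \<open>L\<close> other than the inclusion fixes \<open>\<alpha>\<close>, then \<open>\<alpha>\<close> generates \<open>K\<close>, and the
  conjugates of \<open>\<alpha>\<close> enumerate the embeddings of \<open>K\<close>.\<close>

lemma conjugate_embeddings:
  fixes \<alpha> :: real
  assumes \<alpha>: "algebraic_integer \<alpha>" "\<alpha> \<in> K"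
    and K: "K = gen_field C" "\<forall>c\<in>C. algebraic_integer c"
    and xs: "\<forall>x\<in>set xs. algebraic_over \<rat> x"
    and L:
        "\<And>E. subfield E \<Longrightarrow> set xs \<subseteq> E \<Longrightarrow> L \<subseteq> E"
        "subfield L" "K \<subseteq> L"
    and real: "totally_real_field L"
    and fix_\<alpha>:
        "\<And>\<phi> :: real \<Rightarrow> real. field_embedding L \<phi> \<Longrightarrow> \<phi> \<alpha> = \<alpha> \<Longrightarrow> \<forall>x\<in>K. \<phi> x = x"
  obtains \<Phi> :: "(real \<Rightarrow> real) set" and \<phi>\<^sub>0 where
    "finite \<Phi>" "degree_over_Q_le K (card \<Phi>)" "\<phi>\<^sub>0 \<in> \<Phi>" "\<forall>x\<in>K. \<phi>\<^sub>0 x = x"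
    "\<And>\<phi>. \<phi> \<in> \<Phi> \<Longrightarrow> field_embedding L \<phi>"
    "\<And>\<phi>. \<phi> \<in> \<Phi> - {\<phi>\<^sub>0} \<Longrightarrow> \<phi> \<alpha> \<noteq> \<alpha>"
    "\<And>t. t \<in> K \<Longrightarrow> algebraic_integer t \<Longrightarrow> t \<noteq> 0 \<Longrightarrow> 1 \<le> (\<Prod>\<phi>\<in>\<Phi>. \<bar>\<phi> t\<bar>)"
proof -
  have R: "subfield (\<rat> :: real set)" and RC: "subfield (\<rat> :: complex set)"
    by (rule subfield_Rats)+
  have alg: "algebraic_over \<rat> \<alpha>"
    by (rule algebraic_over_Rats[OF \<alpha>(1)])
  define E where "E = adjoin \<rat> \<alpha>"
  have E: "subfield E" "\<alpha> \<in> E" "\<rat> \<subseteq> E"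
    using subfield_adjoin[OF R alg] in_adjoin[OF R] subset_adjoin[OF R] by (auto simp: E_def)
  \<comment> \<open>Extend the embedding to a field that contains the generators \<open>xs\<close>,
    restrict it to \<open>L\<close>, and use total reality: its real part is then an embedding of
    \<open>L\<close> into the reals.\<close>
  have to_L: "\<exists>\<tau>. field_embedding L \<tau> \<and> (\<forall>a\<in>F. \<tau> a = \<sigma> a) \<and> (\<forall>x\<in>L. \<tau> x = of_real (Re (\<tau> x)))
      \<and> field_embedding L (\<lambda>x. Re (\<tau> x))"
    if F: "subfield F" "field_embedding F \<sigma>" for F and \<sigma> :: "real \<Rightarrow> complex"
  proof -
    obtain E' \<tau> where E': "subfield E'" "set xs \<subseteq> E'" "field_embedding E' \<tau>" "\<forall>a\<in>F. \<tau> a = \<sigma> a"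
      using extend_embedding_list[OF F xs] by blast
    have \<tau>: "field_embedding L \<tau>"
      using field_embedding_subset[OF E'(3) L(1)[OF E'(1,2)]] .
    have re: "\<tau> x = of_real (Re (\<tau> x))" if "x \<in> L" for x
      using real \<tau> that unfolding totally_real_field_def by (simp add: complex_is_Real_iff
          complex_eq_iff)
    have im: "Im (\<tau> x) = 0" if "x \<in> L" for x
      using re[OF that] by (metis Im_complex_of_real)
    have "field_embedding L (\<lambda>x. Re (\<tau> x))"
      using \<tau> im by (auto simp: field_embedding_def)
    then show ?thesis
      using E' \<tau> re by blast
  qed
  \<comment> \<open>A generator \<open>t\<close> outside \<open>E\<close> would have a second
    conjugate over \<open>E\<close>. The resulting embedding of \<open>L\<close> fixes \<alpha> but
    moves \<open>t\<close>, against \<open>fix_\<alpha>\<close>.\<close>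
  have "C \<subseteq> E"
  proof (rule subsetI, rule ccontr)
    fix t assume t: "t \<in> C" "t \<notin> E"
    have "algebraic_over E t"
      using algebraic_over_mono[OF E(3) algebraic_over_Rats] K t by blast
    then obtain m where m: "is_minpoly E t m"
      using minpoly_exists[OF E(1)] by blast
    obtain c where c: "c \<noteq> complex_of_real t" "poly (map_poly of_real m) c = 0"
      using conjugate_exists[OF E(1) m t(2)] by blast
    obtain \<sigma> where \<sigma>: "field_embedding (adjoin E t) \<sigma>" "\<forall>a\<in>E. \<sigma> a = of_real a" "\<sigma> t = c"
      using extend_embedding[OF E(1) field_embedding_of_real m c(2)] by blast
    obtain \<tau> where \<tau>: "\<forall>a\<in>adjoin E t. \<tau> a = \<sigma> a" "field_embedding L (\<lambda>x. Re (\<tau> x))"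
        "\<forall>x\<in>L. \<tau> x = of_real (Re (\<tau> x))"
      using to_L[OF subfield_adjoin[OF E(1) \<open>algebraic_over E t\<close>] \<sigma>(1)] by blast
    have "t \<in> K"
      using t(1) K(1) gen_field_base by blast
    have "Re (\<tau> \<alpha>) = \<alpha>"
      using \<tau>(1) \<sigma>(2) E(2) subset_adjoin[OF E(1), of t] by auto
    then have "Re (\<tau> t) = t"
      using fix_\<alpha>[OF \<tau>(2)] \<open>t \<in> K\<close> by blast
    then have "\<tau> t = of_real t"
      using \<tau>(3) \<open>t \<in> K\<close> L(3) by (metis subsetD)
    then show False
      using \<tau>(1) \<sigma>(3) c(1) in_adjoin[OF E(1), of t] by auto
  qed
  then have "K \<subseteq> E"
    using gen_field_least[OF E(1)] K(1) by simp
  moreover have "E \<subseteq> K"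
    unfolding E_def adjoin_def poly_altdef poly_over_def K(1)
    using Rats_subset_subfield[OF subfield_gen_field, of C] \<alpha>(2) K(1)
    by (auto intro!: subfield_sum[OF subfield_gen_field] subfieldD[OF subfield_gen_field])
  ultimately have KE: "K = E"
    by blast
  obtain m where m: "is_minpoly \<rat> \<alpha> m"
    using minpoly_exists[OF R alg] by blast
  define M where "M = map_poly complex_of_real m"
  have degM: "degree M = degree m" and leadM: "lead_coeff M = 1"
    using degree_map_minpoly[OF R field_embedding_of_real m] by (simp_all add: M_def)
  have M: "M \<in> poly_over \<rat>" "M \<noteq> 0"
    using m leadM by (auto simp: M_def is_minpoly_def poly_over_def coeff_map_poly)
  define Z where "Z = {c. poly M c = 0}"
  have "\<forall>c\<in>Z. \<exists>\<tau>. field_embedding L \<tau> \<and> (\<forall>a\<in>\<rat>. \<tau> a = of_real a) \<and> \<tau> \<alpha> = c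
      \<and> (\<forall>x\<in>L. \<tau> x = of_real (Re (\<tau> x))) \<and> field_embedding L (\<lambda>x. Re (\<tau> x))"
  proof
    fix c assume c: "c \<in> Z"
    then have "poly (map_poly of_real m) c = 0"
      by (simp add: Z_def M_def)
    then obtain \<sigma> where \<sigma>: "field_embedding E \<sigma>" "\<forall>a\<in>\<rat>. \<sigma> a = of_real a" "\<sigma> \<alpha> = c"
      using extend_embedding[OF R field_embedding_of_real m] unfolding E_def by blast
    obtain \<tau> where \<tau>: "field_embedding L \<tau>" "\<forall>a\<in>E. \<tau> a = \<sigma> a"
        "\<forall>x\<in>L. \<tau> x = of_real (Re (\<tau> x))" "field_embedding L (\<lambda>x. Re (\<tau> x))"
      using to_L[OF E(1) \<sigma>(1)] by blast
    have "\<forall>a\<in>\<rat>. \<tau> a = of_real a" "\<tau> \<alpha> = c"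
      using \<tau>(2) \<sigma>(2,3) E(2,3) by auto
    with \<tau> show "\<exists>\<tau>. field_embedding L \<tau> \<and> (\<forall>a\<in>\<rat>. \<tau> a = of_real a) \<and> \<tau> \<alpha> = c
      \<and> (\<forall>x\<in>L. \<tau> x = of_real (Re (\<tau> x))) \<and> field_embedding L (\<lambda>x. Re (\<tau> x))"
      by blast
  qed
  from bchoice[OF this] obtain \<tau> where \<tau>': "\<forall>c\<in>Z. field_embedding L (\<tau> c) \<and>
      (\<forall>a\<in>\<rat>. \<tau> c a = of_real a) \<and> \<tau> c \<alpha> = c \<and> (\<forall>x\<in>L. \<tau> c x = of_real (Re (\<tau> c x))) \<and>
      field_embedding L (\<lambda>x. Re (\<tau> c x))" ..
  have \<tau>: "field_embedding L (\<tau> c)" "a \<in> \<rat> \<Longrightarrow> \<tau> c a = of_real a" "\<tau> c \<alpha> = c"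
      "x \<in> L \<Longrightarrow> \<tau> c x = of_real (Re (\<tau> c x))" "field_embedding L (\<lambda>x. Re (\<tau> c x))"
    if "c \<in> Z" for c a x
    using \<tau>' that by blast+
  have "\<alpha> \<in> L"
    using \<alpha>(2) L(3) by blast
  have \<tau>_poly: "\<tau> c (poly g \<alpha>) = poly (map_poly of_real g) c" if "c \<in> Z" "g \<in> poly_over \<rat>" for c g
  proof -
    have g: "g \<in> poly_over L"
      using that(2) Rats_subset_subfield[OF L(2)] poly_over_mono by blast
    have "map_poly (\<tau> c) g = map_poly of_real g"
      using that \<tau>(2) embedding_0[OF L(2) \<tau>(1)]
      by (intro poly_eqI) (simp add: coeff_map_poly poly_over_def)
    then show ?thesis
      using embedding_poly[OF L(2) \<tau>(1) g \<open>\<alpha> \<in> L\<close>] that \<tau>(3) by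
          simp
  qed
  \<comment> \<open>By minimality the derivative of \<open>m\<close> does not vanish at \<alpha>;
    the embedding that takes \<alpha> to \<open>c\<close> carries this over to \<open>c\<close>. So
    there are as many embeddings as the degree of \<open>m\<close>.\<close>
  have simple: "poly (pderiv M) c \<noteq> 0" if "c \<in> Z" for c
  proof -
    have d: "pderiv m \<in> poly_over \<rat>"
      using m poly_over_pderiv[OF R] by (simp add: is_minpoly_def)
    have "degree (pderiv m) < degree m" "pderiv m \<noteq> 0"
      using minpoly_degree_pos[OF m] by (auto simp: degree_pderiv pderiv_eq_0_iff)
    then have "poly (pderiv m) \<alpha> \<noteq> 0"
      using m d by (auto simp: is_minpoly_def)
    moreover have "poly (pderiv m) \<alpha> \<in> L"
      using d E_def KE L(3) by (auto simp: adjoin_def)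
    ultimately have "\<tau> c (poly (pderiv m) \<alpha>) \<noteq> 0"
      using embedding_nonzero[OF L(2) \<tau>(1)[OF that]] by blast
    moreover have "map_poly of_real (pderiv m) = pderiv M"
      by (intro poly_eqI) (simp add: M_def coeff_map_poly coeff_pderiv)
    ultimately show ?thesis
      using \<tau>_poly[OF that d] by simp
  qed
  have "finite Z"
    using M by (simp add: Z_def poly_roots_finite)
  have proots: "proots M = mset_set Z"
  proof (rule multiset_eqI)
    fix c
    have "rsquarefree M"
      using simple unfolding rsquarefree_roots Z_def by blast
    then have "order c M = 0 \<or> order c M = 1"
      by (simp add: rsquarefree_def)
    then show "count (proots M) c = count (mset_set Z) c"
      using M \<open>finite Z\<close> by (auto simp: Z_def order_root count_mset_set')
  qed
  define \<phi> where "\<phi> c = (\<lambda>x. Re (\<tau> c x))" for c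
  have \<phi>: "\<tau> c x = of_real (\<phi> c x)" if "c \<in> Z" "x \<in> L" for c x
    using \<tau>(4)[OF that] by (simp add: \<phi>_def)
  have inj: "inj_on \<phi> Z"
  proof (rule inj_onI)
    fix c d assume "c \<in> Z" "d \<in> Z" "\<phi> c = \<phi> d"
    then have "\<tau> c \<alpha> = \<tau> d \<alpha>"
      using \<phi> \<open>\<alpha> \<in> L\<close> by simp
    then show "c = d"
      using \<tau>(3) \<open>c \<in> Z\<close> \<open>d \<in> Z\<close> by simp
  qed
  show ?thesis
  proof (rule that[of "\<phi> ` Z" "\<phi> (of_real \<alpha>)"])
    show "finite (\<phi> ` Z)"
      using \<open>finite Z\<close> by simp
    have "card (\<phi> ` Z) = size (proots M)"
      using inj by (simp add: card_image proots)
    also have "\<dots> = degree m"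
      by (simp add: size_proots_complex degM)
    finally show "degree_over_Q_le K (card (\<phi> ` Z))"
      using q_basis_powers[OF m] by (simp add: KE E_def)
    have "poly M (of_real \<alpha>) = of_real (poly m \<alpha>)"
      unfolding M_def by (induction m) (simp_all add: map_poly_pCons)
    then have "of_real \<alpha> \<in> Z"
      using m by (simp add: Z_def is_minpoly_def)
    then show "\<phi> (of_real \<alpha>) \<in> \<phi> ` Z"
      by simp
    show "\<forall>x\<in>K. \<phi> (of_real \<alpha>) x = x"
      using fix_\<alpha>[of "\<phi> (of_real \<alpha>)" ] \<tau>(3,5)[OF \<open>of_real \<alpha>
          \<in> Z\<close>] by (simp add: \<phi>_def)
    show "field_embedding L f" if "f \<in> \<phi> ` Z" for f
      using that \<tau>(5) by (auto simp: \<phi>_def)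
    show "f \<alpha> \<noteq> \<alpha>" if f: "f \<in> \<phi> ` Z - {\<phi> (of_real \<alpha>)}" for f
    proof
      assume fa: "f \<alpha> = \<alpha>"
      obtain c where c: "c \<in> Z" "f = \<phi> c" "\<phi> c \<noteq> \<phi> (of_real \<alpha>)"
        using f by auto
      then have "c = of_real \<alpha>"
        using \<phi>[OF c(1) \<open>\<alpha> \<in> L\<close>] \<tau>(3)[OF c(1)] fa c(2) by simp
      then show False
        using c(3) by simp
    qed
    \<comment> \<open>The product of the conjugates of \<open>t\<close> is an algebraic integer, and
      it is rational as a product over all roots of \<open>M\<close>. So it is a nonzero
      integer.\<close>
    show "1 \<le> (\<Prod>f\<in>\<phi> ` Z. \<bar>f t\<bar>)" if t: "t \<in> K" "algebraic_integer t" "t \<noteq> 0" for t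
    proof -
      obtain g where g: "g \<in> poly_over \<rat>" "t = poly g \<alpha>"
        using t KE by (auto simp: E_def adjoin_def)
      have tL: "t \<in> L"
        using t L(3) by blast
      define P where "P = (\<Prod>c\<in>#proots M. poly (map_poly of_real g) c)"
      have P: "P = (\<Prod>c\<in>Z. \<tau> c t)"
        unfolding P_def proots using \<tau>_poly g by (simp add: prod_unfold_prod_mset[symmetric]
            cong: prod.cong)
      have "algebraic_integer (\<tau> c t)" if "c \<in> Z" for c
        using embedding_algebraic_integer[OF L(2) \<tau>(1)[OF that] tL t(2)]
        unfolding algebraic_integer_def .
      then have "algebraic_integer P"
        unfolding P prod_unfold_prod_mset
        by (intro algebraic_integer_prod_mset) (use \<open>finite Z\<close> in auto)
      moreover have "P \<in> \<rat>"
        unfolding P_def using g(1)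
        by (intro prod_over_roots_in_subfield[OF RC M]) (auto simp: poly_over_def coeff_map_poly)
      ultimately obtain k :: int where k: "P = of_int k"
        using rational_algebraic_integer by (auto elim: Ints_cases)
      have "P \<noteq> 0"
        unfolding P using \<open>finite Z\<close> embedding_nonzero[OF L(2) \<tau>(1) tL t(3)] by
            simp
      then have "1 \<le> \<bar>k\<bar>"
        using k by auto
      then have "1 \<le> norm P"
        unfolding k by (simp only: norm_of_int)
      also have "norm P = (\<Prod>c\<in>Z. \<bar>\<phi> c t\<bar>)"
        unfolding P using \<phi> tL by (simp add: prod_norm[symmetric] cong: prod.cong)
      also have "\<dots> = (\<Prod>f\<in>\<phi> ` Z. \<bar>f t\<bar>)"
        using inj by (simp add: prod.reindex)
      finally show ?thesis .
    qed
  qed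
qed

section \<open>The path matrix\<close>

lemma path_matrix_entry:
  "i < 4 \<Longrightarrow> j < 4 \<Longrightarrow> path_matrix u s k $$ (i, j) =
     (if i = j then -2
      else if {i, j} = {0, 1} then u
      else if {i, j} = {0, 2} then 2 * cos (pi / real s)
      else if {i, j} = {1, 3} then 2 * cos (pi / real k)
      else 0)"
  by (simp add: path_matrix_def)

lemma path_matrix_dim [simp]: "dim_row (path_matrix u s k) = 4" "dim_col (path_matrix u s k) = 4"
  by (simp_all add: path_matrix_def)

lemma entries_path_matrix:
  "entries (path_matrix u s k) = {-2, 0, u, 2 * cos (pi / real s), 2 * cos (pi / real k)}" (is "?l = ?r")
proof
  have "(if b1 then -2 else if b2 then u else if b3 then 2 * cos (pi / real s)
      else if b4 then 2 * cos (pi / real k) else 0) \<in> ?r" for b1 b2 b3 b4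
    by simp
  then have "path_matrix u s k $$ (i, j) \<in> ?r" if "i < 4" "j < 4" for i j
    using that by (simp only: path_matrix_entry)
  then show "?l \<subseteq> ?r"
    unfolding entries_def by fastforce
  have "path_matrix u s k $$ (i, j) \<in> ?l" if "i < 4" "j < 4" for i j
    using that by (auto simp: entries_def)
  from this[of 0 0] this[of 0 3] this[of 0 1] this[of 0 2] this[of 1 3] show "?r \<subseteq> ?l"
    by (simp add: path_matrix_entry doubleton_eq_iff)
qed

lemma cyclic_products_path_matrix:
  "u\<^sup>2 \<in> cyclic_products (path_matrix u s k)"
  "(2 * cos (pi / real s))\<^sup>2 \<in> cyclic_products (path_matrix u s k)"
  "(2 * cos (pi / real k))\<^sup>2 \<in> cyclic_products (path_matrix u s k)"
proof -
  have two: "path_matrix u s k $$ (i, j) * path_matrix u s k $$ (j, i) \<in> cyclic_products (path_matrix u s k)"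
    if "i < 4" "j < 4" for i j
    unfolding cyclic_products_def using that
    by (intro CollectI exI[of _ "[i, j]"]) (auto simp: numeral_2_eq_2)
  from two[of 0 1] two[of 0 2] two[of 1 3] show
    "u\<^sup>2 \<in> cyclic_products (path_matrix u s k)"
    "(2 * cos (pi / real s))\<^sup>2 \<in> cyclic_products (path_matrix u s k)"
    "(2 * cos (pi / real k))\<^sup>2 \<in> cyclic_products (path_matrix u s k)"
    by (simp_all add: path_matrix_entry doubleton_eq_iff power2_eq_square)
qed

lemma ground_field_subset: "ground_field (path_matrix u s k) \<subseteq> gen_field (entries (path_matrix u s k))"
  unfolding ground_field_def
proof (rule gen_field_least[OF subfield_gen_field], rule subsetI)
  let ?A = "path_matrix u s k" and ?L = "gen_field (entries (path_matrix u s k))"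
  have entry: "?A $$ (i, j) \<in> ?L" if "i < 4" "j < 4" for i j
    using gen_field_base[of "entries ?A"] that by (auto simp: entries_def)
  have prod: "prod f A \<in> ?L" if "\<And>i. i \<in> A \<Longrightarrow> f i \<in> ?L" for f :: "nat \<Rightarrow> real" and A
    using that by (induction A rule: infinite_finite_induct) (auto intro:
        subfieldD[OF subfield_gen_field] )
  fix c assume "c \<in> cyclic_products ?A"
  then obtain l where l: "l \<noteq> []" "\<forall>i\<in>set l. i < 4"
      "c = (\<Prod>t<length l. ?A $$ (l ! t, l ! ((t + 1) mod length l)))"
    by (auto simp: cyclic_products_def)
  show "c \<in> ?L"
    unfolding l(3) using l(1,2) by (intro prod entry) auto
qed

text \<open>For given values \<open>p\<close> and \<open>q\<close> at the inner vertices, the choice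
  \<open>r = a p / 2\<close>, \<open>t = b q / 2\<close> at the leaves is extremal. It leaves a
  binary form in \<open>p\<close> and \<open>q\<close> whose determinant condition is the third
  inequality. The test vectors are these extremal choices.\<close>

lemma negative_definite_path_matrix:
  assumes "negative_definite (map_mat \<phi> (path_matrix u s k))"
    and "\<phi> (-2) = -2" "\<phi> 0 = 0"
    and "\<phi> (2 * cos (pi / real s)) = a" "\<phi> (2 * cos (pi / real k)) = b"
  shows "a\<^sup>2 < 4" "b\<^sup>2 < 4" "4 * (\<phi> u)\<^sup>2 < (4 - a\<^sup>2) * (4 - b\<^sup>2)"
proof -
  let ?M = "map_mat \<phi> (path_matrix u s k)"
  have sum4: "(\<Sum>i=0..<4. f i) = f 0 + f 1 + f 2 + f 3" for f :: "nat \<Rightarrow> real"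
    by (simp add: eval_nat_numeral)
  have neg: "2 * (\<phi> u * p * q + a * p * r + b * q * t) < 2 * (p\<^sup>2 + q\<^sup>2 + r\<^sup>2 + t\<^sup>2)"
    if "(p, q, r, t) \<noteq> (0, 0, 0, 0)" for p q r t :: real
  proof -
    define v where "v = vec 4 (\<lambda>i. [p, q, r, t] ! i)"
    have v: "v $ 0 = p" "v $ 1 = q" "v $ 2 = r" "v $ 3 = t" "dim_vec v = 4"
      by (simp_all add: v_def)
    have "v \<noteq> 0\<^sub>v 4"
    proof
      assume "v = 0\<^sub>v 4"
      then have "v $ 0 = 0" "v $ 1 = 0" "v $ 2 = 0" "v $ 3 = 0"
        by simp_all
      then show False
        using v that by simp
    qed
    then have "v \<bullet> (?M *\<^sub>v v) < 0"
      using assms(1) v(5) unfolding negative_definite_def by (auto intro: carrier_vecI)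
    moreover have "v \<bullet> (?M *\<^sub>v v) =
        2 * (\<phi> u * p * q + a * p * r + b * q * t) - 2 * (p\<^sup>2 + q\<^sup>2 + r\<^sup>2 + t\<^sup>2)"
      using v assms(2-5)
      by (simp add: scalar_prod_def sum4 path_matrix_entry doubleton_eq_iff power2_eq_square)
        (simp add: algebra_simps)
    ultimately show ?thesis
      by simp
  qed
  have "a\<^sup>2 < 4"
    using neg[of 2 0 a 0] by (simp add: power2_eq_square)
  moreover have b: "b\<^sup>2 < 4"
    using neg[of 0 2 0 b] by (simp add: power2_eq_square)
  define z where "z = 4 - b\<^sup>2"
  have "z > 0"
    using b by (simp add: z_def)
  \<comment> \<open>With \<open>p = z\<close> the extremal values are \<open>q = 2 \<phi> u\<close>,
    \<open>r = a z / 2\<close> and \<open>t = b \<phi> u\<close>; the scaling by \<open>z\<close>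
    avoids a division.\<close>
  have "2 * (\<phi> u * z * (2 * \<phi> u) + a * z * (a * z / 2) + b * (2 * \<phi> u) * (b * \<phi> u))
      < 2 * (z\<^sup>2 + (2 * \<phi> u)\<^sup>2 + (a * z / 2)\<^sup>2 + (b * \<phi> u)\<^sup>2)"
    using \<open>z > 0\<close> by (intro neg) auto
  then have "4 * (\<phi> u)\<^sup>2 * z + a\<^sup>2 * z\<^sup>2 + 4 * b\<^sup>2 * (\<phi> u)\<^sup>2
      < 2 * z\<^sup>2 + 8 * (\<phi> u)\<^sup>2 + a\<^sup>2 * z\<^sup>2 / 2 + 2 * b\<^sup>2 * (\<phi> u)\<^sup>2"
    by (simp add: power2_eq_square algebra_simps)
  moreover have "8 * (\<phi> u)\<^sup>2 - 2 * b\<^sup>2 * (\<phi> u)\<^sup>2 = 2 * z * (\<phi> u)\<^sup>2"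
    by (simp add: z_def algebra_simps)
  ultimately have "z * (4 * (\<phi> u)\<^sup>2) < z * ((4 - a\<^sup>2) * z)"
    by (simp add: algebra_simps power2_eq_square)
  then show "4 * (\<phi> u)\<^sup>2 < (4 - a\<^sup>2) * (4 - b\<^sup>2)"
    using \<open>z > 0\<close> by (simp add: z_def)
  show "a\<^sup>2 < 4" "b\<^sup>2 < 4"
    by fact+
qed

text \<open>Integer polynomials in three variables, given as functions. The rules let automation
  recognise a written-out term, and induction over them transports both integrality and
  compatibility with embeddings.\<close>

inductive int_poly3 :: "(real \<Rightarrow> real \<Rightarrow> real \<Rightarrow> real) \<Rightarrow> bool" where
  fst: "int_poly3 (\<lambda>x y z. x)"
| snd: "int_poly3 (\<lambda>x y z. y)"
| trd: "int_poly3 (\<lambda>x y z. z)"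
| one: "int_poly3 (\<lambda>x y z. 1)"
| numeral: "int_poly3 (\<lambda>x y z. numeral n)"
| add: "int_poly3 f \<Longrightarrow> int_poly3 g \<Longrightarrow> int_poly3 (\<lambda>x y z. f x y z + g x y z)"
| diff: "int_poly3 f \<Longrightarrow> int_poly3 g \<Longrightarrow> int_poly3 (\<lambda>x y z. f x y z - g x y z)"
| mult: "int_poly3 f \<Longrightarrow> int_poly3 g \<Longrightarrow> int_poly3 (\<lambda>x y z. f x y z * g x y z)"

lemma int_poly3_power: "int_poly3 f \<Longrightarrow> int_poly3 (\<lambda>x y z. f x y z ^ n)"
  by (induction n) (auto intro: int_poly3.intros)

lemma int_poly3_algebraic_integer:
  assumes "int_poly3 f" "algebraic_integer x" "algebraic_integer y" "algebraic_integer z"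
  shows "algebraic_integer (f x y z)"
  using assms by (induction rule: int_poly3.induct)
    (auto intro: algebraic_integer_ring algebraic_integer_diff algebraic_integer_1 algebraic_integer_numeral)

lemma int_poly3_embedding:
  assumes "int_poly3 f" "subfield F" "field_embedding F \<phi>" "x \<in> F" "y \<in> F" "z \<in> F"
  shows "f x y z \<in> F \<and> \<phi> (f x y z) = f (\<phi> x) (\<phi> y) (\<phi> z)"
  using assms
  by (induction rule: int_poly3.induct)
    (auto simp: embedding_add embedding_diff embedding_mult embedding_1 embedding_numeral
      intro: subfieldD subfield_numeral)

lemma int_poly3_subfield:
  assumes "int_poly3 f" "subfield F" "x \<in> F" "y \<in> F" "z \<in> F"
  shows "f x y z \<in> F"
  using int_poly3_embedding[OF assms(1,2) field_embedding_of_real assms(3-5)] ..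

text \<open>The interface between algebra and counting. \<open>I\<close> consists of the embeddings
  in the enumeration other than the one that is the identity on the ground field, which accounts for
  the successor in the degree.\<close>

lemma path_matrix_conjugates:
  assumes u: "totally_real_algebraic_integer u" "2 < u"
    and V: "V_arithmetic (path_matrix u s k)" and sk: "3 \<le> s" "3 \<le> k"
  defines "y \<equiv> 4 - (2 * cos (pi / real s))\<^sup>2" and "z \<equiv> 4 - (2 * cos (pi / real k))\<^sup>2"
  obtains I :: "(real \<Rightarrow> real) set" where
    "finite I" "degree_over_Q_le (ground_field (path_matrix u s k)) (Suc (card I))"
    "\<And>\<phi>. \<phi> \<in> I \<Longrightarrow> 0 < \<phi> (u\<^sup>2) \<and> 4 * \<phi> (u\<^sup>2) < \<phi> y * \<phi> z \<and>
        0 < \<phi> y \<and> \<phi> y < 4 \<and> 0 < \<phi> z \<and> \<phi> z < 4"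
    "\<And>\<phi> f. \<phi> \<in> I \<Longrightarrow> int_poly3 f \<Longrightarrow> f (\<phi> (u\<^sup>2)) (\<phi> y) (\<phi> z) = 0 \<longleftrightarrow> f (u\<^sup>2) y z = 0"
    "\<And>f. int_poly3 f \<Longrightarrow> f (u\<^sup>2) y z \<noteq> 0 \<Longrightarrow>
        0 \<le> ln (f (u\<^sup>2) y z) + (\<Sum>\<phi>\<in>I. ln (f (\<phi> (u\<^sup>2)) (\<phi> y) (\<phi> z)))"
proof -
  define A where "A = path_matrix u s k"
  define L where "L = gen_field (entries A)"
  define K where "K = ground_field A"
  define a where "a = 2 * cos (pi / real s)"
  define b where "b = 2 * cos (pi / real k)"
  have L: "subfield L" and K: "subfield K" and KL: "K \<subseteq> L"
    using subfield_gen_field ground_field_subset by (auto simp: L_def K_def A_def ground_field_def)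
  have C: "u\<^sup>2 \<in> cyclic_products A" "a\<^sup>2 \<in> cyclic_products A" "b\<^sup>2 \<in> cyclic_products A"
    using cyclic_products_path_matrix by (auto simp: A_def a_def b_def)
  have algint: "\<forall>c\<in>cyclic_products A. algebraic_integer c"
    using V by (simp add: V_arithmetic_def A_def)
  have "cyclic_products A \<subseteq> K"
    using gen_field_base by (simp add: K_def ground_field_def)
  then have inK: "u\<^sup>2 \<in> K" "y \<in> K" "z \<in> K"
    using C subfieldD(7)[OF K subfield_numeral[OF K]] by (auto simp: y_def z_def a_def b_def)
  have alg: "algebraic_integer (u\<^sup>2)" "algebraic_integer y" "algebraic_integer z"
    using C algint algebraic_integer_diff[OF algebraic_integer_numeral]
    by (auto simp: y_def z_def a_def b_def)
  have algebraic: "\<forall>x\<in>set [u, a, b]. algebraic_over \<rat> x"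
    using C algint u(1) algebraic_over_Rats algebraic_over_square_root[OF subfield_Rats]
    by (auto simp: totally_real_algebraic_integer_def)
  have ent: "entries A = {-2, 0, u, a, b}"
    by (simp add: A_def entries_path_matrix a_def b_def)
  have inL: "u \<in> L" "a \<in> L" "b \<in> L"
    using gen_field_base[of "entries A"] by (auto simp: ent L_def)
  have least: "L \<subseteq> E" if "subfield E" "set [u, a, b] \<subseteq> E" for E
    unfolding L_def ent using that
    by (intro gen_field_least) (auto intro: subfieldD subfield_numeral)
  \<comment> \<open>An embedding keeps \<open>a\<close> and \<open>b\<close> nonzero, which is what
    makes the bounds \<open>\<phi> y < 4\<close> and \<open>\<phi> z < 4\<close> strict.\<close>
  have pos: "a \<noteq> 0" "b \<noteq> 0"
  proof -
    have "cos (pi / real n) > 0" if "3 \<le> n" for n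
    proof (rule cos_gt_zero_pi)
      have "pi / real n < pi / 2"
        using that pi_gt_zero by (intro divide_strict_left_mono) auto
      then show "pi / real n < pi / 2" "- (pi / 2) < pi / real n"
        using pi_gt_zero by (auto intro: less_le_trans[of _ 0])
    qed
    from this[OF sk(1)] this[OF sk(2)] show "a \<noteq> 0" "b \<noteq> 0"
      by (auto simp: a_def b_def)
  qed
  have bounds: "0 < \<phi> (u\<^sup>2) \<and> 4 * \<phi> (u\<^sup>2) < \<phi> y * \<phi> z \<and> 0 < \<phi> y \<and> \<phi> y < 4 \<and> 0 < \<phi> z \<and> \<phi> z < 4"
    if \<phi>: "field_embedding L \<phi>" "\<not> (\<forall>x\<in>K. \<phi> x = x)" for \<phi> :: "real \<Rightarrow> real"
  proof -
    have "negative_definite (map_mat \<phi> A)"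
      using V \<phi> unfolding V_arithmetic_def A_def L_def K_def by blast
    moreover have "\<phi> (-2) = -2" "\<phi> 0 = 0"
      using embedding_0[OF L \<phi>(1)] embedding_uminus[OF L \<phi>(1) subfield_numeral[OF L]]
        embedding_numeral[OF L \<phi>(1)] by auto
    ultimately have "(\<phi> a)\<^sup>2 < 4" "(\<phi> b)\<^sup>2 < 4" "4 * (\<phi> u)\<^sup>2 < (4 - (\<phi> a)\<^sup>2) * (4 - (\<phi> b)\<^sup>2)"
      unfolding a_def b_def A_def by (rule negative_definite_path_matrix[OF _ _ _ refl refl])+
    moreover have "\<phi> (x\<^sup>2) = (\<phi> x)\<^sup>2" "\<phi> (4 - x\<^sup>2) = 4 - (\<phi> x)\<^sup>2" if "x \<in> L" for x
      using that by (simp_all add: embedding_power[OF L \<phi>(1)] embedding_diff[OF L \<phi>(1)]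
          embedding_numeral[OF L \<phi>(1)] subfield_numeral[OF L] subfieldD(9)[OF L])
    moreover have "\<phi> x \<noteq> 0" if "x \<in> {u, a, b}" for x
      using that inL pos u embedding_nonzero[OF L \<phi>(1)] by auto
    ultimately show ?thesis
      using inL by (simp add: y_def z_def a_def[symmetric] b_def[symmetric])
  qed
  have fixed: "\<forall>x\<in>K. \<phi> x = x" if \<phi>: "field_embedding L \<phi>" "\<phi> (u\<^sup>2) = u\<^sup>2" for \<phi> :: "real \<Rightarrow> real"
  proof (rule ccontr)
    assume "\<not> ?thesis"
    then have *: "4 * u\<^sup>2 < \<phi> y * \<phi> z" "0 < \<phi> y" "\<phi> y < 4" "0 < \<phi> z" "\<phi> z < 4"
      using bounds[OF \<phi>(1)] \<phi>(2) by auto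
    then have "\<phi> y * \<phi> z \<le> 4 * 4"
      by (intro mult_mono) auto
    moreover have "2\<^sup>2 < u\<^sup>2"
      using u(2) by (intro power_strict_mono) auto
    ultimately show False
      using * by simp
  qed
  have real: "totally_real_field L"
    using V by (simp add: V_arithmetic_def A_def L_def)
  obtain \<Phi> \<phi>\<^sub>0 where \<Phi>: "finite \<Phi>" "degree_over_Q_le K (card \<Phi>)" "\<phi>\<^sub>0 \<in> \<Phi>" "\<forall>x\<in>K. \<phi>\<^sub>0 x = x"
    "\<And>\<phi>. \<phi> \<in> \<Phi> \<Longrightarrow> field_embedding L \<phi>"
    "\<And>\<phi>. \<phi> \<in> \<Phi> - {\<phi>\<^sub>0} \<Longrightarrow> \<phi> (u\<^sup>2) \<noteq> u\<^sup>2"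
    "\<And>t. t \<in> K \<Longrightarrow> algebraic_integer t \<Longrightarrow> t \<noteq> 0 \<Longrightarrow> 1 \<le> (\<Prod>\<phi>\<in>\<Phi>. \<bar>\<phi> t\<bar>)"
    using conjugate_embeddings[OF alg(1) inK(1) K_def[unfolded ground_field_def] algint algebraic
        least L KL
        real fixed] by blast
  define I where "I = \<Phi> - {\<phi>\<^sub>0}"
  have hom: "\<phi> (f (u\<^sup>2) y z) = f (\<phi> (u\<^sup>2)) (\<phi> y) (\<phi> z)" if "\<phi> \<in> \<Phi>" "int_poly3 f" for \<phi> f
    using int_poly3_embedding[OF that(2) L \<Phi>(5)[OF that(1)]] inK KL by blast
  show ?thesis
  proof (rule that[of I])
    show "finite I"
      using \<Phi>(1) by (simp add: I_def)
    have "Suc (card I) = card \<Phi>"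
      using \<Phi>(1,3) by (metis I_def card.remove)
    then show "degree_over_Q_le (ground_field (path_matrix u s k)) (Suc (card I))"
      using \<Phi>(2) by (simp add: K_def A_def)
    show "0 < \<phi> (u\<^sup>2) \<and> 4 * \<phi> (u\<^sup>2) < \<phi> y * \<phi> z \<and> 0 < \<phi> y \<and> \<phi> y < 4 \<and> 0 < \<phi> z \<and> \<phi> z < 4"
      if "\<phi> \<in> I" for \<phi>
      using bounds \<Phi>(5,6) inK(1) that by (auto simp: I_def)
    show "f (\<phi> (u\<^sup>2)) (\<phi> y) (\<phi> z) = 0 \<longleftrightarrow> f (u\<^sup>2) y z = 0" if "\<phi> \<in> I" "int_poly3 f" for \<phi> f
    proof -
      have "\<phi> \<in> \<Phi>"
        using that by (simp add: I_def)
      moreover have "f (u\<^sup>2) y z \<in> L"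
        using int_poly3_subfield[OF that(2) K inK] KL by blast
      ultimately show ?thesis
        using hom[OF _ that(2), of \<phi>]
            embedding_nonzero[OF L \<Phi>(5)[OF \<open>\<phi> \<in> \<Phi>\<close>] ]
          embedding_0[OF L \<Phi>(5)[OF \<open>\<phi> \<in> \<Phi>\<close>]] by (cases "f (u\<^sup>2) y z = 0") auto
    qed
    show "0 \<le> ln (f (u\<^sup>2) y z) + (\<Sum>\<phi>\<in>I. ln (f (\<phi> (u\<^sup>2)) (\<phi> y) (\<phi> z)))"
      if f: "int_poly3 f" "f (u\<^sup>2) y z \<noteq> 0" for f
    proof -
      define t where "t = f (u\<^sup>2) y z"
      have t: "t \<in> K" "algebraic_integer t" "t \<noteq> 0"
        using int_poly3_subfield[OF f(1) K inK] int_poly3_algebraic_integer[OF f(1) alg] f(2)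
        by (auto simp: t_def)
      have nz: "\<phi> t \<noteq> 0" if "\<phi> \<in> \<Phi>" for \<phi>
        using embedding_nonzero[OF L \<Phi>(5)[OF that]] t KL by blast
      have "0 \<le> ln (\<Prod>\<phi>\<in>\<Phi>. \<bar>\<phi> t\<bar>)"
        using \<Phi>(7)[OF t] by simp
      also have "\<dots> = (\<Sum>\<phi>\<in>\<Phi>. ln \<bar>\<phi> t\<bar>)"
        using \<Phi>(1) nz by (intro ln_prod) auto
      also have "\<dots> = (\<Sum>\<phi>\<in>\<Phi>. ln (\<phi> t))"
        by (intro sum.cong) (auto simp: abs_if ln_minus)
      also have "\<dots> = ln (\<phi>\<^sub>0 t) + (\<Sum>\<phi>\<in>I. ln (\<phi> t))"
        using \<Phi>(1,3) by (simp add: I_def sum.remove)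
      also have "\<phi>\<^sub>0 t = t"
        using \<Phi>(4) t by blast
      also have "(\<Sum>\<phi>\<in>I. ln (\<phi> t)) = (\<Sum>\<phi>\<in>I. ln (f (\<phi> (u\<^sup>2)) (\<phi> y) (\<phi> z)))"
        using hom[OF _ f(1)] by (intro sum.cong refl) (simp add: t_def I_def)
      finally show ?thesis
        by (simp add: t_def)
    qed
  qed
qed

section \<open>Weighted sums of logarithms\<close>

text \<open>The unit for all logarithms: tangents are taken at powers of 21 / 20, so their constants
  are integer multiples of \<open>lam\<close>, and \<open>lam\<close> is the only logarithm that
  needs numerical bounds.\<close>

definition lam :: real where "lam = ln (21 / 20)"

lemma lam_bounds: "(4876 / 100000) < lam" "lam < (4881 / 100000)"
proof -
  \<comment> \<open>The inequality \<open>ln t <= t - 1\<close> is sharp only near 1, hence the 64th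
    root: 64 times 0.000762 is 0.048768.\<close>
  have "ln (20 / 21 :: real) < ln (((999238 / 1000000) :: real) ^ 64)"
    by (subst ln_less_cancel_iff) (simp_all add: power_divide)
  also have "\<dots> = 64 * ln ((999238 / 1000000) :: real)"
    by (simp add: ln_realpow)
  also have "\<dots> \<le> 64 * ((999238 / 1000000) - 1)"
    using ln_le_minus_one[of "(999238 / 1000000) :: real"] by simp
  finally show "(4876 / 100000) < lam"
    by (simp add: lam_def ln_div)
  have "(21 / 20 :: real) < 1 + (4881 / 100000) + (4881 / 100000)\<^sup>2 / 2"
    by (simp add: power2_eq_square)
  also have "\<dots> \<le> exp (4881 / 100000)"
    by (rule exp_lower_Taylor_quadratic) simp
  finally have "ln (21 / 20) < ln (exp ((4881 / 100000) :: real))"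
    by (subst ln_less_cancel_iff) simp_all
  then show "lam < (4881 / 100000)"
    by (simp add: lam_def)
qed

text \<open>Tangents to the logarithm at the points \<open>(21 / 20) ^ n\<close> and \<open>(20 / 21) ^ n\<close>, with slopes rounded
  up. On a cell where every affine form keeps its sign, a weighted sum of logarithms is concave, so a
  suitable tangent for each form bounds it almost sharply.\<close>

lemma ln_tangent_pos:
  assumes "0 < P" and "1 \<le> c * (21 / 20) ^ n"
  shows "ln P \<le> real n * lam + c * P - 1"
proof -
  have "0 < c"
    using assms(2) by (smt (verit) mult_nonpos_nonneg zero_le_power zero_le_divide_iff)
  have "0 \<le> ln (c * (21 / 20) ^ n)"
    using assms(2) by simp
  also have "\<dots> = ln c + real n * lam"
    using \<open>0 < c\<close> by (simp add: ln_mult ln_realpow lam_def)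
  finally have "- ln c \<le> real n * lam"
    by simp
  moreover have "ln c + ln P \<le> c * P - 1"
    using ln_le_minus_one[of "c * P"] \<open>0 < c\<close> assms(1) by (simp add: ln_mult)
  ultimately show ?thesis
    by linarith
qed

lemma ln_tangent_pos_inv:
  assumes "0 < P" and "(21 / 20) ^ n \<le> c"
  shows "ln P \<le> - real n * lam + c * P - 1"
proof -
  have c: "0 < c"
    using assms(2) by (smt (verit) zero_less_power zero_less_divide_iff)
  have "ln ((21 / 20 :: real) ^ n) \<le> ln c"
    using assms(2) by (subst ln_le_cancel_iff) (use c in simp_all)
  then have "real n * lam \<le> ln c"
    by (simp add: ln_realpow lam_def)
  moreover have "ln c + ln P \<le> c * P - 1"
    using ln_le_minus_one[of "c * P"] c assms(1) by (simp add: ln_mult)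
  ultimately show ?thesis
    by linarith
qed

lemma ln_tangent_neg:
  assumes "P < 0" and "1 \<le> c * (21 / 20) ^ n"
  shows "ln P \<le> real n * lam - c * P - 1"
  using ln_tangent_pos[of "- P" c n] assms by (simp add: ln_minus)

lemma ln_tangent_neg_inv:
  assumes "P < 0" and "(21 / 20) ^ n \<le> c"
  shows "ln P \<le> - real n * lam - c * P - 1"
  using ln_tangent_pos_inv[of "- P" n c] assms by (simp add: ln_minus)

text \<open>\<open>slope_at_n\<close> belongs to the tangent at \<open>(21 / 20) ^ n\<close> and
  \<open>slope_at_mn\<close> to the one at its reciprocal. The exponents 108, 122 and 137 give
  points near 196, 392 and 784, the upper limits of \<open>x\<close>, \<open>2 x\<close> and
  \<open>4 x\<close>.\<close>

lemma slope_table: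
  shows slope_at_m95: "(21 / 20 :: real) ^ 95 \<le> (10304 / 100)"
    and slope_at_m62: "(21 / 20 :: real) ^ 62 \<le> (20594 / 1000)"
    and slope_at_m59: "(21 / 20 :: real) ^ 59 \<le> (17790 / 1000)"
    and slope_at_m57: "(21 / 20 :: real) ^ 57 \<le> (16136 / 1000)"
    and slope_at_m56: "(21 / 20 :: real) ^ 56 \<le> (15368 / 1000)"
    and slope_at_m51: "(21 / 20 :: real) ^ 51 \<le> (12041 / 1000)"
    and slope_at_m50: "(21 / 20 :: real) ^ 50 \<le> (11468 / 1000)"
    and slope_at_m49: "(21 / 20 :: real) ^ 49 \<le> (10922 / 1000)"
    and slope_at_m48: "(21 / 20 :: real) ^ 48 \<le> (10402 / 1000)"
    and slope_at_m45: "(21 / 20 :: real) ^ 45 \<le> (89851 / 10000)"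
    and slope_at_m44: "(21 / 20 :: real) ^ 44 \<le> (85572 / 10000)"
    and slope_at_m42: "(21 / 20 :: real) ^ 42 \<le> (77616 / 10000)"
    and slope_at_m41: "(21 / 20 :: real) ^ 41 \<le> (73920 / 10000)"
    and slope_at_m40: "(21 / 20 :: real) ^ 40 \<le> (70400 / 10000)"
    and slope_at_m39: "(21 / 20 :: real) ^ 39 \<le> (67048 / 10000)"
    and slope_at_m38: "(21 / 20 :: real) ^ 38 \<le> (63855 / 10000)"
    and slope_at_m37: "(21 / 20 :: real) ^ 37 \<le> (60815 / 10000)"
    and slope_at_m36: "(21 / 20 :: real) ^ 36 \<le> (57919 / 10000)"
    and slope_at_m35: "(21 / 20 :: real) ^ 35 \<le> (55161 / 10000)"
    and slope_at_m34: "(21 / 20 :: real) ^ 34 \<le> (52534 / 10000)"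
    and slope_at_m33: "(21 / 20 :: real) ^ 33 \<le> (50032 / 10000)"
    and slope_at_m32: "(21 / 20 :: real) ^ 32 \<le> (47650 / 10000)"
    and slope_at_m31: "(21 / 20 :: real) ^ 31 \<le> (45381 / 10000)"
    and slope_at_m30: "(21 / 20 :: real) ^ 30 \<le> (43220 / 10000)"
    and slope_at_m29: "(21 / 20 :: real) ^ 29 \<le> (41162 / 10000)"
    and slope_at_m28: "(21 / 20 :: real) ^ 28 \<le> (39202 / 10000)"
    and slope_at_m27: "(21 / 20 :: real) ^ 27 \<le> (37335 / 10000)"
    and slope_at_m26: "(21 / 20 :: real) ^ 26 \<le> (35557 / 10000)"
    and slope_at_m25: "(21 / 20 :: real) ^ 25 \<le> (33864 / 10000)"
    and slope_at_m24: "(21 / 20 :: real) ^ 24 \<le> (32251 / 10000)"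
    and slope_at_m23: "(21 / 20 :: real) ^ 23 \<le> (30716 / 10000)"
    and slope_at_m22: "(21 / 20 :: real) ^ 22 \<le> (29253 / 10000)"
    and slope_at_m21: "(21 / 20 :: real) ^ 21 \<le> (27860 / 10000)"
    and slope_at_m20: "(21 / 20 :: real) ^ 20 \<le> (26533 / 10000)"
    and slope_at_m19: "(21 / 20 :: real) ^ 19 \<le> (25270 / 10000)"
    and slope_at_m18: "(21 / 20 :: real) ^ 18 \<le> (24067 / 10000)"
    and slope_at_m17: "(21 / 20 :: real) ^ 17 \<le> (22921 / 10000)"
    and slope_at_m16: "(21 / 20 :: real) ^ 16 \<le> (21829 / 10000)"
    and slope_at_m15: "(21 / 20 :: real) ^ 15 \<le> (20790 / 10000)"
    and slope_at_m14: "(21 / 20 :: real) ^ 14 \<le> (19800 / 10000)"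
    and slope_at_m13: "(21 / 20 :: real) ^ 13 \<le> (18857 / 10000)"
    and slope_at_m12: "(21 / 20 :: real) ^ 12 \<le> (17959 / 10000)"
    and slope_at_m11: "(21 / 20 :: real) ^ 11 \<le> (17104 / 10000)"
    and slope_at_m10: "(21 / 20 :: real) ^ 10 \<le> (16289 / 10000)"
    and slope_at_m9: "(21 / 20 :: real) ^ 9 \<le> (15514 / 10000)"
    and slope_at_m8: "(21 / 20 :: real) ^ 8 \<le> (14775 / 10000)"
    and slope_at_m7: "(21 / 20 :: real) ^ 7 \<le> (14072 / 10000)"
    and slope_at_m6: "(21 / 20 :: real) ^ 6 \<le> (13401 / 10000)"
    and slope_at_m5: "(21 / 20 :: real) ^ 5 \<le> (12763 / 10000)"
    and slope_at_m4: "(21 / 20 :: real) ^ 4 \<le> (12156 / 10000)"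
    and slope_at_m3: "(21 / 20 :: real) ^ 3 \<le> (11577 / 10000)"
    and slope_at_m2: "(21 / 20 :: real) ^ 2 \<le> (11026 / 10000)"
    and slope_at_m1: "(21 / 20 :: real) ^ 1 \<le> (10501 / 10000)"
    and slope_at_0: "1 \<le> (10001 / 10000) * (21 / 20 :: real) ^ 0"
    and slope_at_1: "1 \<le> (95239 / 100000) * (21 / 20 :: real) ^ 1"
    and slope_at_2: "1 \<le> (90703 / 100000) * (21 / 20 :: real) ^ 2"
    and slope_at_3: "1 \<le> (86384 / 100000) * (21 / 20 :: real) ^ 3"
    and slope_at_4: "1 \<le> (82271 / 100000) * (21 / 20 :: real) ^ 4"
    and slope_at_5: "1 \<le> (78353 / 100000) * (21 / 20 :: real) ^ 5"
    and slope_at_6: "1 \<le> (74622 / 100000) * (21 / 20 :: real) ^ 6"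
    and slope_at_7: "1 \<le> (71069 / 100000) * (21 / 20 :: real) ^ 7"
    and slope_at_8: "1 \<le> (67684 / 100000) * (21 / 20 :: real) ^ 8"
    and slope_at_9: "1 \<le> (64461 / 100000) * (21 / 20 :: real) ^ 9"
    and slope_at_10: "1 \<le> (61392 / 100000) * (21 / 20 :: real) ^ 10"
    and slope_at_11: "1 \<le> (58468 / 100000) * (21 / 20 :: real) ^ 11"
    and slope_at_12: "1 \<le> (55684 / 100000) * (21 / 20 :: real) ^ 12"
    and slope_at_13: "1 \<le> (53033 / 100000) * (21 / 20 :: real) ^ 13"
    and slope_at_14: "1 \<le> (50507 / 100000) * (21 / 20 :: real) ^ 14"
    and slope_at_15: "1 \<le> (48102 / 100000) * (21 / 20 :: real) ^ 15"
    and slope_at_16: "1 \<le> (45812 / 100000) * (21 / 20 :: real) ^ 16"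
    and slope_at_17: "1 \<le> (43630 / 100000) * (21 / 20 :: real) ^ 17"
    and slope_at_18: "1 \<le> (41553 / 100000) * (21 / 20 :: real) ^ 18"
    and slope_at_19: "1 \<le> (39574 / 100000) * (21 / 20 :: real) ^ 19"
    and slope_at_20: "1 \<le> (37689 / 100000) * (21 / 20 :: real) ^ 20"
    and slope_at_21: "1 \<le> (35895 / 100000) * (21 / 20 :: real) ^ 21"
    and slope_at_22: "1 \<le> (34185 / 100000) * (21 / 20 :: real) ^ 22"
    and slope_at_23: "1 \<le> (32558 / 100000) * (21 / 20 :: real) ^ 23"
    and slope_at_24: "1 \<le> (31007 / 100000) * (21 / 20 :: real) ^ 24"
    and slope_at_25: "1 \<le> (29531 / 100000) * (21 / 20 :: real) ^ 25"
    and slope_at_26: "1 \<le> (28125 / 100000) * (21 / 20 :: real) ^ 26"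
    and slope_at_27: "1 \<le> (26785 / 100000) * (21 / 20 :: real) ^ 27"
    and slope_at_28: "1 \<le> (25510 / 100000) * (21 / 20 :: real) ^ 28"
    and slope_at_30: "1 \<le> (23138 / 100000) * (21 / 20 :: real) ^ 30"
    and slope_at_40: "1 \<le> (14205 / 100000) * (21 / 20 :: real) ^ 40"
    and slope_at_108: "1 \<le> (51471 / 10000000) * (21 / 20 :: real) ^ 108"
    and slope_at_122: "1 \<le> (25996 / 10000000) * (21 / 20 :: real) ^ 122"
    and slope_at_137: "1 \<le> (12505 / 10000000) * (21 / 20 :: real) ^ 137"
  by (simp_all add: power_divide)

section \<open>Estimates for s = k = 3\<close>

lemma form_3_3_conj_cell1:
  fixes x :: real
  assumes "0 < x" "x - 1 < 0" "x - 2 < 0" "0 < x" "4 * x < 9"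
  shows "3 * ln x + 3 * ln (x - 1) + 4 * ln (x - 2) \<le> - 48 * lam"
  \<comment> \<open>The maximum on this cell is at x = 2 / 5. The tangent points are near the values
    2 / 5, 3 / 5 and 8 / 5 of the forms there, shifted so that the weighted slopes almost
    cancel.\<close>
  using ln_tangent_pos_inv[OF assms(1) slope_at_m18]
    ln_tangent_neg_inv[OF assms(2) slope_at_m10]
    ln_tangent_neg[OF assms(3) slope_at_11]
    lam_bounds  assms
  unfolding  of_nat_numeral of_nat_0 of_nat_1 ring_distribs by linarith

lemma form_3_3_conj_cell2:
  fixes x :: real
  assumes "0 < x" "0 < x - 1" "x - 2 < 0" "0 < x" "4 * x < 9"
  shows "3 * ln x + 3 * ln (x - 1) + 4 * ln (x - 2) \<le> - 48 * lam"
  using ln_tangent_pos[OF assms(1) slope_at_9]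
    ln_tangent_pos_inv[OF assms(2) slope_at_m14]
    ln_tangent_neg_inv[OF assms(3) slope_at_m14]
    lam_bounds  assms
  unfolding  of_nat_numeral of_nat_0 of_nat_1 ring_distribs by linarith

lemma form_3_3_conj_cell3:
  fixes x :: real
  assumes "0 < x" "0 < x - 1" "0 < x - 2" "0 < x" "4 * x < 9"
  shows "3 * ln x + 3 * ln (x - 1) + 4 * ln (x - 2) \<le> - 48 * lam"
  using ln_tangent_pos[OF assms(1) slope_at_17]
    ln_tangent_pos[OF assms(2) slope_at_5]
    ln_tangent_pos_inv[OF assms(3) slope_at_m28]
    lam_bounds  assms
  unfolding  of_nat_numeral of_nat_0 of_nat_1 ring_distribs by linarith

text \<open>The points 1 and 2 cut the interval from 0 to 9 / 4 into three cells on which the sum is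
  concave; 9 / 4 is \<open>y z / 4\<close> for \<open>y = z = 3\<close>.\<close>

lemma form_3_3_conj:
  fixes x :: real
  assumes "0 < x" "4 * x < 9"
    and "x \<noteq> 0" "x - 1 \<noteq> 0" "x - 2 \<noteq> 0"
  shows "3 * ln x + 3 * ln (x - 1) + 4 * ln (x - 2) \<le> - 48 * lam"
proof -
  show ?thesis
  proof (cases "x - 1 < 0")
    case h1: True
    show ?thesis
      by (rule form_3_3_conj_cell1) (use assms(1-2) h1  in linarith)+
  next
    case False
    then have h1: "0 < x - 1"
      using assms(4) by simp
    show ?thesis
    proof (cases "x - 2 < 0")
      case h2: True
      show ?thesis
        by (rule form_3_3_conj_cell2) (use assms(1-2) h1 h2  in linarith)+
    next
      case False
      then have h2: "0 < x - 2"
        using assms(5) by simp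
      show ?thesis
        by (rule form_3_3_conj_cell3) (use assms(1-2) h1 h2  in linarith)+
    qed
  qed
qed

lemma form_3_3_id_cell1:
  fixes x :: real
  assumes "0 < x" "0 < x - 1" "0 < x - 2" "4 < x" "x < 196"
  shows "3 * ln x + 3 * ln (x - 1) + 4 * ln (x - 2) \<le> 1081 * lam"
  using ln_tangent_pos[OF assms(1) slope_at_108]
    ln_tangent_pos[OF assms(2) slope_at_108]
    ln_tangent_pos[OF assms(3) slope_at_108]
    lam_bounds  assms
  unfolding  of_nat_numeral of_nat_0 of_nat_1 ring_distribs by linarith

lemma form_3_3_id:
  fixes x :: real
  assumes "4 < x" "x < 196"
    and "x \<noteq> 0" "x - 1 \<noteq> 0" "x - 2 \<noteq> 0"
  shows "3 * ln x + 3 * ln (x - 1) + 4 * ln (x - 2) \<le> 1081 * lam"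
  by (rule form_3_3_id_cell1) (use assms(1-2)  in linarith)+

section \<open>Estimates for constant y, that is s = 3, 4, 6 and k >= 4\<close>

definition r1 :: real where "r1 = (3 - sqrt 5) / 2"
definition r2 :: real where "r2 = (3 + sqrt 5) / 2"

lemma sqrt5_bounds: "(22360679 / 10000000) < sqrt 5" "sqrt 5 < (2236068 / 1000000)"
  by (rule real_less_rsqrt real_less_lsqrt; simp add: power2_eq_square)+

lemma r_bounds: "(38196 / 100000) < r1" "r1 < (38197 / 100000)" "(261803 / 100000) < r2" "r2 < (261804 / 100000)"
  using sqrt5_bounds by (simp_all add: r1_def r2_def)

text \<open>The second argument stands for \<open>z\<close>. The numbers \<open>r1\<close> and
  \<open>r2\<close> are the roots of \<open>x^2 - 3 x + 1\<close>; splitting this quadratic makes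
  every form affine.\<close>

definition form_const :: "real \<Rightarrow> real \<Rightarrow> real" where
  "form_const x y = 36 * ln (y - 4) + 27 * ln (y - 3) + 61 * ln (x - y + 1) + 43 * ln (x - 2) +
     97 * ln (x - 1) + 78 * ln x + 11 * ln (2 * x - y - 1) + 15 * ln (2 * x - y) +
     23 * (ln (x - r1) + ln (x - r2))"

text \<open>The first ten assumptions list the signs of the forms in the order of
  \<open>form_const\<close>. Twenty sign patterns occur in the triangle given by the last three
  assumptions; each has its own tangents below.\<close>

lemma form_const_conj_cell1:
  fixes x y :: real
  assumes "y - 4 < 0" "y - 3 < 0" "x - y + 1 < 0" "x - 2 < 0" "x - 1 < 0" "0 < x"
      "2 * x - y - 1 < 0" "2 * x - y < 0" "x - r1 < 0" "x - r2 < 0" "0 < x" "4 * x < 3 * y"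
      "y < 4"
  shows "form_const x y \<le> - 2037 * lam"
  using ln_tangent_neg[OF assms(1) slope_at_10]
    ln_tangent_neg_inv[OF assms(2) slope_at_m9]
    ln_tangent_neg[OF assms(3) slope_at_3]
    ln_tangent_neg[OF assms(4) slope_at_13]
    ln_tangent_neg_inv[OF assms(5) slope_at_m5]
    ln_tangent_pos_inv[OF assms(6) slope_at_m32]
    ln_tangent_neg[OF assms(7) slope_at_22]
    ln_tangent_neg[OF assms(8) slope_at_14]
    ln_tangent_neg_inv[OF assms(9) slope_at_m37]
    ln_tangent_neg[OF assms(10) slope_at_18]
    lam_bounds r_bounds assms
  unfolding form_const_def of_nat_numeral of_nat_0 of_nat_1 ring_distribs by linarith

lemma form_const_conj_cell2:
  fixes x y :: real
  assumes "y - 4 < 0" "y - 3 < 0" "x - y + 1 < 0" "x - 2 < 0" "x - 1 < 0" "0 < x"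
      "2 * x - y - 1 < 0" "2 * x - y < 0" "0 < x - r1" "x - r2 < 0" "0 < x" "4 * x < 3 * y"
      "y < 4"
  shows "form_const x y \<le> - 2037 * lam"
  using ln_tangent_neg[OF assms(1) slope_at_7]
    ln_tangent_neg_inv[OF assms(2) slope_at_m13]
    ln_tangent_neg[OF assms(3) slope_at_0]
    ln_tangent_neg[OF assms(4) slope_at_8]
    ln_tangent_neg_inv[OF assms(5) slope_at_m15]
    ln_tangent_pos_inv[OF assms(6) slope_at_m14]
    ln_tangent_neg[OF assms(7) slope_at_17]
    ln_tangent_neg[OF assms(8) slope_at_7]
    ln_tangent_pos_inv[OF assms(9) slope_at_m42]
    ln_tangent_neg[OF assms(10) slope_at_16]
    lam_bounds r_bounds assms
  unfolding form_const_def of_nat_numeral of_nat_0 of_nat_1 ring_distribs by linarith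

lemma form_const_conj_cell3:
  fixes x y :: real
  assumes "y - 4 < 0" "y - 3 < 0" "0 < x - y + 1" "x - 2 < 0" "x - 1 < 0" "0 < x"
      "2 * x - y - 1 < 0" "2 * x - y < 0" "x - r1 < 0" "x - r2 < 0" "0 < x" "4 * x < 3 * y"
      "y < 4"
  shows "form_const x y \<le> - 2037 * lam"
  using ln_tangent_neg[OF assms(1) slope_at_26]
    ln_tangent_neg[OF assms(2) slope_at_18]
    ln_tangent_pos_inv[OF assms(3) slope_at_m9]
    ln_tangent_neg[OF assms(4) slope_at_12]
    ln_tangent_neg_inv[OF assms(5) slope_at_m4]
    ln_tangent_pos_inv[OF assms(6) slope_at_m34]
    ln_tangent_neg[OF assms(7) slope_at_2]
    ln_tangent_neg_inv[OF assms(8) slope_at_m40]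
    ln_tangent_neg_inv[OF assms(9) slope_at_m34]
    ln_tangent_neg[OF assms(10) slope_at_18]
    lam_bounds r_bounds assms
  unfolding form_const_def of_nat_numeral of_nat_0 of_nat_1 ring_distribs by linarith

lemma form_const_conj_cell4:
  fixes x y :: real
  assumes "y - 4 < 0" "y - 3 < 0" "0 < x - y + 1" "x - 2 < 0" "x - 1 < 0" "0 < x"
      "2 * x - y - 1 < 0" "2 * x - y < 0" "0 < x - r1" "x - r2 < 0" "0 < x" "4 * x < 3 * y"
      "y < 4"
  shows "form_const x y \<le> - 2037 * lam"
  using ln_tangent_neg[OF assms(1) slope_at_22]
    ln_tangent_neg[OF assms(2) slope_at_14]
    ln_tangent_pos_inv[OF assms(3) slope_at_m17]
    ln_tangent_neg[OF assms(4) slope_at_9]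
    ln_tangent_neg_inv[OF assms(5) slope_at_m13]
    ln_tangent_pos_inv[OF assms(6) slope_at_m15]
    ln_tangent_neg[OF assms(7) slope_at_3]
    ln_tangent_neg_inv[OF assms(8) slope_at_m48]
    ln_tangent_pos_inv[OF assms(9) slope_at_m49]
    ln_tangent_neg[OF assms(10) slope_at_15]
    lam_bounds r_bounds assms
  unfolding form_const_def of_nat_numeral of_nat_0 of_nat_1 ring_distribs by linarith

lemma form_const_conj_cell5:
  fixes x y :: real
  assumes "y - 4 < 0" "y - 3 < 0" "0 < x - y + 1" "x - 2 < 0" "x - 1 < 0" "0 < x"
      "2 * x - y - 1 < 0" "0 < 2 * x - y" "x - r1 < 0" "x - r2 < 0" "0 < x" "4 * x < 3 * y"
      "y < 4"
  shows "form_const x y \<le> - 2037 * lam"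
  using ln_tangent_neg[OF assms(1) slope_at_27]
    ln_tangent_neg[OF assms(2) slope_at_20]
    ln_tangent_pos_inv[OF assms(3) slope_at_m1]
    ln_tangent_neg[OF assms(4) slope_at_12]
    ln_tangent_neg_inv[OF assms(5) slope_at_m6]
    ln_tangent_pos_inv[OF assms(6) slope_at_m29]
    ln_tangent_neg_inv[OF assms(7) slope_at_m3]
    ln_tangent_pos_inv[OF assms(8) slope_at_m37]
    ln_tangent_neg_inv[OF assms(9) slope_at_m40]
    ln_tangent_neg[OF assms(10) slope_at_18]
    lam_bounds r_bounds assms
  unfolding form_const_def of_nat_numeral of_nat_0 of_nat_1 ring_distribs by linarith

lemma form_const_conj_cell6:
  fixes x y :: real
  assumes "y - 4 < 0" "y - 3 < 0" "0 < x - y + 1" "x - 2 < 0" "x - 1 < 0" "0 < x"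
      "2 * x - y - 1 < 0" "0 < 2 * x - y" "0 < x - r1" "x - r2 < 0" "0 < x" "4 * x < 3 * y"
      "y < 4"
  shows "form_const x y \<le> - 2037 * lam"
  using ln_tangent_neg[OF assms(1) slope_at_24]
    ln_tangent_neg[OF assms(2) slope_at_17]
    ln_tangent_pos_inv[OF assms(3) slope_at_m4]
    ln_tangent_neg[OF assms(4) slope_at_7]
    ln_tangent_neg_inv[OF assms(5) slope_at_m16]
    ln_tangent_pos_inv[OF assms(6) slope_at_m13]
    ln_tangent_neg_inv[OF assms(7) slope_at_m10]
    ln_tangent_pos_inv[OF assms(8) slope_at_m20]
    ln_tangent_pos_inv[OF assms(9) slope_at_m38]
    ln_tangent_neg[OF assms(10) slope_at_15]
    lam_bounds r_bounds assms
  unfolding form_const_def of_nat_numeral of_nat_0 of_nat_1 ring_distribs by linarith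

lemma form_const_conj_cell7:
  fixes x y :: real
  assumes "y - 4 < 0" "y - 3 < 0" "x - y + 1 < 0" "x - 2 < 0" "0 < x - 1" "0 < x"
      "2 * x - y - 1 < 0" "2 * x - y < 0" "0 < x - r1" "x - r2 < 0" "0 < x" "4 * x < 3 * y"
      "y < 4"
  shows "form_const x y \<le> - 2037 * lam"
  using ln_tangent_neg[OF assms(1) slope_at_1]
    ln_tangent_neg_inv[OF assms(2) slope_at_m38]
    ln_tangent_neg_inv[OF assms(3) slope_at_m13]
    ln_tangent_neg_inv[OF assms(4) slope_at_m8]
    ln_tangent_pos_inv[OF assms(5) slope_at_m23]
    ln_tangent_pos[OF assms(6) slope_at_6]
    ln_tangent_neg[OF assms(7) slope_at_4]
    ln_tangent_neg_inv[OF assms(8) slope_at_m35]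
    ln_tangent_pos_inv[OF assms(9) slope_at_m1]
    ln_tangent_neg[OF assms(10) slope_at_5]
    lam_bounds r_bounds assms
  unfolding form_const_def of_nat_numeral of_nat_0 of_nat_1 ring_distribs by linarith

lemma form_const_conj_cell8:
  fixes x y :: real
  assumes "y - 4 < 0" "y - 3 < 0" "x - y + 1 < 0" "x - 2 < 0" "0 < x - 1" "0 < x"
      "2 * x - y - 1 < 0" "0 < 2 * x - y" "0 < x - r1" "x - r2 < 0" "0 < x" "4 * x < 3 * y"
      "y < 4"
  shows "form_const x y \<le> - 2037 * lam"
  using ln_tangent_neg[OF assms(1) slope_at_6]
    ln_tangent_neg_inv[OF assms(2) slope_at_m35]
    ln_tangent_neg_inv[OF assms(3) slope_at_m26]
    ln_tangent_neg_inv[OF assms(4) slope_at_m16]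
    ln_tangent_pos_inv[OF assms(5) slope_at_m13]
    ln_tangent_pos[OF assms(6) slope_at_9]
    ln_tangent_neg_inv[OF assms(7) slope_at_m7]
    ln_tangent_pos_inv[OF assms(8) slope_at_m27]
    ln_tangent_pos[OF assms(9) slope_at_4]
    ln_tangent_neg[OF assms(10) slope_at_0]
    lam_bounds r_bounds assms
  unfolding form_const_def of_nat_numeral of_nat_0 of_nat_1 ring_distribs by linarith

lemma form_const_conj_cell9:
  fixes x y :: real
  assumes "y - 4 < 0" "y - 3 < 0" "0 < x - y + 1" "x - 2 < 0" "0 < x - 1" "0 < x"
      "2 * x - y - 1 < 0" "0 < 2 * x - y" "0 < x - r1" "x - r2 < 0" "0 < x" "4 * x < 3 * y"
      "y < 4"
  shows "form_const x y \<le> - 2037 * lam"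
  using ln_tangent_neg[OF assms(1) slope_at_15]
    ln_tangent_neg[OF assms(2) slope_at_2]
    ln_tangent_pos_inv[OF assms(3) slope_at_m14]
    ln_tangent_neg_inv[OF assms(4) slope_at_m12]
    ln_tangent_pos_inv[OF assms(5) slope_at_m17]
    ln_tangent_pos[OF assms(6) slope_at_7]
    ln_tangent_neg_inv[OF assms(7) slope_at_m57]
    ln_tangent_pos_inv[OF assms(8) slope_at_m2]
    ln_tangent_pos[OF assms(9) slope_at_1]
    ln_tangent_neg[OF assms(10) slope_at_4]
    lam_bounds r_bounds assms
  unfolding form_const_def of_nat_numeral of_nat_0 of_nat_1 ring_distribs by linarith

lemma form_const_conj_cell10:
  fixes x y :: real
  assumes "y - 4 < 0" "y - 3 < 0" "0 < x - y + 1" "x - 2 < 0" "0 < x - 1" "0 < x"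
      "0 < 2 * x - y - 1" "0 < 2 * x - y" "0 < x - r1" "x - r2 < 0" "0 < x" "4 * x < 3 * y"
      "y < 4"
  shows "form_const x y \<le> - 2037 * lam"
  using ln_tangent_neg[OF assms(1) slope_at_11]
    ln_tangent_neg_inv[OF assms(2) slope_at_m6]
    ln_tangent_pos_inv[OF assms(3) slope_at_m17]
    ln_tangent_neg_inv[OF assms(4) slope_at_m23]
    ln_tangent_pos_inv[OF assms(5) slope_at_m8]
    ln_tangent_pos[OF assms(6) slope_at_11]
    ln_tangent_pos_inv[OF assms(7) slope_at_m44]
    ln_tangent_pos[OF assms(8) slope_at_1]
    ln_tangent_pos[OF assms(9) slope_at_5]
    ln_tangent_neg_inv[OF assms(10) slope_at_m1]
    lam_bounds r_bounds assms
  unfolding form_const_def of_nat_numeral of_nat_0 of_nat_1 ring_distribs by linarith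

lemma form_const_conj_cell11:
  fixes x y :: real
  assumes "y - 4 < 0" "y - 3 < 0" "0 < x - y + 1" "0 < x - 2" "0 < x - 1" "0 < x"
      "0 < 2 * x - y - 1" "0 < 2 * x - y" "0 < x - r1" "x - r2 < 0" "0 < x" "4 * x < 3 * y"
      "y < 4"
  shows "form_const x y \<le> - 2037 * lam"
  using ln_tangent_neg[OF assms(1) slope_at_3]
    ln_tangent_neg_inv[OF assms(2) slope_at_m42]
    ln_tangent_pos_inv[OF assms(3) slope_at_m26]
    ln_tangent_pos_inv[OF assms(4) slope_at_m39]
    ln_tangent_pos[OF assms(5) slope_at_3]
    ln_tangent_pos[OF assms(6) slope_at_16]
    ln_tangent_pos_inv[OF assms(7) slope_at_m16]
    ln_tangent_pos[OF assms(8) slope_at_8]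
    ln_tangent_pos[OF assms(9) slope_at_12]
    ln_tangent_neg_inv[OF assms(10) slope_at_m16]
    lam_bounds r_bounds assms
  unfolding form_const_def of_nat_numeral of_nat_0 of_nat_1 ring_distribs by linarith

lemma form_const_conj_cell12:
  fixes x y :: real
  assumes "y - 4 < 0" "0 < y - 3" "x - y + 1 < 0" "x - 2 < 0" "x - 1 < 0" "0 < x"
      "2 * x - y - 1 < 0" "2 * x - y < 0" "x - r1 < 0" "x - r2 < 0" "0 < x" "4 * x < 3 * y"
      "y < 4"
  shows "form_const x y \<le> - 2037 * lam"
  using ln_tangent_neg_inv[OF assms(1) slope_at_m17]
    ln_tangent_pos_inv[OF assms(2) slope_at_m12]
    ln_tangent_neg[OF assms(3) slope_at_17]
    ln_tangent_neg[OF assms(4) slope_at_11]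
    ln_tangent_neg_inv[OF assms(5) slope_at_m6]
    ln_tangent_pos_inv[OF assms(6) slope_at_m31]
    ln_tangent_neg[OF assms(7) slope_at_30]
    ln_tangent_neg[OF assms(8) slope_at_23]
    ln_tangent_neg_inv[OF assms(9) slope_at_m38]
    ln_tangent_neg[OF assms(10) slope_at_17]
    lam_bounds r_bounds assms
  unfolding form_const_def of_nat_numeral of_nat_0 of_nat_1 ring_distribs by linarith

lemma form_const_conj_cell13:
  fixes x y :: real
  assumes "y - 4 < 0" "0 < y - 3" "x - y + 1 < 0" "x - 2 < 0" "x - 1 < 0" "0 < x"
      "2 * x - y - 1 < 0" "2 * x - y < 0" "0 < x - r1" "x - r2 < 0" "0 < x" "4 * x < 3 * y"
      "y < 4"
  shows "form_const x y \<le> - 2037 * lam"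
  using ln_tangent_neg_inv[OF assms(1) slope_at_m17]
    ln_tangent_pos_inv[OF assms(2) slope_at_m10]
    ln_tangent_neg[OF assms(3) slope_at_15]
    ln_tangent_neg[OF assms(4) slope_at_7]
    ln_tangent_neg_inv[OF assms(5) slope_at_m16]
    ln_tangent_pos_inv[OF assms(6) slope_at_m13]
    ln_tangent_neg[OF assms(7) slope_at_25]
    ln_tangent_neg[OF assms(8) slope_at_19]
    ln_tangent_pos_inv[OF assms(9) slope_at_m39]
    ln_tangent_neg[OF assms(10) slope_at_14]
    lam_bounds r_bounds assms
  unfolding form_const_def of_nat_numeral of_nat_0 of_nat_1 ring_distribs by linarith

lemma form_const_conj_cell14:
  fixes x y :: real
  assumes "y - 4 < 0" "0 < y - 3" "x - y + 1 < 0" "x - 2 < 0" "0 < x - 1" "0 < x"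
      "2 * x - y - 1 < 0" "2 * x - y < 0" "0 < x - r1" "x - r2 < 0" "0 < x" "4 * x < 3 * y"
      "y < 4"
  shows "form_const x y \<le> - 2037 * lam"
  using ln_tangent_neg_inv[OF assms(1) slope_at_m26]
    ln_tangent_pos_inv[OF assms(2) slope_at_m8]
    ln_tangent_neg[OF assms(3) slope_at_2]
    ln_tangent_neg_inv[OF assms(4) slope_at_m18]
    ln_tangent_pos_inv[OF assms(5) slope_at_m12]
    ln_tangent_pos[OF assms(6) slope_at_8]
    ln_tangent_neg[OF assms(7) slope_at_8]
    ln_tangent_neg_inv[OF assms(8) slope_at_m11]
    ln_tangent_pos[OF assms(9) slope_at_3]
    ln_tangent_neg[OF assms(10) slope_at_1]
    lam_bounds r_bounds assms
  unfolding form_const_def of_nat_numeral of_nat_0 of_nat_1 ring_distribs by linarith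

lemma form_const_conj_cell15:
  fixes x y :: real
  assumes "y - 4 < 0" "0 < y - 3" "x - y + 1 < 0" "x - 2 < 0" "0 < x - 1" "0 < x"
      "2 * x - y - 1 < 0" "0 < 2 * x - y" "0 < x - r1" "x - r2 < 0" "0 < x" "4 * x < 3 * y"
      "y < 4"
  shows "form_const x y \<le> - 2037 * lam"
  using ln_tangent_neg_inv[OF assms(1) slope_at_m13]
    ln_tangent_pos_inv[OF assms(2) slope_at_m16]
    ln_tangent_neg_inv[OF assms(3) slope_at_m9]
    ln_tangent_neg_inv[OF assms(4) slope_at_m34]
    ln_tangent_pos_inv[OF assms(5) slope_at_m4]
    ln_tangent_pos[OF assms(6) slope_at_12]
    ln_tangent_neg[OF assms(7) slope_at_0]
    ln_tangent_pos_inv[OF assms(8) slope_at_m38]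
    ln_tangent_pos[OF assms(9) slope_at_8]
    ln_tangent_neg_inv[OF assms(10) slope_at_m4]
    lam_bounds r_bounds assms
  unfolding form_const_def of_nat_numeral of_nat_0 of_nat_1 ring_distribs by linarith

lemma form_const_conj_cell16:
  fixes x y :: real
  assumes "y - 4 < 0" "0 < y - 3" "x - y + 1 < 0" "0 < x - 2" "0 < x - 1" "0 < x"
      "2 * x - y - 1 < 0" "0 < 2 * x - y" "0 < x - r1" "x - r2 < 0" "0 < x" "4 * x < 3 * y"
      "y < 4"
  shows "form_const x y \<le> - 2037 * lam"
  using ln_tangent_neg_inv[OF assms(1) slope_at_m34]
    ln_tangent_pos_inv[OF assms(2) slope_at_m4]
    ln_tangent_neg_inv[OF assms(3) slope_at_m14]
    ln_tangent_pos_inv[OF assms(4) slope_at_m25]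
    ln_tangent_pos[OF assms(5) slope_at_5]
    ln_tangent_pos[OF assms(6) slope_at_17]
    ln_tangent_neg_inv[OF assms(7) slope_at_m33]
    ln_tangent_pos_inv[OF assms(8) slope_at_m5]
    ln_tangent_pos[OF assms(9) slope_at_15]
    ln_tangent_neg_inv[OF assms(10) slope_at_m24]
    lam_bounds r_bounds assms
  unfolding form_const_def of_nat_numeral of_nat_0 of_nat_1 ring_distribs by linarith

lemma form_const_conj_cell17:
  fixes x y :: real
  assumes "y - 4 < 0" "0 < y - 3" "x - y + 1 < 0" "0 < x - 2" "0 < x - 1" "0 < x"
      "0 < 2 * x - y - 1" "0 < 2 * x - y" "0 < x - r1" "x - r2 < 0" "0 < x" "4 * x < 3 * y"
      "y < 4"
  shows "form_const x y \<le> - 2037 * lam"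
  using ln_tangent_neg_inv[OF assms(1) slope_at_m30]
    ln_tangent_pos_inv[OF assms(2) slope_at_m3]
    ln_tangent_neg_inv[OF assms(3) slope_at_m25]
    ln_tangent_pos_inv[OF assms(4) slope_at_m15]
    ln_tangent_pos[OF assms(5) slope_at_8]
    ln_tangent_pos[OF assms(6) slope_at_19]
    ln_tangent_pos_inv[OF assms(7) slope_at_m38]
    ln_tangent_pos[OF assms(8) slope_at_5]
    ln_tangent_pos[OF assms(9) slope_at_16]
    ln_tangent_neg_inv[OF assms(10) slope_at_m39]
    lam_bounds r_bounds assms
  unfolding form_const_def of_nat_numeral of_nat_0 of_nat_1 ring_distribs by linarith

lemma form_const_conj_cell18:
  fixes x y :: real
  assumes "y - 4 < 0" "0 < y - 3" "x - y + 1 < 0" "0 < x - 2" "0 < x - 1" "0 < x"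
      "0 < 2 * x - y - 1" "0 < 2 * x - y" "0 < x - r1" "0 < x - r2" "0 < x" "4 * x < 3 * y"
      "y < 4"
  shows "form_const x y \<le> - 2037 * lam"
  using ln_tangent_neg_inv[OF assms(1) slope_at_m49]
    ln_tangent_pos_inv[OF assms(2) slope_at_m3]
    ln_tangent_neg_inv[OF assms(3) slope_at_m38]
    ln_tangent_pos_inv[OF assms(4) slope_at_m7]
    ln_tangent_pos[OF assms(5) slope_at_11]
    ln_tangent_pos[OF assms(6) slope_at_21]
    ln_tangent_pos_inv[OF assms(7) slope_at_m10]
    ln_tangent_pos[OF assms(8) slope_at_9]
    ln_tangent_pos[OF assms(9) slope_at_17]
    ln_tangent_pos_inv[OF assms(10) slope_at_m42]
    lam_bounds r_bounds assms
  unfolding form_const_def of_nat_numeral of_nat_0 of_nat_1 ring_distribs by linarith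

lemma form_const_conj_cell19:
  fixes x y :: real
  assumes "y - 4 < 0" "0 < y - 3" "0 < x - y + 1" "0 < x - 2" "0 < x - 1" "0 < x"
      "0 < 2 * x - y - 1" "0 < 2 * x - y" "0 < x - r1" "x - r2 < 0" "0 < x" "4 * x < 3 * y"
      "y < 4"
  shows "form_const x y \<le> - 2037 * lam"
  using ln_tangent_neg_inv[OF assms(1) slope_at_m6]
    ln_tangent_pos_inv[OF assms(2) slope_at_m25]
    ln_tangent_pos_inv[OF assms(3) slope_at_m36]
    ln_tangent_pos_inv[OF assms(4) slope_at_m15]
    ln_tangent_pos[OF assms(5) slope_at_8]
    ln_tangent_pos[OF assms(6) slope_at_19]
    ln_tangent_pos_inv[OF assms(7) slope_at_m9]
    ln_tangent_pos[OF assms(8) slope_at_10]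
    ln_tangent_pos[OF assms(9) slope_at_15]
    ln_tangent_neg_inv[OF assms(10) slope_at_m39]
    lam_bounds r_bounds assms
  unfolding form_const_def of_nat_numeral of_nat_0 of_nat_1 ring_distribs by linarith

lemma form_const_conj_cell20:
  fixes x y :: real
  assumes "y - 4 < 0" "0 < y - 3" "0 < x - y + 1" "0 < x - 2" "0 < x - 1" "0 < x"
      "0 < 2 * x - y - 1" "0 < 2 * x - y" "0 < x - r1" "0 < x - r2" "0 < x" "4 * x < 3 * y"
      "y < 4"
  shows "form_const x y \<le> - 2037 * lam"
  using ln_tangent_neg_inv[OF assms(1) slope_at_m23]
    ln_tangent_pos_inv[OF assms(2) slope_at_m9]
    ln_tangent_pos_inv[OF assms(3) slope_at_m51]
    ln_tangent_pos_inv[OF assms(4) slope_at_m6]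
    ln_tangent_pos[OF assms(5) slope_at_11]
    ln_tangent_pos[OF assms(6) slope_at_21]
    ln_tangent_pos_inv[OF assms(7) slope_at_m4]
    ln_tangent_pos[OF assms(8) slope_at_12]
    ln_tangent_pos[OF assms(9) slope_at_18]
    ln_tangent_pos_inv[OF assms(10) slope_at_m41]
    lam_bounds r_bounds assms
  unfolding form_const_def of_nat_numeral of_nat_0 of_nat_1 ring_distribs by linarith

text \<open>Only signs that are still open are split; linear arithmetic derives the remaining ones,
  which also discards the empty sign patterns.\<close>

lemma form_const_conj:
  fixes x y :: real
  assumes "0 < x" "4 * x < 3 * y" "y < 4"
    and "y - 4 \<noteq> 0" "y - 3 \<noteq> 0" "x - y + 1 \<noteq> 0" "x - 2 \<noteq> 0"
        "x - 1 \<noteq> 0" "x \<noteq> 0" "2 * x - y - 1 \<noteq> 0" "2 * x - y \<noteq> 0"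
        "x - r1 \<noteq> 0" "x - r2 \<noteq> 0"
  shows "form_const x y \<le> - 2037 * lam"
proof -
  show ?thesis
  proof (cases "y - 3 < 0")
    case h1: True
    show ?thesis
    proof (cases "x - 1 < 0")
      case h2: True
      show ?thesis
      proof (cases "x - y + 1 < 0")
        case h3: True
        show ?thesis
        proof (cases "x - r1 < 0")
          case h4: True
          show ?thesis
            by (rule form_const_conj_cell1) (use assms(1-3) h1 h2 h3 h4 r_bounds in linarith)+
        next
          case False
          then have h4: "0 < x - r1"
            using assms(12) by simp
          show ?thesis
            by (rule form_const_conj_cell2) (use assms(1-3) h1 h2 h3 h4 r_bounds in linarith)+
        qed
      next
        case False
        then have h3: "0 < x - y + 1"
          using assms(6) by simp
        show ?thesis
        proof (cases "2 * x - y < 0")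
          case h4: True
          show ?thesis
          proof (cases "x - r1 < 0")
            case h5: True
            show ?thesis
              by (rule form_const_conj_cell3) (use assms(1-3) h1 h2 h3 h4 h5 r_bounds in linarith)+
          next
            case False
            then have h5: "0 < x - r1"
              using assms(12) by simp
            show ?thesis
              by (rule form_const_conj_cell4) (use assms(1-3) h1 h2 h3 h4 h5 r_bounds in linarith)+
          qed
        next
          case False
          then have h4: "0 < 2 * x - y"
            using assms(11) by simp
          show ?thesis
          proof (cases "x - r1 < 0")
            case h5: True
            show ?thesis
              by (rule form_const_conj_cell5) (use assms(1-3) h1 h2 h3 h4 h5 r_bounds in linarith)+
          next
            case False
            then have h5: "0 < x - r1"
              using assms(12) by simp
            show ?thesis
              by (rule form_const_conj_cell6) (use assms(1-3) h1 h2 h3 h4 h5 r_bounds in linarith)+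
          qed
        qed
      qed
    next
      case False
      then have h2: "0 < x - 1"
        using assms(8) by simp
      show ?thesis
      proof (cases "x - y + 1 < 0")
        case h3: True
        show ?thesis
        proof (cases "2 * x - y < 0")
          case h4: True
          show ?thesis
            by (rule form_const_conj_cell7) (use assms(1-3) h1 h2 h3 h4 r_bounds in linarith)+
        next
          case False
          then have h4: "0 < 2 * x - y"
            using assms(11) by simp
          show ?thesis
            by (rule form_const_conj_cell8) (use assms(1-3) h1 h2 h3 h4 r_bounds in linarith)+
        qed
      next
        case False
        then have h3: "0 < x - y + 1"
          using assms(6) by simp
        show ?thesis
        proof (cases "x - 2 < 0")
          case h4: True
          show ?thesis
          proof (cases "2 * x - y - 1 < 0")
            case h5: True
            show ?thesis
              by (rule form_const_conj_cell9) (use assms(1-3) h1 h2 h3 h4 h5 r_bounds in linarith)+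
          next
            case False
            then have h5: "0 < 2 * x - y - 1"
              using assms(10) by simp
            show ?thesis
              by (rule form_const_conj_cell10) (use assms(1-3) h1 h2 h3 h4 h5 r_bounds in linarith)+
          qed
        next
          case False
          then have h4: "0 < x - 2"
            using assms(7) by simp
          show ?thesis
            by (rule form_const_conj_cell11) (use assms(1-3) h1 h2 h3 h4 r_bounds in linarith)+
        qed
      qed
    qed
  next
    case False
    then have h1: "0 < y - 3"
      using assms(5) by simp
    show ?thesis
    proof (cases "x - 1 < 0")
      case h2: True
      show ?thesis
      proof (cases "x - r1 < 0")
        case h3: True
        show ?thesis
          by (rule form_const_conj_cell12) (use assms(1-3) h1 h2 h3 r_bounds in linarith)+
      next
        case False
        then have h3: "0 < x - r1"
          using assms(12) by simp
        show ?thesis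
          by (rule form_const_conj_cell13) (use assms(1-3) h1 h2 h3 r_bounds in linarith)+
      qed
    next
      case False
      then have h2: "0 < x - 1"
        using assms(8) by simp
      show ?thesis
      proof (cases "x - y + 1 < 0")
        case h3: True
        show ?thesis
        proof (cases "x - 2 < 0")
          case h4: True
          show ?thesis
          proof (cases "2 * x - y < 0")
            case h5: True
            show ?thesis
              by (rule form_const_conj_cell14) (use assms(1-3) h1 h2 h3 h4 h5 r_bounds in linarith)+
          next
            case False
            then have h5: "0 < 2 * x - y"
              using assms(11) by simp
            show ?thesis
              by (rule form_const_conj_cell15) (use assms(1-3) h1 h2 h3 h4 h5 r_bounds in linarith)+
          qed
        next
          case False
          then have h4: "0 < x - 2"
            using assms(7) by simp
          show ?thesis
          proof (cases "2 * x - y - 1 < 0")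
            case h5: True
            show ?thesis
              by (rule form_const_conj_cell16) (use assms(1-3) h1 h2 h3 h4 h5 r_bounds in linarith)+
          next
            case False
            then have h5: "0 < 2 * x - y - 1"
              using assms(10) by simp
            show ?thesis
            proof (cases "x - r2 < 0")
              case h6: True
              show ?thesis
                by (rule form_const_conj_cell17) (use assms(1-3) h1 h2 h3 h4 h5 h6 r_bounds in linarith)+
            next
              case False
              then have h6: "0 < x - r2"
                using assms(13) by simp
              show ?thesis
                by (rule form_const_conj_cell18) (use assms(1-3) h1 h2 h3 h4 h5 h6 r_bounds in linarith)+
            qed
          qed
        qed
      next
        case False
        then have h3: "0 < x - y + 1"
          using assms(6) by simp
        show ?thesis
        proof (cases "x - r2 < 0")
          case h4: True
          show ?thesis
            by (rule form_const_conj_cell19) (use assms(1-3) h1 h2 h3 h4 r_bounds in linarith)+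
        next
          case False
          then have h4: "0 < x - r2"
            using assms(13) by simp
          show ?thesis
            by (rule form_const_conj_cell20) (use assms(1-3) h1 h2 h3 h4 r_bounds in linarith)+
        qed
      qed
    qed
  qed
qed

text \<open>For \<open>x > 4\<close> and \<open>y <= 2\<close> every sign is constant, so one cell
  suffices. The bound is nearly reached when \<open>x\<close> tends to 196 and \<open>y\<close> to
  0.\<close>

lemma form_const_id_cell1:
  fixes x y :: real
  assumes "y - 4 < 0" "y - 3 < 0" "0 < x - y + 1" "0 < x - 2" "0 < x - 1" "0 < x"
      "0 < 2 * x - y - 1" "0 < 2 * x - y" "0 < x - r1" "0 < x - r2" "4 < x" "x < 196" "0 < y"
      "y \<le> 2"
  shows "form_const x y \<le> 39952 * lam"
  using ln_tangent_neg[OF assms(1) slope_at_28]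
    ln_tangent_neg[OF assms(2) slope_at_23]
    ln_tangent_pos[OF assms(3) slope_at_108]
    ln_tangent_pos[OF assms(4) slope_at_108]
    ln_tangent_pos[OF assms(5) slope_at_108]
    ln_tangent_pos[OF assms(6) slope_at_108]
    ln_tangent_pos[OF assms(7) slope_at_122]
    ln_tangent_pos[OF assms(8) slope_at_122]
    ln_tangent_pos[OF assms(9) slope_at_108]
    ln_tangent_pos[OF assms(10) slope_at_108]
    lam_bounds r_bounds assms
  unfolding form_const_def of_nat_numeral of_nat_0 of_nat_1 ring_distribs by linarith

lemma form_const_id:
  fixes x y :: real
  assumes "4 < x" "x < 196" "0 < y" "y \<le> 2"
    and "y - 4 \<noteq> 0" "y - 3 \<noteq> 0" "x - y + 1 \<noteq> 0" "x - 2 \<noteq> 0"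
        "x - 1 \<noteq> 0" "x \<noteq> 0" "2 * x - y - 1 \<noteq> 0" "2 * x - y \<noteq> 0"
        "x - r1 \<noteq> 0" "x - r2 \<noteq> 0"
  shows "form_const x y \<le> 39952 * lam"
  by (rule form_const_id_cell1) (use assms(1-4) r_bounds in linarith)+

section \<open>Estimates for s = 5, one family for each root of y^2 - 5 y + 5\<close>

lemma form_5_conj1_cell1:
  fixes x y :: real
  assumes "0 < 4 - y" "0 < x" "x - y < 0" "x - 1 < 0" "x - y + 1 < 0" "(138196 / 100000) < y"
      "y < (138197 / 100000)" "0 < x" "x < y"
  shows "7 * ln (4 - y) + 3 * ln x + 3 * ln (x - y) + 4 * ln (x - 1) + 4 * ln (x - y + 1) \<le> - 97 * lam"
  using ln_tangent_pos[OF assms(1) slope_at_20]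
    ln_tangent_pos_inv[OF assms(2) slope_at_m41]
    ln_tangent_neg[OF assms(3) slope_at_5]
    ln_tangent_neg_inv[OF assms(4) slope_at_m1]
    ln_tangent_neg_inv[OF assms(5) slope_at_m28]
    lam_bounds  assms
  unfolding  of_nat_numeral of_nat_0 of_nat_1 ring_distribs by linarith

lemma form_5_conj1_cell2:
  fixes x y :: real
  assumes "0 < 4 - y" "0 < x" "x - y < 0" "x - 1 < 0" "0 < x - y + 1" "(138196 / 100000) < y"
      "y < (138197 / 100000)" "0 < x" "x < y"
  shows "7 * ln (4 - y) + 3 * ln x + 3 * ln (x - y) + 4 * ln (x - 1) + 4 * ln (x - y + 1) \<le> - 97 * lam"
  using ln_tangent_pos[OF assms(1) slope_at_20]
    ln_tangent_pos_inv[OF assms(2) slope_at_m8]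
    ln_tangent_neg_inv[OF assms(3) slope_at_m8]
    ln_tangent_neg_inv[OF assms(4) slope_at_m24]
    ln_tangent_pos_inv[OF assms(5) slope_at_m24]
    lam_bounds  assms
  unfolding  of_nat_numeral of_nat_0 of_nat_1 ring_distribs by linarith

lemma form_5_conj1_cell3:
  fixes x y :: real
  assumes "0 < 4 - y" "0 < x" "x - y < 0" "0 < x - 1" "0 < x - y + 1" "(138196 / 100000) < y"
      "y < (138197 / 100000)" "0 < x" "x < y"
  shows "7 * ln (4 - y) + 3 * ln x + 3 * ln (x - y) + 4 * ln (x - 1) + 4 * ln (x - y + 1) \<le> - 97 * lam"
  using ln_tangent_pos[OF assms(1) slope_at_20]
    ln_tangent_pos[OF assms(2) slope_at_5]
    ln_tangent_neg_inv[OF assms(3) slope_at_m41]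
    ln_tangent_pos_inv[OF assms(4) slope_at_m27]
    ln_tangent_pos_inv[OF assms(5) slope_at_m4]
    lam_bounds  assms
  unfolding  of_nat_numeral of_nat_0 of_nat_1 ring_distribs by linarith

lemma form_5_conj1:
  fixes x y :: real
  assumes "(138196 / 100000) < y" "y < (138197 / 100000)" "0 < x" "x < y"
    and "4 - y \<noteq> 0" "x \<noteq> 0" "x - y \<noteq> 0" "x - 1 \<noteq> 0"
        "x - y + 1 \<noteq> 0"
  shows "7 * ln (4 - y) + 3 * ln x + 3 * ln (x - y) + 4 * ln (x - 1) + 4 * ln (x - y + 1) \<le> - 97 * lam"
proof -
  show ?thesis
  proof (cases "x - 1 < 0")
    case h1: True
    show ?thesis
    proof (cases "x - y + 1 < 0")
      case h2: True
      show ?thesis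
        by (rule form_5_conj1_cell1) (use assms(1-4) h1 h2  in linarith)+
    next
      case False
      then have h2: "0 < x - y + 1"
        using assms(9) by simp
      show ?thesis
        by (rule form_5_conj1_cell2) (use assms(1-4) h1 h2  in linarith)+
    qed
  next
    case False
    then have h1: "0 < x - 1"
      using assms(8) by simp
    show ?thesis
      by (rule form_5_conj1_cell3) (use assms(1-4) h1  in linarith)+
  qed
qed

lemma form_5_conj2_cell1:
  fixes x y :: real
  assumes "0 < 4 - y" "0 < x" "x - y < 0" "x - 1 < 0" "x - y + 1 < 0" "(361803 / 100000) < y"
      "y < (361804 / 100000)" "0 < x" "x < y"
  shows "7 * ln (4 - y) + 3 * ln x + 3 * ln (x - y) + 4 * ln (x - 1) + 4 * ln (x - y + 1) \<le> - 97 * lam"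
  using ln_tangent_pos_inv[OF assms(1) slope_at_m20]
    ln_tangent_pos_inv[OF assms(2) slope_at_m22]
    ln_tangent_neg[OF assms(3) slope_at_24]
    ln_tangent_neg_inv[OF assms(4) slope_at_m9]
    ln_tangent_neg[OF assms(5) slope_at_18]
    lam_bounds  assms
  unfolding  of_nat_numeral of_nat_0 of_nat_1 ring_distribs by linarith

lemma form_5_conj2_cell2:
  fixes x y :: real
  assumes "0 < 4 - y" "0 < x" "x - y < 0" "0 < x - 1" "x - y + 1 < 0" "(361803 / 100000) < y"
      "y < (361804 / 100000)" "0 < x" "x < y"
  shows "7 * ln (4 - y) + 3 * ln x + 3 * ln (x - y) + 4 * ln (x - 1) + 4 * ln (x - y + 1) \<le> - 97 * lam"
  using ln_tangent_pos_inv[OF assms(1) slope_at_m20]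
    ln_tangent_pos[OF assms(2) slope_at_12]
    ln_tangent_neg[OF assms(3) slope_at_12]
    ln_tangent_pos_inv[OF assms(4) slope_at_m4]
    ln_tangent_neg_inv[OF assms(5) slope_at_m4]
    lam_bounds  assms
  unfolding  of_nat_numeral of_nat_0 of_nat_1 ring_distribs by linarith

lemma form_5_conj2_cell3:
  fixes x y :: real
  assumes "0 < 4 - y" "0 < x" "x - y < 0" "0 < x - 1" "0 < x - y + 1" "(361803 / 100000) < y"
      "y < (361804 / 100000)" "0 < x" "x < y"
  shows "7 * ln (4 - y) + 3 * ln x + 3 * ln (x - y) + 4 * ln (x - 1) + 4 * ln (x - y + 1) \<le> - 97 * lam"
  using ln_tangent_pos_inv[OF assms(1) slope_at_m20]
    ln_tangent_pos[OF assms(2) slope_at_24]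
    ln_tangent_neg_inv[OF assms(3) slope_at_m22]
    ln_tangent_pos[OF assms(4) slope_at_18]
    ln_tangent_pos_inv[OF assms(5) slope_at_m9]
    lam_bounds  assms
  unfolding  of_nat_numeral of_nat_0 of_nat_1 ring_distribs by linarith

lemma form_5_conj2:
  fixes x y :: real
  assumes "(361803 / 100000) < y" "y < (361804 / 100000)" "0 < x" "x < y"
    and "4 - y \<noteq> 0" "x \<noteq> 0" "x - y \<noteq> 0" "x - 1 \<noteq> 0"
        "x - y + 1 \<noteq> 0"
  shows "7 * ln (4 - y) + 3 * ln x + 3 * ln (x - y) + 4 * ln (x - 1) + 4 * ln (x - y + 1) \<le> - 97 * lam"
proof -
  show ?thesis
  proof (cases "x - 1 < 0")
    case h1: True
    show ?thesis
      by (rule form_5_conj2_cell1) (use assms(1-4) h1  in linarith)+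
  next
    case False
    then have h1: "0 < x - 1"
      using assms(8) by simp
    show ?thesis
    proof (cases "x - y + 1 < 0")
      case h2: True
      show ?thesis
        by (rule form_5_conj2_cell2) (use assms(1-4) h1 h2  in linarith)+
    next
      case False
      then have h2: "0 < x - y + 1"
        using assms(9) by simp
      show ?thesis
        by (rule form_5_conj2_cell3) (use assms(1-4) h1 h2  in linarith)+
    qed
  qed
qed

lemma form_5_id_cell1:
  fixes x y :: real
  assumes "0 < 4 - y" "0 < x" "0 < x - y" "0 < x - 1" "0 < x - y + 1" "(138196 / 100000) < y"
      "y < (138197 / 100000)" "4 < x" "x < 196"
  shows "7 * ln (4 - y) + 3 * ln x + 3 * ln (x - y) + 4 * ln (x - 1) + 4 * ln (x - y + 1) \<le> 1652 * lam"
  using ln_tangent_pos[OF assms(1) slope_at_20]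
    ln_tangent_pos[OF assms(2) slope_at_108]
    ln_tangent_pos[OF assms(3) slope_at_108]
    ln_tangent_pos[OF assms(4) slope_at_108]
    ln_tangent_pos[OF assms(5) slope_at_108]
    lam_bounds  assms
  unfolding  of_nat_numeral of_nat_0 of_nat_1 ring_distribs by linarith

lemma form_5_id:
  fixes x y :: real
  assumes "(138196 / 100000) < y" "y < (138197 / 100000)" "4 < x" "x < 196"
    and "4 - y \<noteq> 0" "x \<noteq> 0" "x - y \<noteq> 0" "x - 1 \<noteq> 0"
        "x - y + 1 \<noteq> 0"
  shows "7 * ln (4 - y) + 3 * ln x + 3 * ln (x - y) + 4 * ln (x - 1) + 4 * ln (x - y + 1) \<le> 1652 * lam"
  by (rule form_5_id_cell1) (use assms(1-4)  in linarith)+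

section \<open>Estimates for s = k = 7, one family for each root of the cubic\<close>

lemma form_7_7_conj1_cell1:
  fixes x y :: real
  assumes "0 < 4 - y" "0 < x - 2 * y + 4" "0 < x - y + 1" "0 < x" "(75302 / 100000) < y"
      "y < (75303 / 100000)" "0 < x" "x < (1419 / 10000)"
  shows "2 * ln (4 - y) + ln (x - 2 * y + 4) + ln (x - y + 1) + 2 * ln x \<le> - 26 * lam"
  using ln_tangent_pos[OF assms(1) slope_at_24]
    ln_tangent_pos[OF assms(2) slope_at_20]
    ln_tangent_pos_inv[OF assms(3) slope_at_m19]
    ln_tangent_pos_inv[OF assms(4) slope_at_m40]
    lam_bounds  assms
  unfolding  of_nat_numeral of_nat_0 of_nat_1 ring_distribs by linarith

text \<open>Since \<open>y = z\<close> in this case, the region is \<open>4 x < y^2\<close>. The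
  bound on \<open>x\<close>, here and for the other two roots, is \<open>y^2 / 4\<close> rounded
  up.\<close>

lemma form_7_7_conj1:
  fixes x y :: real
  assumes "(75302 / 100000) < y" "y < (75303 / 100000)" "0 < x" "x < (1419 / 10000)"
    and "4 - y \<noteq> 0" "x - 2 * y + 4 \<noteq> 0" "x - y + 1 \<noteq> 0" "x \<noteq> 0"
  shows "2 * ln (4 - y) + ln (x - 2 * y + 4) + ln (x - y + 1) + 2 * ln x \<le> - 26 * lam"
  by (rule form_7_7_conj1_cell1) (use assms(1-4)  in linarith)+

lemma form_7_7_conj2_cell1:
  fixes x y :: real
  assumes "0 < 4 - y" "x - 2 * y + 4 < 0" "x - y + 1 < 0" "0 < x" "(244504 / 100000) < y"
      "y < (244505 / 100000)" "0 < x" "x < (14947 / 10000)"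
  shows "2 * ln (4 - y) + ln (x - 2 * y + 4) + ln (x - y + 1) + 2 * ln x \<le> - 26 * lam"
  using ln_tangent_pos[OF assms(1) slope_at_9]
    ln_tangent_neg_inv[OF assms(2) slope_at_m20]
    ln_tangent_neg_inv[OF assms(3) slope_at_m2]
    ln_tangent_pos_inv[OF assms(4) slope_at_m13]
    lam_bounds  assms
  unfolding  of_nat_numeral of_nat_0 of_nat_1 ring_distribs by linarith

lemma form_7_7_conj2_cell2:
  fixes x y :: real
  assumes "0 < 4 - y" "0 < x - 2 * y + 4" "x - y + 1 < 0" "0 < x" "(244504 / 100000) < y"
      "y < (244505 / 100000)" "0 < x" "x < (14947 / 10000)"
  shows "2 * ln (4 - y) + ln (x - 2 * y + 4) + ln (x - y + 1) + 2 * ln x \<le> - 26 * lam"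
  using ln_tangent_pos[OF assms(1) slope_at_9]
    ln_tangent_pos_inv[OF assms(2) slope_at_m22]
    ln_tangent_neg_inv[OF assms(3) slope_at_m31]
    ln_tangent_pos[OF assms(4) slope_at_4]
    lam_bounds  assms
  unfolding  of_nat_numeral of_nat_0 of_nat_1 ring_distribs by linarith

lemma form_7_7_conj2_cell3:
  fixes x y :: real
  assumes "0 < 4 - y" "0 < x - 2 * y + 4" "0 < x - y + 1" "0 < x" "(244504 / 100000) < y"
      "y < (244505 / 100000)" "0 < x" "x < (14947 / 10000)"
  shows "2 * ln (4 - y) + ln (x - 2 * y + 4) + ln (x - y + 1) + 2 * ln x \<le> - 26 * lam"
  using ln_tangent_pos[OF assms(1) slope_at_9]
    ln_tangent_pos_inv[OF assms(2) slope_at_m10]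
    ln_tangent_pos_inv[OF assms(3) slope_at_m62]
    ln_tangent_pos[OF assms(4) slope_at_8]
    lam_bounds  assms
  unfolding  of_nat_numeral of_nat_0 of_nat_1 ring_distribs by linarith

lemma form_7_7_conj2:
  fixes x y :: real
  assumes "(244504 / 100000) < y" "y < (244505 / 100000)" "0 < x" "x < (14947 / 10000)"
    and "4 - y \<noteq> 0" "x - 2 * y + 4 \<noteq> 0" "x - y + 1 \<noteq> 0" "x \<noteq> 0"
  shows "2 * ln (4 - y) + ln (x - 2 * y + 4) + ln (x - y + 1) + 2 * ln x \<le> - 26 * lam"
proof -
  show ?thesis
  proof (cases "x - 2 * y + 4 < 0")
    case h1: True
    show ?thesis
      by (rule form_7_7_conj2_cell1) (use assms(1-4) h1  in linarith)+
  next
    case False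
    then have h1: "0 < x - 2 * y + 4"
      using assms(6) by simp
    show ?thesis
    proof (cases "x - y + 1 < 0")
      case h2: True
      show ?thesis
        by (rule form_7_7_conj2_cell2) (use assms(1-4) h1 h2  in linarith)+
    next
      case False
      then have h2: "0 < x - y + 1"
        using assms(7) by simp
      show ?thesis
        by (rule form_7_7_conj2_cell3) (use assms(1-4) h1 h2  in linarith)+
    qed
  qed
qed

lemma form_7_7_conj3_cell1:
  fixes x y :: real
  assumes "0 < 4 - y" "x - 2 * y + 4 < 0" "x - y + 1 < 0" "0 < x" "(380193 / 100000) < y"
      "y < (380194 / 100000)" "0 < x" "x < (36138 / 10000)"
  shows "2 * ln (4 - y) + ln (x - 2 * y + 4) + ln (x - y + 1) + 2 * ln x \<le> - 26 * lam"
  using ln_tangent_pos_inv[OF assms(1) slope_at_m33]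
    ln_tangent_neg[OF assms(2) slope_at_14]
    ln_tangent_neg[OF assms(3) slope_at_5]
    ln_tangent_pos[OF assms(4) slope_at_9]
    lam_bounds  assms
  unfolding  of_nat_numeral of_nat_0 of_nat_1 ring_distribs by linarith

lemma form_7_7_conj3_cell2:
  fixes x y :: real
  assumes "0 < 4 - y" "x - 2 * y + 4 < 0" "0 < x - y + 1" "0 < x" "(380193 / 100000) < y"
      "y < (380194 / 100000)" "0 < x" "x < (36138 / 10000)"
  shows "2 * ln (4 - y) + ln (x - 2 * y + 4) + ln (x - y + 1) + 2 * ln x \<le> - 26 * lam"
  using ln_tangent_pos_inv[OF assms(1) slope_at_m33]
    ln_tangent_neg_inv[OF assms(2) slope_at_m21]
    ln_tangent_pos_inv[OF assms(3) slope_at_m16]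
    ln_tangent_pos[OF assms(4) slope_at_24]
    lam_bounds  assms
  unfolding  of_nat_numeral of_nat_0 of_nat_1 ring_distribs by linarith

lemma form_7_7_conj3_cell3:
  fixes x y :: real
  assumes "0 < 4 - y" "0 < x - 2 * y + 4" "0 < x - y + 1" "0 < x" "(380193 / 100000) < y"
      "y < (380194 / 100000)" "0 < x" "x < (36138 / 10000)"
  shows "2 * ln (4 - y) + ln (x - 2 * y + 4) + ln (x - y + 1) + 2 * ln x \<le> - 26 * lam"
  using ln_tangent_pos_inv[OF assms(1) slope_at_m33]
    ln_tangent_pos_inv[OF assms(2) slope_at_m95]
    ln_tangent_pos_inv[OF assms(3) slope_at_m4]
    ln_tangent_pos[OF assms(4) slope_at_26]
    lam_bounds  assms
  unfolding  of_nat_numeral of_nat_0 of_nat_1 ring_distribs by linarith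

lemma form_7_7_conj3:
  fixes x y :: real
  assumes "(380193 / 100000) < y" "y < (380194 / 100000)" "0 < x" "x < (36138 / 10000)"
    and "4 - y \<noteq> 0" "x - 2 * y + 4 \<noteq> 0" "x - y + 1 \<noteq> 0" "x \<noteq> 0"
  shows "2 * ln (4 - y) + ln (x - 2 * y + 4) + ln (x - y + 1) + 2 * ln x \<le> - 26 * lam"
proof -
  show ?thesis
  proof (cases "x - 2 * y + 4 < 0")
    case h1: True
    show ?thesis
    proof (cases "x - y + 1 < 0")
      case h2: True
      show ?thesis
        by (rule form_7_7_conj3_cell1) (use assms(1-4) h1 h2  in linarith)+
    next
      case False
      then have h2: "0 < x - y + 1"
        using assms(7) by simp
      show ?thesis
        by (rule form_7_7_conj3_cell2) (use assms(1-4) h1 h2  in linarith)+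
    qed
  next
    case False
    then have h1: "0 < x - 2 * y + 4"
      using assms(6) by simp
    show ?thesis
      by (rule form_7_7_conj3_cell3) (use assms(1-4) h1  in linarith)+
  qed
qed

lemma form_7_7_id_cell1:
  fixes x y :: real
  assumes "0 < 4 - y" "0 < x - 2 * y + 4" "0 < x - y + 1" "0 < x" "(75302 / 100000) < y"
      "y < (75303 / 100000)" "4 < x" "x < 196"
  shows "2 * ln (4 - y) + ln (x - 2 * y + 4) + ln (x - y + 1) + 2 * ln x \<le> 482 * lam"
  using ln_tangent_pos[OF assms(1) slope_at_24]
    ln_tangent_pos[OF assms(2) slope_at_108]
    ln_tangent_pos[OF assms(3) slope_at_108]
    ln_tangent_pos[OF assms(4) slope_at_108]
    lam_bounds  assms
  unfolding  of_nat_numeral of_nat_0 of_nat_1 ring_distribs by linarith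

lemma form_7_7_id:
  fixes x y :: real
  assumes "(75302 / 100000) < y" "y < (75303 / 100000)" "4 < x" "x < 196"
    and "4 - y \<noteq> 0" "x - 2 * y + 4 \<noteq> 0" "x - y + 1 \<noteq> 0" "x \<noteq> 0"
  shows "2 * ln (4 - y) + ln (x - 2 * y + 4) + ln (x - y + 1) + 2 * ln x \<le> 482 * lam"
  by (rule form_7_7_id_cell1) (use assms(1-4)  in linarith)+

section \<open>Estimates in one variable for indices from 8 on, and the cubic for index 7\<close>

definition p1 :: real where "p1 = (5 - sqrt 5) / 2"
definition p2 :: real where "p2 = (5 + sqrt 5) / 2"

lemma p_bounds: "(138196 / 100000) < p1" "p1 < (138197 / 100000)" "(361803 / 100000) < p2" "p2 < (361804 / 100000)"
  using sqrt5_bounds by (simp_all add: p1_def p2_def)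

text \<open>The minimal polynomial of \<open>4 sin^2 (pi / 7)\<close>: write
  \<open>sin (7 t) / sin t\<close> as a polynomial in \<open>4 sin^2 t\<close> and change the
  sign.\<close>

definition sept :: "real \<Rightarrow> real" where "sept y = y ^ 3 - 7 * y\<^sup>2 + 14 * y - 7"

text \<open>Pinned down by its equation and a narrow interval, since the estimates need only
  rational enclosures. The link with the angle pi / 7 is made by \<open>chord_7\<close>.\<close>

definition t1 :: real where "t1 = (SOME t. (7530203 / 10000000) < t \<and> t < (7530204 / 10000000) \<and> sept t = 0)"

lemma t1: "(7530203 / 10000000) < t1 \<and> t1 < (7530204 / 10000000) \<and> sept t1 = 0"
proof -
  have "\<exists>t. (7530203 / 10000000) \<le> t \<and> t \<le> (7530204 / 10000000) \<and> sept t = 0"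
    by (rule IVT') (auto simp: sept_def power2_eq_square power3_eq_cube intro!: continuous_intros)
  moreover have "sept (7530203 / 10000000) \<noteq> 0" "sept (7530204 / 10000000) \<noteq> 0"
    by (simp_all add: sept_def power2_eq_square power3_eq_cube)
  ultimately have "\<exists>t. (7530203 / 10000000) < t \<and> t < (7530204 / 10000000) \<and> sept t = 0"
    by (metis less_eq_real_def)
  then show ?thesis
    unfolding t1_def by (rule someI_ex)
qed

text \<open>Doubling the angle permutes the numbers \<open>4 sin\<^sup>2 (j \<pi> / 7)\<close> and acts on them by \<open>y \<mapsto> y (4 - y)\<close>.\<close>

definition t2 :: real where "t2 = 4 * t1 - t1\<^sup>2"
definition t3 :: real where "t3 = 7 - 5 * t1 + t1\<^sup>2"

lemma t_bounds: "(75302 / 100000) < t1" "t1 < (75303 / 100000)" "(244504 / 100000) < t2" "t2 < (244505 / 100000)" "(380193 / 100000) < t3" "t3 < (380194 / 100000)"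
proof -
  have "(7530203 / 10000000)\<^sup>2 < t1\<^sup>2" "t1\<^sup>2 < (7530204 / 10000000)\<^sup>2"
    using t1 by (auto intro!: power_strict_mono)
  then show "(75302 / 100000) < t1" "t1 < (75303 / 100000)" "(244504 / 100000) < t2" "t2 < (244505 / 100000)" "(380193 / 100000) < t3" "t3 < (380194 / 100000)"
    using t1 unfolding t2_def t3_def by (simp_all add: power2_eq_square)
qed

lemma sept_factor: "sept y = (y - t1) * (y - t2) * (y - t3)"
proof -
  \<comment> \<open>The sum \<open>t1 + t2 + t3\<close> is 7 identically; the other two elementary
    symmetric functions have the right values only modulo \<open>sept t1\<close>, which produces the
    cofactor.\<close>
  have "(y - t1) * (y - t2) * (y - t3) = sept y + sept t1 * ((2 - t1) * y - (1 + 2 * t1 - t1\<^sup>2))"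
    by (simp add: sept_def t2_def t3_def power2_eq_square power3_eq_cube algebra_simps)
  then show ?thesis
    using t1 by simp
qed

text \<open>The variable \<open>y\<close> itself is left out: the term \<open>300 * ln y\<close>
  that accompanies this form later comes from separating the variables and not from a norm.\<close>

definition form_tail :: "real \<Rightarrow> real" where
  "form_tail y = 93 * ln (y - 4) + 118 * ln (y - 3) + 61 * ln (y - 2) + 100 * (ln (y - p1) + ln (y - p2)) +
     43 * (ln (y - t1) + ln (y - t2) + ln (y - t3)) + 7 * ln (y - 1)"

lemma form_tail_conj_cell1:
  fixes y :: real
  assumes "0 < y" "y - 4 < 0" "y - 3 < 0" "y - 2 < 0" "y - p1 < 0" "y - p2 < 0" "y - t1 < 0"
      "y - t2 < 0" "y - t3 < 0" "y - 1 < 0" "0 < y" "y < 4"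
  shows "300 * ln y + form_tail y \<le> 3334 * lam"
  using ln_tangent_pos_inv[OF assms(1) slope_at_m12]
    ln_tangent_neg[OF assms(2) slope_at_26]
    ln_tangent_neg[OF assms(3) slope_at_18]
    ln_tangent_neg[OF assms(4) slope_at_8]
    ln_tangent_neg_inv[OF assms(5) slope_at_m4]
    ln_tangent_neg[OF assms(6) slope_at_23]
    ln_tangent_neg_inv[OF assms(7) slope_at_m33]
    ln_tangent_neg[OF assms(8) slope_at_13]
    ln_tangent_neg[OF assms(9) slope_at_24]
    ln_tangent_neg_inv[OF assms(10) slope_at_m18]
    lam_bounds p_bounds t_bounds assms
  unfolding form_tail_def of_nat_numeral of_nat_0 of_nat_1 ring_distribs by linarith

lemma form_tail_conj_cell2:
  fixes y :: real
  assumes "0 < y" "y - 4 < 0" "y - 3 < 0" "y - 2 < 0" "y - p1 < 0" "y - p2 < 0" "0 < y - t1"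
      "y - t2 < 0" "y - t3 < 0" "y - 1 < 0" "0 < y" "y < 4"
  shows "300 * ln y + form_tail y \<le> 3334 * lam"
  using ln_tangent_pos_inv[OF assms(1) slope_at_m2]
    ln_tangent_neg[OF assms(2) slope_at_23]
    ln_tangent_neg[OF assms(3) slope_at_14]
    ln_tangent_neg[OF assms(4) slope_at_1]
    ln_tangent_neg_inv[OF assms(5) slope_at_m17]
    ln_tangent_neg[OF assms(6) slope_at_20]
    ln_tangent_pos_inv[OF assms(7) slope_at_m35]
    ln_tangent_neg[OF assms(8) slope_at_8]
    ln_tangent_neg[OF assms(9) slope_at_21]
    ln_tangent_neg_inv[OF assms(10) slope_at_m56]
    lam_bounds p_bounds t_bounds assms
  unfolding form_tail_def of_nat_numeral of_nat_0 of_nat_1 ring_distribs by linarith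

lemma form_tail_conj_cell3:
  fixes y :: real
  assumes "0 < y" "y - 4 < 0" "y - 3 < 0" "y - 2 < 0" "y - p1 < 0" "y - p2 < 0" "0 < y - t1"
      "y - t2 < 0" "y - t3 < 0" "0 < y - 1" "0 < y" "y < 4"
  shows "300 * ln y + form_tail y \<le> 3334 * lam"
  using ln_tangent_pos[OF assms(1) slope_at_1]
    ln_tangent_neg[OF assms(2) slope_at_22]
    ln_tangent_neg[OF assms(3) slope_at_14]
    ln_tangent_neg_inv[OF assms(4) slope_at_m1]
    ln_tangent_neg_inv[OF assms(5) slope_at_m23]
    ln_tangent_neg[OF assms(6) slope_at_19]
    ln_tangent_pos_inv[OF assms(7) slope_at_m24]
    ln_tangent_neg[OF assms(8) slope_at_7]
    ln_tangent_neg[OF assms(9) slope_at_20]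
    ln_tangent_pos_inv[OF assms(10) slope_at_m59]
    lam_bounds p_bounds t_bounds assms
  unfolding form_tail_def of_nat_numeral of_nat_0 of_nat_1 ring_distribs by linarith

lemma form_tail_conj_cell4:
  fixes y :: real
  assumes "0 < y" "y - 4 < 0" "y - 3 < 0" "y - 2 < 0" "0 < y - p1" "y - p2 < 0" "0 < y - t1"
      "y - t2 < 0" "y - t3 < 0" "0 < y - 1" "0 < y" "y < 4"
  shows "300 * ln y + form_tail y \<le> 3334 * lam"
  using ln_tangent_pos[OF assms(1) slope_at_11]
    ln_tangent_neg[OF assms(2) slope_at_17]
    ln_tangent_neg[OF assms(3) slope_at_5]
    ln_tangent_neg_inv[OF assms(4) slope_at_m28]
    ln_tangent_pos_inv[OF assms(5) slope_at_m21]
    ln_tangent_neg[OF assms(6) slope_at_13]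
    ln_tangent_pos[OF assms(7) slope_at_0]
    ln_tangent_neg_inv[OF assms(8) slope_at_m7]
    ln_tangent_neg[OF assms(9) slope_at_15]
    ln_tangent_pos_inv[OF assms(10) slope_at_m6]
    lam_bounds p_bounds t_bounds assms
  unfolding form_tail_def of_nat_numeral of_nat_0 of_nat_1 ring_distribs by linarith

lemma form_tail_conj_cell5:
  fixes y :: real
  assumes "0 < y" "y - 4 < 0" "y - 3 < 0" "0 < y - 2" "0 < y - p1" "y - p2 < 0" "0 < y - t1"
      "y - t2 < 0" "y - t3 < 0" "0 < y - 1" "0 < y" "y < 4"
  shows "300 * ln y + form_tail y \<le> 3334 * lam"
  using ln_tangent_pos[OF assms(1) slope_at_17]
    ln_tangent_neg[OF assms(2) slope_at_10]
    ln_tangent_neg_inv[OF assms(3) slope_at_m6]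
    ln_tangent_pos_inv[OF assms(4) slope_at_m29]
    ln_tangent_pos_inv[OF assms(5) slope_at_m3]
    ln_tangent_neg[OF assms(6) slope_at_6]
    ln_tangent_pos[OF assms(7) slope_at_8]
    ln_tangent_neg_inv[OF assms(8) slope_at_m33]
    ln_tangent_neg[OF assms(9) slope_at_9]
    ln_tangent_pos[OF assms(10) slope_at_4]
    lam_bounds p_bounds t_bounds assms
  unfolding form_tail_def of_nat_numeral of_nat_0 of_nat_1 ring_distribs by linarith

lemma form_tail_conj_cell6:
  fixes y :: real
  assumes "0 < y" "y - 4 < 0" "y - 3 < 0" "0 < y - 2" "0 < y - p1" "y - p2 < 0" "0 < y - t1"
      "0 < y - t2" "y - t3 < 0" "0 < y - 1" "0 < y" "y < 4"
  shows "300 * ln y + form_tail y \<le> 3334 * lam"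
  using ln_tangent_pos[OF assms(1) slope_at_20]
    ln_tangent_neg[OF assms(2) slope_at_6]
    ln_tangent_neg_inv[OF assms(3) slope_at_m21]
    ln_tangent_pos_inv[OF assms(4) slope_at_m10]
    ln_tangent_pos[OF assms(5) slope_at_5]
    ln_tangent_neg[OF assms(6) slope_at_0]
    ln_tangent_pos[OF assms(7) slope_at_13]
    ln_tangent_pos_inv[OF assms(8) slope_at_m33]
    ln_tangent_neg[OF assms(9) slope_at_4]
    ln_tangent_pos[OF assms(10) slope_at_8]
    lam_bounds p_bounds t_bounds assms
  unfolding form_tail_def of_nat_numeral of_nat_0 of_nat_1 ring_distribs by linarith

lemma form_tail_conj_cell7:
  fixes y :: real
  assumes "0 < y" "y - 4 < 0" "0 < y - 3" "0 < y - 2" "0 < y - p1" "y - p2 < 0" "0 < y - t1"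
      "0 < y - t2" "y - t3 < 0" "0 < y - 1" "0 < y" "y < 4"
  shows "300 * ln y + form_tail y \<le> 3334 * lam"
  using ln_tangent_pos[OF assms(1) slope_at_25]
    ln_tangent_neg_inv[OF assms(2) slope_at_m9]
    ln_tangent_pos_inv[OF assms(3) slope_at_m22]
    ln_tangent_pos[OF assms(4) slope_at_6]
    ln_tangent_pos[OF assms(5) slope_at_14]
    ln_tangent_neg_inv[OF assms(6) slope_at_m26]
    ln_tangent_pos[OF assms(7) slope_at_20]
    ln_tangent_pos_inv[OF assms(8) slope_at_m1]
    ln_tangent_neg_inv[OF assms(9) slope_at_m16]
    ln_tangent_pos[OF assms(10) slope_at_20]
    lam_bounds p_bounds t_bounds assms
  unfolding form_tail_def of_nat_numeral of_nat_0 of_nat_1 ring_distribs by linarith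

lemma form_tail_conj_cell8:
  fixes y :: real
  assumes "0 < y" "y - 4 < 0" "0 < y - 3" "0 < y - 2" "0 < y - p1" "0 < y - p2" "0 < y - t1"
      "0 < y - t2" "y - t3 < 0" "0 < y - 1" "0 < y" "y < 4"
  shows "300 * ln y + form_tail y \<le> 3334 * lam"
  using ln_tangent_pos[OF assms(1) slope_at_27]
    ln_tangent_neg_inv[OF assms(2) slope_at_m29]
    ln_tangent_pos_inv[OF assms(3) slope_at_m7]
    ln_tangent_pos[OF assms(4) slope_at_12]
    ln_tangent_pos[OF assms(5) slope_at_18]
    ln_tangent_pos_inv[OF assms(6) slope_at_m42]
    ln_tangent_pos[OF assms(7) slope_at_23]
    ln_tangent_pos[OF assms(8) slope_at_5]
    ln_tangent_neg_inv[OF assms(9) slope_at_m59]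
    ln_tangent_pos[OF assms(10) slope_at_21]
    lam_bounds p_bounds t_bounds assms
  unfolding form_tail_def of_nat_numeral of_nat_0 of_nat_1 ring_distribs by linarith

lemma form_tail_conj_cell9:
  fixes y :: real
  assumes "0 < y" "y - 4 < 0" "0 < y - 3" "0 < y - 2" "0 < y - p1" "0 < y - p2" "0 < y - t1"
      "0 < y - t2" "0 < y - t3" "0 < y - 1" "0 < y" "y < 4"
  shows "300 * ln y + form_tail y \<le> 3334 * lam"
  using ln_tangent_pos[OF assms(1) slope_at_27]
    ln_tangent_neg_inv[OF assms(2) slope_at_m50]
    ln_tangent_pos_inv[OF assms(3) slope_at_m3]
    ln_tangent_pos[OF assms(4) slope_at_12]
    ln_tangent_pos[OF assms(5) slope_at_18]
    ln_tangent_pos_inv[OF assms(6) slope_at_m25]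
    ln_tangent_pos[OF assms(7) slope_at_23]
    ln_tangent_pos[OF assms(8) slope_at_6]
    ln_tangent_pos_inv[OF assms(9) slope_at_m45]
    ln_tangent_pos[OF assms(10) slope_at_21]
    lam_bounds p_bounds t_bounds assms
  unfolding form_tail_def of_nat_numeral of_nat_0 of_nat_1 ring_distribs by linarith

lemma form_tail_conj:
  fixes y :: real
  assumes "0 < y" "y < 4"
    and "y \<noteq> 0" "y - 4 \<noteq> 0" "y - 3 \<noteq> 0" "y - 2 \<noteq> 0"
        "y - p1 \<noteq> 0" "y - p2 \<noteq> 0" "y - t1 \<noteq> 0" "y - t2 \<noteq> 0"
        "y - t3 \<noteq> 0" "y - 1 \<noteq> 0"
  shows "300 * ln y + form_tail y \<le> 3334 * lam"
proof -
  show ?thesis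
  proof (cases "y - 3 < 0")
    case h1: True
    show ?thesis
    proof (cases "y - 2 < 0")
      case h2: True
      show ?thesis
      proof (cases "y - p1 < 0")
        case h3: True
        show ?thesis
        proof (cases "y - t1 < 0")
          case h4: True
          show ?thesis
            by (rule form_tail_conj_cell1) (use assms(1-2) h1 h2 h3 h4 p_bounds t_bounds in linarith)+
        next
          case False
          then have h4: "0 < y - t1"
            using assms(9) by simp
          show ?thesis
          proof (cases "y - 1 < 0")
            case h5: True
            show ?thesis
              by (rule form_tail_conj_cell2) (use assms(1-2) h1 h2 h3 h4 h5 p_bounds t_bounds in linarith)+
          next
            case False
            then have h5: "0 < y - 1"
              using assms(12) by simp
            show ?thesis
              by (rule form_tail_conj_cell3) (use assms(1-2) h1 h2 h3 h4 h5 p_bounds t_bounds in linarith)+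
          qed
        qed
      next
        case False
        then have h3: "0 < y - p1"
          using assms(7) by simp
        show ?thesis
          by (rule form_tail_conj_cell4) (use assms(1-2) h1 h2 h3 p_bounds t_bounds in linarith)+
      qed
    next
      case False
      then have h2: "0 < y - 2"
        using assms(6) by simp
      show ?thesis
      proof (cases "y - t2 < 0")
        case h3: True
        show ?thesis
          by (rule form_tail_conj_cell5) (use assms(1-2) h1 h2 h3 p_bounds t_bounds in linarith)+
      next
        case False
        then have h3: "0 < y - t2"
          using assms(10) by simp
        show ?thesis
          by (rule form_tail_conj_cell6) (use assms(1-2) h1 h2 h3 p_bounds t_bounds in linarith)+
      qed
    qed
  next
    case False
    then have h1: "0 < y - 3"
      using assms(5) by simp
    show ?thesis
    proof (cases "y - p2 < 0")
      case h2: True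
      show ?thesis
        by (rule form_tail_conj_cell7) (use assms(1-2) h1 h2 p_bounds t_bounds in linarith)+
    next
      case False
      then have h2: "0 < y - p2"
        using assms(8) by simp
      show ?thesis
      proof (cases "y - t3 < 0")
        case h3: True
        show ?thesis
          by (rule form_tail_conj_cell8) (use assms(1-2) h1 h2 h3 p_bounds t_bounds in linarith)+
      next
        case False
        then have h3: "0 < y - t3"
          using assms(11) by simp
        show ?thesis
          by (rule form_tail_conj_cell9) (use assms(1-2) h1 h2 h3 p_bounds t_bounds in linarith)+
      qed
    qed
  qed
qed

text \<open>The limit 586 / 1000 lies just above \<open>4 sin^2 (pi / 8)\<close>, so one estimate
  covers all indices from 8 on. It is nearly reached as \<open>y\<close> tends to 0, that is for
  large indices.\<close>

lemma form_tail_id_cell1: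
  fixes y :: real
  assumes "y - 4 < 0" "y - 3 < 0" "y - 2 < 0" "y - p1 < 0" "y - p2 < 0" "y - t1 < 0" "y - t2 < 0"
      "y - t3 < 0" "y - 1 < 0" "0 < y" "y < (586 / 1000)"
  shows "form_tail y \<le> 11183 * lam"
  using ln_tangent_neg[OF assms(1) slope_at_28]
    ln_tangent_neg[OF assms(2) slope_at_23]
    ln_tangent_neg[OF assms(3) slope_at_14]
    ln_tangent_neg[OF assms(4) slope_at_7]
    ln_tangent_neg[OF assms(5) slope_at_26]
    ln_tangent_neg_inv[OF assms(6) slope_at_m6]
    ln_tangent_neg[OF assms(7) slope_at_18]
    ln_tangent_neg[OF assms(8) slope_at_27]
    ln_tangent_neg[OF assms(9) slope_at_0]
    lam_bounds p_bounds t_bounds assms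
  unfolding form_tail_def of_nat_numeral of_nat_0 of_nat_1 ring_distribs by linarith

lemma form_tail_id:
  fixes y :: real
  assumes "0 < y" "y < (586 / 1000)"
    and "y - 4 \<noteq> 0" "y - 3 \<noteq> 0" "y - 2 \<noteq> 0" "y - p1 \<noteq> 0"
        "y - p2 \<noteq> 0" "y - t1 \<noteq> 0" "y - t2 \<noteq> 0" "y - t3 \<noteq> 0"
        "y - 1 \<noteq> 0"
  shows "form_tail y \<le> 11183 * lam"
  by (rule form_tail_id_cell1) (use assms(1-2) p_bounds t_bounds in linarith)+

lemma form_7_tail_id_cell1:
  fixes y :: real
  assumes "0 < 4 - y" "y - 3 < 0" "(75302 / 100000) < y" "y < (75303 / 100000)"
  shows "100 * ln (4 - y) + 200 * ln (y - 3) \<le> 5734 * lam"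
  using ln_tangent_pos[OF assms(1) slope_at_24]
    ln_tangent_neg[OF assms(2) slope_at_17]
    lam_bounds  assms
  unfolding  of_nat_numeral of_nat_0 of_nat_1 ring_distribs by linarith

lemma form_7_tail_id:
  fixes y :: real
  assumes "(75302 / 100000) < y" "y < (75303 / 100000)"
    and "4 - y \<noteq> 0" "y - 3 \<noteq> 0"
  shows "100 * ln (4 - y) + 200 * ln (y - 3) \<le> 5734 * lam"
  by (rule form_7_tail_id_cell1) (use assms(1-2)  in linarith)+

text \<open>The second argument stands for \<open>4 x - y z\<close>, which is below 4 * 196 =
  784.\<close>

lemma form_product_id_cell1:
  fixes x y :: real
  assumes "0 < x" "0 < y" "0 < x" "x < 196" "0 < y" "y < 784"
  shows "240 * ln x + 60 * ln y \<le> 34160 * lam"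
  using ln_tangent_pos[OF assms(1) slope_at_108]
    ln_tangent_pos[OF assms(2) slope_at_137]
    lam_bounds  assms
  unfolding  of_nat_numeral of_nat_0 of_nat_1 ring_distribs by linarith

lemma form_product_id:
  fixes x y :: real
  assumes "0 < x" "x < 196" "0 < y" "y < 784"
    and "x \<noteq> 0" "y \<noteq> 0"
  shows "240 * ln x + 60 * ln y \<le> 34160 * lam"
  by (rule form_product_id_cell1) (use assms(1-4)  in linarith)+

section \<open>Counting the embeddings\<close>

lemma quint_factor: "v * v - 5 * v + 5 = (v - p1) * (v - p2)"
  by (simp add: p1_def p2_def field_simps)

text \<open>All that the counting needs from the algebra: \<open>X i\<close>, \<open>Y i\<close>,
  \<open>Z i\<close> are the images of \<open>x\<close>, \<open>y\<close>, \<open>z\<close> under a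
  nontrivial embedding. The clause \<open>zero\<close> expresses that embeddings are injective, the
  clause \<open>norm\<close> that a nonzero algebraic integer has norm at least 1 in absolute
  value.\<close>

locale conjugate_system =
  fixes I :: "'i set" and x y z :: real and X Y Z :: "'i \<Rightarrow> real"
  assumes finite: "finite I"
    and x: "4 < x" "x < 196"
    and X: "i \<in> I \<Longrightarrow> 0 < X i" "i \<in> I \<Longrightarrow> 4 * X i < Y i * Z i"
    and Y: "i \<in> I \<Longrightarrow> 0 < Y i" "i \<in> I \<Longrightarrow> Y i < 4"
    and Z: "i \<in> I \<Longrightarrow> 0 < Z i" "i \<in> I \<Longrightarrow> Z i < 4"
    and zero:
        "i \<in> I \<Longrightarrow> int_poly3 f \<Longrightarrow> f (X i) (Y i) (Z i) = 0 \<longleftrightarrow> f x y z = 0"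
    and norm:
        "int_poly3 f \<Longrightarrow> f x y z \<noteq> 0 \<Longrightarrow> 0 \<le> ln (f x y z) + (\<Sum>i\<in>I. ln (f (X i) (Y i) (Z i)))"
begin

lemma card_bound:
  fixes ws :: "(real \<times> (real \<Rightarrow> real \<Rightarrow> real \<Rightarrow> real)) list"
  assumes ws: "\<forall>(w, f)\<in>set ws. 0 \<le> w \<and> int_poly3 f \<and> f x y z \<noteq> 0"
    and conj:
        "\<And>i. i \<in> I \<Longrightarrow> (\<Sum>(w, f)\<leftarrow>ws. w * ln (f (X i) (Y i) (Z i))) \<le> - E * lam"
    and id: "(\<Sum>(w, f)\<leftarrow>ws. w * ln (f x y z)) \<le> C * lam"
  shows "real (card I) * E \<le> C"
proof -
  have "0 \<le> (\<Sum>(w, f)\<leftarrow>ws. w * ln (f x y z)) + (\<Sum>i\<in>I. \<Sum>(w, f)\<leftarrow>ws. w * ln (f (X i) (Y i) (Z i)))"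
    using ws
  proof (induction ws)
    case (Cons wf ws)
    obtain w f where wf: "wf = (w, f)"
      by (cases wf)
    have "0 \<le> w * (ln (f x y z) + (\<Sum>i\<in>I. ln (f (X i) (Y i) (Z i))))"
      using Cons.prems wf by (intro mult_nonneg_nonneg norm) auto
    also have "\<dots> = w * ln (f x y z) + (\<Sum>i\<in>I. w * ln (f (X i) (Y i) (Z i)))"
      by (simp add: distrib_left sum_distrib_left)
    finally show ?case
      using Cons.IH Cons.prems by (simp add: wf sum.distrib)
  qed simp
  also have "\<dots> \<le> C * lam + (\<Sum>i\<in>I. - E * lam)"
    using id conj by (intro add_mono sum_mono)
  also have "\<dots> = (C - real (card I) * E) * lam"
    by (simp add: algebra_simps)
  finally have "0 \<le> C - real (card I) * E"
    using lam_bounds(1) by (simp add: zero_le_mult_iff)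
  then show ?thesis
    by simp
qed

lemma conj_zero: "i \<in> I \<Longrightarrow> int_poly3 f \<Longrightarrow> f x y z = 0 \<Longrightarrow> f (X i) (Y i) (Z i) = 0"
  using zero by blast

lemma conj_nonzero: "i \<in> I \<Longrightarrow> int_poly3 f \<Longrightarrow> f x y z \<noteq> 0 \<Longrightarrow> f (X i) (Y i) (Z i) \<noteq> 0"
  using zero by blast

lemma card_bound_3_3:
  assumes "y = 3" "z = 3"
  shows "card I < 25"
proof -
  have "real (card I) * 48 \<le> 1081"
  proof (rule card_bound[of "[(3, \<lambda>x y z. x), (3, \<lambda>x y z. x - 1), (4, \<lambda>x y z. x - 2)]"])
    fix i assume i: "i \<in> I"
    have "Y i - 3 = 0" "Z i - 3 = 0"
      using conj_zero[OF i, of "\<lambda>x y z. y - 3"]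
          conj_zero[OF i, of "\<lambda>x y z. z - 3"] assms
      by (auto simp: int_poly3.intros)
    moreover have "X i - 1 \<noteq> 0" "X i - 2 \<noteq> 0"
      using conj_nonzero[OF i, of "\<lambda>x y z. x - 1"]
          conj_nonzero[OF i, of "\<lambda>x y z. x - 2"] x
      by (auto simp: int_poly3.intros)
    ultimately show "(\<Sum>(w, f)\<leftarrow>[(3, \<lambda>x y z. x), (3, \<lambda>x y z. x - 1), (4, \<lambda>x y z. x - 2)].
        w * ln (f (X i) (Y i) (Z i))) \<le> - 48 * lam"
      using form_3_3_conj[of "X i"] X[OF i] by simp
  qed (use x form_3_3_id[of x] in \<open>auto intro!: int_poly3.intros\<close>)
  then show ?thesis
    by simp
qed

text \<open>A rational \<open>y\<close> is its own conjugate, so \<open>Y i <= 3\<close> for all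
  three values, and they share the region \<open>4 X < 3 Z\<close>.\<close>

lemma card_bound_constant:
  assumes y: "y = 1 \<or> y = 2 \<or> y = 3" and z: "0 < z" "z \<le> 2"
  shows "card I < 20"
proof -
  define ws :: "(real \<times> (real \<Rightarrow> real \<Rightarrow> real \<Rightarrow> real)) list" where
    "ws = [(36, \<lambda>x y z. z - 4), (27, \<lambda>x y z. z - 3), (61, \<lambda>x y z. x - z + 1), (43, \<lambda>x y z. x - 2),
      (97, \<lambda>x y z. x - 1), (78, \<lambda>x y z. x), (11, \<lambda>x y z. 2 * x - z - 1), (15, \<lambda>x y z. 2 * x - z),
      (23, \<lambda>x y z. x * x - 3 * x + 1)]"
  have quad: "v * v - 3 * v + 1 = (v - r1) * (v - r2)" for v
    by (simp add: r1_def r2_def field_simps)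
  \<comment> \<open>The list contains the quadratic unsplit because its linear factors do not have
    integer coefficients. Its logarithm is split only here, which needs a nonzero value.\<close>
  have sum: "(\<Sum>(w, f)\<leftarrow>ws. w * ln (f a b c)) = form_const a c" if "a * a - 3 * a + 1 \<noteq> 0" for a b c
    using that by (simp add: ws_def form_const_def quad ln_mult)
  have x12: "0 < x * x - 3 * x + 1"
    unfolding quad using x r_bounds by (intro mult_pos_pos) linarith+
  have nz: "\<forall>(w, f)\<in>set ws. 0 \<le> w \<and> int_poly3 f \<and> f x y z \<noteq> 0"
    using x z x12 by (auto simp: ws_def intro!: int_poly3.intros)
  have "real (card I) * 2037 \<le> 39952"
  proof (rule card_bound[OF nz])
    fix i assume i: "i \<in> I"
    have ne: "\<forall>(w, f)\<in>set ws. f (X i) (Y i) (Z i) \<noteq> 0"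
      using conj_nonzero[OF i] nz by fastforce
    have "Y i \<le> 3"
      using y conj_zero[OF i, of "\<lambda>x y z. y - 1"]
          conj_zero[OF i, of "\<lambda>x y z. y - 2"]
        conj_zero[OF i, of "\<lambda>x y z. y - 3"] by (auto simp: int_poly3.intros)
    then have "Y i * Z i \<le> 3 * Z i"
      using Z[OF i] by (intro mult_right_mono) auto
    then have "4 * X i < 3 * Z i"
      using X[OF i] by simp
    moreover have "X i * X i - 3 * X i + 1 \<noteq> 0"
      using ne by (auto simp: ws_def)
    ultimately show "(\<Sum>(w, f)\<leftarrow>ws. w * ln (f (X i) (Y i) (Z i))) \<le> - 2037 * lam"
      using X[OF i] Z[OF i] ne unfolding sum[OF \<open>X i * X i - 3 * X i + 1 \<noteq> 0\<close>]
      by (intro form_const_conj) (auto simp: ws_def quad)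
  next
    show "(\<Sum>(w, f)\<leftarrow>ws. w * ln (f x y z)) \<le> 39952 * lam"
      using x z x12 r_bounds by (subst sum) (auto intro!: form_const_id)
  qed
  then show ?thesis
    by simp
qed

text \<open>\<open>Z i < 4\<close> turns \<open>4 X < Y Z\<close> into \<open>X < Y\<close>, so the
  estimate is uniform in k. The given \<open>y\<close> is the smaller root \<open>p1\<close>, while
  a conjugate may be either root.\<close>

lemma card_bound_5:
  assumes y: "y * y - 5 * y + 5 = 0" "y \<le> 2"
  shows "card I < 20"
proof -
  define ws :: "(real \<times> (real \<Rightarrow> real \<Rightarrow> real \<Rightarrow> real)) list" where
    "ws = [(7, \<lambda>x y z. 4 - y), (3, \<lambda>x y z. x), (3, \<lambda>x y z. x - y), (4, \<lambda>x y z. x - 1),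
      (4, \<lambda>x y z. x - y + 1)]"
  have "y = p1"
    using y p_bounds by (auto simp: quint_factor)
  then have yb: "138196 / 100000 < y" "y < 138197 / 100000"
    using p_bounds by auto
  have nz: "\<forall>(w, f)\<in>set ws. 0 \<le> w \<and> int_poly3 f \<and> f x y z \<noteq> 0"
    using x yb by (auto simp: ws_def intro!: int_poly3.intros)
  have "real (card I) * 97 \<le> 1652"
  proof (rule card_bound[OF nz])
    fix i assume i: "i \<in> I"
    have ne: "\<forall>(w, f)\<in>set ws. f (X i) (Y i) (Z i) \<noteq> 0"
      using conj_nonzero[OF i] nz by fastforce
    have "Y i * Y i - 5 * Y i + 5 = 0"
      using conj_zero[OF i, of "\<lambda>x y z. y * y - 5 * y + 5"] y by (auto simp:
          int_poly3.intros)
    then consider "Y i = p1" | "Y i = p2"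
      by (auto simp: quint_factor)
    moreover have "Y i * Z i \<le> Y i * 4"
      using Y[OF i] Z[OF i] by (intro mult_left_mono) auto
    then have "X i < Y i"
      using X[OF i] by simp
    ultimately show "(\<Sum>(w, f)\<leftarrow>ws. w * ln (f (X i) (Y i) (Z i))) \<le> - 97 * lam"
    proof cases
      case 1
      then show ?thesis
        using form_5_conj1[of "Y i" "X i"] p_bounds X[OF i] \<open>X i < Y i\<close> ne by (simp
            add: ws_def)
    next
      case 2
      then show ?thesis
        using form_5_conj2[of "Y i" "X i"] p_bounds X[OF i] \<open>X i < Y i\<close> ne by (simp
            add: ws_def)
    qed
  next
    show "(\<Sum>(w, f)\<leftarrow>ws. w * ln (f x y z)) \<le> 1652 * lam"
      using form_5_id[of y x] x yb by (simp add: ws_def)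
  qed
  then show ?thesis
    by simp
qed

text \<open>As \<open>y - z\<close> vanishes, so do its conjugates; the region shrinks to three
  segments \<open>4 X < Y^2\<close>, one over each root of \<open>sept\<close>.\<close>

lemma card_bound_7_7:
  assumes y: "sept y = 0" "y \<le> 2" and z: "z = y"
  shows "card I < 21"
proof -
  define ws :: "(real \<times> (real \<Rightarrow> real \<Rightarrow> real \<Rightarrow> real)) list" where
    "ws = [(2, \<lambda>x y z. 4 - y), (1, \<lambda>x y z. x - 2 * y + 4), (1, \<lambda>x y z. x - y + 1), (2, \<lambda>x y z. x)]"
  have "y = t1"
    using y t_bounds by (auto simp: sept_factor)
  then have yb: "75302 / 100000 < y" "y < 75303 / 100000"
    using t_bounds by auto
  have nz: "\<forall>(w, f)\<in>set ws. 0 \<le> w \<and> int_poly3 f \<and> f x y z \<noteq> 0"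
    using x yb by (auto simp: ws_def intro!: int_poly3.intros)
  have "real (card I) * 26 \<le> 482"
  proof (rule card_bound[OF nz])
    fix i assume i: "i \<in> I"
    have ne: "\<forall>(w, f)\<in>set ws. f (X i) (Y i) (Z i) \<noteq> 0"
      using conj_nonzero[OF i] nz by fastforce
    have "sept (Y i) = 0"
      using conj_zero[OF i, of "\<lambda>x y z. y ^ 3 - 7 * y\<^sup>2 + 14 * y - 7"] y
      by (auto simp: sept_def int_poly3.intros int_poly3_power)
    then consider "Y i = t1" | "Y i = t2" | "Y i = t3"
      by (auto simp: sept_factor)
    moreover have "Y i - Z i = 0"
      using conj_zero[OF i, of "\<lambda>x y z. y - z"] z by (auto simp: int_poly3.intros)
    then have xy: "4 * X i < Y i * Y i"
      using X[OF i] by simp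
    have sq: "Y i * Y i < b * b" if "Y i < b" for b
      using Y[OF i] that by (intro mult_strict_mono) auto
    ultimately show "(\<Sum>(w, f)\<leftarrow>ws. w * ln (f (X i) (Y i) (Z i))) \<le> - 26 * lam"
    proof cases
      case 1
      then show ?thesis
        using form_7_7_conj1[of "Y i" "X i"] t_bounds X[OF i] xy sq[of "75303 / 100000"] ne
        by (simp add: ws_def)
    next
      case 2
      then show ?thesis
        using form_7_7_conj2[of "Y i" "X i"] t_bounds X[OF i] xy sq[of "244505 / 100000"] ne
        by (simp add: ws_def)
    next
      case 3
      then show ?thesis
        using form_7_7_conj3[of "Y i" "X i"] t_bounds X[OF i] xy sq[of "380194 / 100000"] ne
        by (simp add: ws_def)
    qed
  next
    show "(\<Sum>(w, f)\<leftarrow>ws. w * ln (f x y z)) \<le> 482 * lam"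
      using form_7_7_id[of y x] x yb by (simp add: ws_def)
  qed
  then show ?thesis
    by simp
qed

end

text \<open>The parameter \<open>g\<close> selects a coordinate, so that the same weights serve
  \<open>y\<close> and \<open>z\<close>. The quadratic and the cubic stay unsplit because the norm
  inequality requires integer polynomials.\<close>

definition ws_tail :: "(real \<Rightarrow> real \<Rightarrow> real \<Rightarrow> real) \<Rightarrow> (real \<times> (real \<Rightarrow> real \<Rightarrow> real \<Rightarrow> real)) list" where
  "ws_tail g = [(93, \<lambda>x y z. g x y z - 4), (118, \<lambda>x y z. g x y z - 3), (61, \<lambda>x y z. g x y z - 2),
     (100, \<lambda>x y z. g x y z * g x y z - 5 * g x y z + 5),
     (43, \<lambda>x y z. g x y z ^ 3 - 7 * (g x y z)\<^sup>2 + 14 * g x y z - 7), (7, \<lambda>x y z. g x y z - 1)]"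

lemma ws_tail_sum:
  assumes "\<forall>(w, f)\<in>set (ws_tail g). f x y z \<noteq> 0"
  shows "(\<Sum>(w, f)\<leftarrow>ws_tail g. w * ln (f x y z)) = form_tail (g x y z)"
proof -
  let ?v = "g x y z"
  have "?v * ?v - 5 * ?v + 5 \<noteq> 0" "sept ?v \<noteq> 0"
    using assms by (simp_all add: ws_tail_def sept_def)
  then have "(?v - p1) * (?v - p2) \<noteq> 0" "(?v - t1) * (?v - t2) * (?v - t3) \<noteq> 0"
    by (simp_all only: quint_factor sept_factor not_False_eq_True)
  moreover have "ln (?v * ?v - 5 * ?v + 5) = ln ((?v - p1) * (?v - p2))"
    "ln (?v ^ 3 - 7 * ?v\<^sup>2 + 14 * ?v - 7) = ln ((?v - t1) * (?v - t2) * (?v - t3))"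
    by (simp_all only: quint_factor sept_factor[unfolded sept_def])
  ultimately show ?thesis
    by (simp add: ws_tail_def form_tail_def ln_mult)
qed

lemma ws_tail_int_poly3:
  assumes "int_poly3 g" shows "\<forall>(w, f)\<in>set (ws_tail g). 0 \<le> w \<and> int_poly3 f"
  using assms by (auto simp: ws_tail_def intro!: int_poly3.intros int_poly3_power)

lemma ws_tail_nonzero:
  assumes "g x y z < 586 / 1000" shows "\<forall>(w, f)\<in>set (ws_tail g). f x y z \<noteq> 0"
proof -
  let ?v = "g x y z"
  have "?v * ?v - 5 * ?v + 5 \<noteq> 0"
    unfolding quint_factor using assms p_bounds by auto
  moreover have "?v ^ 3 - 7 * ?v\<^sup>2 + 14 * ?v - 7 \<noteq> 0"
    unfolding sept_factor[unfolded sept_def] using assms t_bounds by auto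
  ultimately show ?thesis
    using assms by (auto simp: ws_tail_def)
qed

lemma ws_tail_le:
  assumes "\<forall>(w, f)\<in>set (ws_tail g). f x y z \<noteq> 0" "0 < g x y z" "g x y z < 4"
  shows "300 * ln (g x y z) + (\<Sum>(w, f)\<leftarrow>ws_tail g. w * ln (f x y z)) \<le> 3334 * lam"
proof -
  let ?v = "g x y z"
  have "?v * ?v - 5 * ?v + 5 \<noteq> 0" "sept ?v \<noteq> 0"
    using assms(1) by (simp_all add: ws_tail_def sept_def)
  then have "(?v - p1) * (?v - p2) \<noteq> 0" "(?v - t1) * (?v - t2) * (?v - t3) \<noteq> 0"
    by (simp_all only: quint_factor sept_factor not_False_eq_True)
  then show ?thesis
    unfolding ws_tail_sum[of g x y z, OF assms(1)] using assms by (intro form_tail_conj) (auto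
        simp: ws_tail_def)
qed

lemma ws_tail_id:
  assumes "0 < g x y z" "g x y z < 586 / 1000"
  shows "(\<Sum>(w, f)\<leftarrow>ws_tail g. w * ln (f x y z)) \<le> 11183 * lam"
  unfolding ws_tail_sum[of g x y z, OF ws_tail_nonzero[of g x y z, OF assms(2)] ] using assms
      p_bounds t_bounds
  by (intro form_tail_id) auto

text \<open>The weighted inequality of the means: at \<open>x = b / 5\<close> both \<open>x\<close>
  and \<open>b - 4 x\<close> equal \<open>b / 5\<close>. With the tangents at this point and the
  weights 240 and 60 the linear terms cancel.\<close>

lemma ln_product_le:
  fixes x b :: real
  assumes "0 < x" "4 * x < b"
  shows "240 * ln x + 60 * ln (b - 4 * x) \<le> 300 * ln b - 300 * ln 5"
proof -
  have b: "0 < b"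
    using assms by simp
  have tangent: "ln 5 - ln b + ln w \<le> 5 * (w / b) - 1" if "0 < w" for w
    using ln_le_minus_one[of "5 / b * w"] that b by (simp add: ln_mult ln_div)
  have "(b - 4 * x) / b = 1 - 4 * (x / b)"
    using b by (simp add: field_simps)
  then show ?thesis
    using tangent[of x] tangent[of "b - 4 * x"] assms by simp
qed

text \<open>The tangent points fit because 1 / 5 is close to \<open>(20 / 21) ^ 33\<close> and 7 is
  close to \<open>(21 / 20) ^ 40\<close>.\<close>

lemma ln_5_7: "- ln 5 \<le> - 3298 / 100 * lam" "ln 7 \<le> 3989 / 100 * lam"
  using ln_tangent_pos_inv[OF _ slope_at_m33, of "1 / 5"] ln_tangent_pos[OF _ slope_at_40, of 7]
      lam_bounds
  by (simp_all add: ln_div)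

context conjugate_system
begin

lemma product_part:
  assumes "i \<in> I"
  shows "240 * ln (X i) + 60 * ln (Y i * Z i - 4 * X i) \<le> 300 * ln (Y i) + 300 * ln (Z i) - 300 * ln 5"
  using ln_product_le[OF X[OF assms]] Y[OF assms] Z[OF assms] by (simp add: ln_mult)

text \<open>At the given matrix \<open>y z - 4 x\<close> is negative, whereas at the conjugates it
  is positive; the logarithm does not see the sign.\<close>

lemma product_part_id:
  assumes "0 < y" "y < 1" "0 < z" "z < 1"
  shows "y * z - 4 * x < 0" "240 * ln x + 60 * ln (y * z - 4 * x) \<le> 34160 * lam"
proof -
  have "y * z < 1 * 1"
    using assms by (intro mult_strict_mono) auto
  then show neg: "y * z - 4 * x < 0"
    using x by simp
  have "0 < y * z"
    using assms by simp
  then show "240 * ln x + 60 * ln (y * z - 4 * x) \<le> 34160 * lam"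
    using form_product_id[of x "4 * x - y * z"] x neg ln_minus[of "4 * x - y * z"] by simp
qed

text \<open>The tail weights are excluded for \<open>y\<close> because \<open>sept y = 0\<close>.
  Instead, 7 is the cube of \<open>y\<close> times the units \<open>4 - y\<close> and
  \<open>(y - 3)^2\<close>, and the weights 100 and 200 on these units trade
  \<open>300 * ln (Y i)\<close> for \<open>100 * ln 7\<close>.\<close>

lemma card_bound_7_tail:
  assumes y: "sept y = 0" "y \<le> 2" and z: "0 < z" "z < 586 / 1000"
  shows "card I < 20"
proof -
  define ws where "ws = [(240, \<lambda>x y z. x), (60, \<lambda>x y z. y * z - 4 * x), (100, \<lambda>x y z. 4 - y),
    (200, \<lambda>x y z. y - 3)] @ ws_tail (\<lambda>x y z. z)"
  have "y = t1"
    using y t_bounds by (auto simp: sept_factor)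
  then have yb: "75302 / 100000 < y" "y < 75303 / 100000"
    using t_bounds by auto
  have base: "y * z - 4 * x < 0" "240 * ln x + 60 * ln (y * z - 4 * x) \<le> 34160 * lam"
    using product_part_id yb z by auto
  have nz: "\<forall>(w, f)\<in>set ws. 0 \<le> w \<and> int_poly3 f \<and> f x y z \<noteq> 0"
    using x yb base ws_tail_int_poly3[OF int_poly3.trd]
        ws_tail_nonzero[of "\<lambda>x y z. z" x y z] z
    unfolding ws_def by (auto intro!: int_poly3.intros)
  \<comment> \<open>Here 51077 = 34160 + 5734 + 11183, and 2565 is just below 300 * 32.98 - 100 *
    39.89 - 3334 = 2571.\<close>
  have "real (card I) * 2565 \<le> 51077"
  proof (rule card_bound[OF nz])
    fix i assume i: "i \<in> I"
    have ne: "\<forall>(w, f)\<in>set ws. f (X i) (Y i) (Z i) \<noteq> 0"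
      using conj_nonzero[OF i] nz by fastforce
    have "sept (Y i) = 0"
      using conj_zero[OF i, of "\<lambda>x y z. y ^ 3 - 7 * y\<^sup>2 + 14 * y - 7"] y
      by (auto simp: sept_def int_poly3.intros int_poly3_power)
    \<comment> \<open>The cofactor is the quotient of the left side minus 7 by
      \<open>sept v\<close>.\<close>
    moreover have "v ^ 3 * ((4 - v) * (v - 3)\<^sup>2) = 7 + sept v * (1 + 2 * v + 3 * v\<^sup>2 - v ^ 3)" for v
      by (simp add: sept_def power2_eq_square power3_eq_cube algebra_simps)
    ultimately have "Y i ^ 3 * ((4 - Y i) * (Y i - 3)\<^sup>2) = 7"
      by simp
    then have "ln (Y i ^ 3 * ((4 - Y i) * (Y i - 3)\<^sup>2)) = ln 7"
      by simp
    moreover have "Y i - 3 \<noteq> 0" "4 - Y i \<noteq> 0"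
      using ne by (auto simp: ws_def)
    ultimately have "3 * ln (Y i) + ln (4 - Y i) + 2 * ln (Y i - 3) = ln 7"
      using Y[OF i] by (simp add: ln_mult ln_realpow power2_eq_square)
    moreover have "300 * ln (Z i) + (\<Sum>(w, f)\<leftarrow>ws_tail (\<lambda>x y z. z). w * ln (f (X i) (Y i) (Z i))) \<le> 3334 * lam"
      using ws_tail_le[of "\<lambda>x y z. z" "X i" "Y i" "Z i"] ne Z[OF i] by (simp add: ws_def)
    ultimately show "(\<Sum>(w, f)\<leftarrow>ws. w * ln (f (X i) (Y i) (Z i))) \<le> - 2565 * lam"
      using product_part[OF i] ln_5_7 lam_bounds by (simp add: ws_def)
  next
    show "(\<Sum>(w, f)\<leftarrow>ws. w * ln (f x y z)) \<le> 51077 * lam"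
      using base(2) form_7_tail_id[of y] yb ws_tail_id[of "\<lambda>x y z. z" x y z] z by (simp
          add: ws_def)
  qed
  then show ?thesis
    by simp
qed

text \<open>After \<open>product_part\<close> the variables are separated, and the same one-variable
  estimate applies to \<open>Y i\<close> and to \<open>Z i\<close>.\<close>

lemma card_bound_tail:
  assumes y: "0 < y" "y < 586 / 1000" and z: "0 < z" "z < 586 / 1000"
  shows "card I < 20"
proof -
  define ws where "ws = [(240, \<lambda>x y z. x), (60, \<lambda>x y z. y * z - 4 * x)] @
    ws_tail (\<lambda>x y z. y) @ ws_tail (\<lambda>x y z. z)"
  have base: "y * z - 4 * x < 0" "240 * ln x + 60 * ln (y * z - 4 * x) \<le> 34160 * lam"
    using product_part_id y z by auto
  have nz: "\<forall>(w, f)\<in>set ws. 0 \<le> w \<and> int_poly3 f \<and> f x y z \<noteq> 0"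
    using x base ws_tail_int_poly3[OF int_poly3.trd] ws_tail_nonzero[of "\<lambda>x y z. z" x y z]
      ws_tail_int_poly3[OF int_poly3.snd] ws_tail_nonzero[of "\<lambda>x y z. y" x y z] y z
    unfolding ws_def by (auto intro!: int_poly3.intros)
  \<comment> \<open>Here 56526 = 34160 + 2 * 11183, and 3220 is just below 300 * 32.98 - 2 * 3334 =
    3226.\<close>
  have "real (card I) * 3220 \<le> 56526"
  proof (rule card_bound[OF nz])
    fix i assume i: "i \<in> I"
    have ne: "\<forall>(w, f)\<in>set ws. f (X i) (Y i) (Z i) \<noteq> 0"
      using conj_nonzero[OF i] nz by fastforce
    have "300 * ln (Y i) + (\<Sum>(w, f)\<leftarrow>ws_tail (\<lambda>x y z. y). w * ln (f (X i) (Y i) (Z i))) \<le> 3334 * lam"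
      using ws_tail_le[of "\<lambda>x y z. y" "X i" "Y i" "Z i"] ne Y[OF i] by (simp add: ws_def)
    moreover have "300 * ln (Z i) + (\<Sum>(w, f)\<leftarrow>ws_tail (\<lambda>x y z. z). w * ln (f (X i) (Y i) (Z i))) \<le> 3334 * lam"
      using ws_tail_le[of "\<lambda>x y z. z" "X i" "Y i" "Z i"] ne Z[OF i] by (simp add: ws_def)
    ultimately show "(\<Sum>(w, f)\<leftarrow>ws. w * ln (f (X i) (Y i) (Z i))) \<le> - 3220 * lam"
      using product_part[OF i] ln_5_7 lam_bounds by (simp add: ws_def)
  next
    show "(\<Sum>(w, f)\<leftarrow>ws. w * ln (f x y z)) \<le> 56526 * lam"
      using base(2) ws_tail_id[of "\<lambda>x y z. y" x y z]
          ws_tail_id[of "\<lambda>x y z. z" x y z] y z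
      by (simp add: ws_def)
  qed
  then show ?thesis
    by simp
qed

end

text \<open>Equal to \<open>4 sin^2 (pi / k)\<close>, the squared side of the regular k-gon
  inscribed in the unit circle.\<close>

definition chord :: "nat \<Rightarrow> real" where "chord k = 4 - (2 * cos (pi / real k))\<^sup>2"

lemma cos_pi_div_mono:
  assumes "2 \<le> m" "m \<le> k" shows "0 \<le> cos (pi / real m)"
      "cos (pi / real m) \<le> cos (pi / real k)"
proof -
  have "pi / real k \<le> pi / real m" "pi / real m \<le> pi / 2"
    using assms by (intro divide_left_mono; simp)+
  moreover from this(2) have "pi / real m \<le> pi"
    using pi_gt_zero by linarith
  moreover have "0 \<le> pi / real m" "0 \<le> pi / real k"
    by simp_all
  moreover have "- (pi / 2) \<le> pi / real m"
    using \<open>0 \<le> pi / real m\<close> pi_gt_zero by linarith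
  ultimately show "0 \<le> cos (pi / real m)" "cos (pi / real m) \<le> cos (pi / real k)"
    by (auto intro!: cos_ge_zero cos_monotone_0_pi_le)
qed

lemma chord_antimono:
  assumes "2 \<le> m" "m \<le> k" shows "chord k \<le> chord m"
  using cos_pi_div_mono[OF assms] by (simp add: chord_def power_mono)

lemma chord_pos:
  assumes "3 \<le> k" shows "0 < chord k"
proof -
  have "cos (pi / real k) < cos 0"
    using assms by (intro cos_monotone_0_pi) (auto simp: field_simps)
  moreover have "0 \<le> cos (pi / real k)"
    using cos_pi_div_mono[of k k] assms by simp
  ultimately have "(cos (pi / real k))\<^sup>2 < 1"
    by (simp add: abs_square_less_1)
  then show ?thesis
    by (simp add: chord_def power_mult_distrib)
qed

lemma chord_values: "chord 3 = 3" "chord 4 = 2" "chord 6 = 1"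
  by (simp_all add: chord_def cos_60 cos_45 cos_30 power_mult_distrib power_divide)

text \<open>For \<open>t = pi / 5\<close> the angles \<open>3 t\<close> and \<open>2 t\<close> add
  up to pi. This is a cubic equation for the cosine, from which the root -1 splits off.\<close>

lemma chord_5: "chord 5 * chord 5 - 5 * chord 5 + 5 = 0"
proof -
  define c where "c = cos (pi / 5)"
  have "cos (3 * (pi / 5)) = - cos (2 * (pi / 5))"
    using cos_pi_minus[of "2 * (pi / 5)"] by (simp add: field_simps)
  then have "4 * c ^ 3 - 3 * c = - (2 * c\<^sup>2 - 1)"
    unfolding cos_treble_cos cos_double_cos by (simp add: c_def)
  then have "(c + 1) * (4 * c\<^sup>2 - 2 * c - 1) = 0"
    by (simp add: power2_eq_square power3_eq_cube algebra_simps)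
  moreover have "c + 1 \<noteq> 0"
    using cos_pi_div_mono[of 5 5] by (simp add: c_def)
  ultimately have c: "4 * c\<^sup>2 - 2 * c - 1 = 0"
    by simp
  have "chord 5 = 4 - 4 * c\<^sup>2"
    by (simp add: chord_def c_def power_mult_distrib)
  then have chord: "chord 5 = 3 - 2 * c"
    using c by simp
  show ?thesis
    unfolding chord using c by (simp add: power2_eq_square algebra_simps)
qed

text \<open>For \<open>t = pi / 7\<close> the angles \<open>4 t\<close> and \<open>3 t\<close> add
  up to pi. This is a quartic equation for the cosine, from which the root -1 splits off.\<close>

lemma chord_7: "sept (chord 7) = 0"
proof -
  define c where "c = cos (pi / 7)"
  have "cos (2 * (2 * (pi / 7))) = - cos (3 * (pi / 7))"
    using cos_pi_minus[of "3 * (pi / 7)"] by (simp add: field_simps)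
  then have "2 * (2 * c\<^sup>2 - 1)\<^sup>2 - 1 = - (4 * c ^ 3 - 3 * c)"
    unfolding cos_treble_cos cos_double_cos by (simp add: c_def)
  then have "(c + 1) * (8 * c ^ 3 - 4 * c\<^sup>2 - 4 * c + 1) = 0"
    by (simp add: power2_eq_square power3_eq_cube algebra_simps)
  moreover have "c + 1 \<noteq> 0"
    using cos_pi_div_mono[of 7 7] by (simp add: c_def)
  ultimately have c: "8 * c ^ 3 - 4 * c\<^sup>2 - 4 * c + 1 = 0"
    by simp
  have chord: "chord 7 = 4 - 4 * c\<^sup>2"
    by (simp add: chord_def c_def power_mult_distrib)
  \<comment> \<open>As a polynomial in \<open>c\<close> the left side is even, and it is the product
    of the cubic for \<open>c\<close> and the same cubic at \<open>- c\<close>.\<close>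
  have "sept (chord 7) = - (8 * c ^ 3 - 4 * c\<^sup>2 - 4 * c + 1) * (8 * c ^ 3 + 4 * c\<^sup>2 - 4 * c - 1)"
    unfolding chord by (simp add: sept_def power2_eq_square power3_eq_cube algebra_simps)
  then show ?thesis
    using c by simp
qed

text \<open>The exact value is \<open>2 - sqrt 2\<close>, about 0.5858.\<close>

lemma chord_8: "chord 8 < 586 / 1000"
proof -
  have "cos (2 * (pi / 8)) = 2 * (cos (pi / 8))\<^sup>2 - 1"
    by (rule cos_double_cos)
  then have "chord 8 = 2 - sqrt 2"
    by (simp add: chord_def cos_45 power_mult_distrib)
  moreover have "1414 / 1000 < sqrt 2"
    by (rule real_less_rsqrt) (simp add: power2_eq_square)
  ultimately show ?thesis
    by simp
qed

lemma degree_over_Q_le_mono: "degree_over_Q_le K m \<Longrightarrow> m \<le> n \<Longrightarrow> degree_over_Q_le K n"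
  unfolding degree_over_Q_le_def by (meson order.trans)

theorem theorem4p12:
  fixes s k :: nat and u :: real
  assumes "3 \<le> s" and "s \<le> k"
    and "totally_real_algebraic_integer u" and "2 < u" and "u < 14"
    and "V_arithmetic (path_matrix u s k)"
  shows "(s = 3 \<and> k = 3 \<longrightarrow> degree_over_Q_le (ground_field (path_matrix u s k)) 25)
       \<and> (s = 3 \<and> k = 7 \<longrightarrow> degree_over_Q_le (ground_field (path_matrix u s k)) 21)
       \<and> (s = 7 \<and> k = 7 \<longrightarrow> degree_over_Q_le (ground_field (path_matrix u s k)) 21)
       \<and> (\<not> (s = 3 \<and> k = 3) \<and> \<not> (s = 3 \<and> k = 7) \<and> \<not> (s = 7 \<and> k = 7)
            \<longrightarrow> degree_over_Q_le (ground_field (path_matrix u s k)) 20)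
       \<and> degree_over_Q_le (ground_field (path_matrix u s k)) 25"
proof -
  have k: "3 \<le> k"
    using assms by simp
  obtain I where I:
    "finite I" "degree_over_Q_le (ground_field (path_matrix u s k)) (Suc (card I))"
    "\<And>\<phi>. \<phi> \<in> I \<Longrightarrow> 0 < \<phi> (u\<^sup>2) \<and> 4 * \<phi> (u\<^sup>2) < \<phi> (chord s) * \<phi> (chord k) \<and>
        0 < \<phi> (chord s) \<and> \<phi> (chord s) < 4 \<and> 0 < \<phi> (chord k) \<and> \<phi> (chord k) < 4"
    "\<And>\<phi> f. \<phi> \<in> I \<Longrightarrow> int_poly3 f \<Longrightarrow>
        f (\<phi> (u\<^sup>2)) (\<phi> (chord s)) (\<phi> (chord k)) = 0 \<longleftrightarrow> f (u\<^sup>2) (chord s) (chord k) = 0"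
    "\<And>f. int_poly3 f \<Longrightarrow> f (u\<^sup>2) (chord s) (chord k) \<noteq> 0 \<Longrightarrow> 0 \<le> ln (f (u\<^sup>2) (chord s) (chord k)) +
        (\<Sum>\<phi>\<in>I. ln (f (\<phi> (u\<^sup>2)) (\<phi> (chord s)) (\<phi> (chord k))))"
    using path_matrix_conjugates[OF assms(3,4,6,1) k] unfolding chord_def by blast
  have u: "4 < u\<^sup>2" "u\<^sup>2 < 196"
    using power_strict_mono[of 2 u 2] power_strict_mono[of u 14 2] assms by simp_all
  interpret conjugate_system I "u\<^sup>2" "chord s" "chord k" "\<lambda>\<phi>. \<phi> (u\<^sup>2)" "\<lambda>\<phi>. \<phi> (chord s)" "\<lambda>\<phi>. \<phi> (chord k)"
    using I u by unfold_locales blast+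
  have small: "0 < chord n" "chord n \<le> 2" if "4 \<le> n" for n
    using chord_pos[of n] chord_antimono[of 4 n] that by (auto simp: chord_values)
  have tiny: "0 < chord n" "chord n < 586 / 1000" if "8 \<le> n" for n
    using chord_pos[of n] chord_antimono[of 8 n] chord_8 that by auto
  have A: "card I < 25" if "s = 3" "k = 3"
    using card_bound_3_3 that by (simp add: chord_values)
  have F: "card I < 21" if "s = 7" "k = 7"
    using card_bound_7_7 small[of 7] that by (simp add: chord_7)
  have other: "card I < 20" if exc: "\<not> (s = 3 \<and> k = 3)" "\<not> (s = 7 \<and> k = 7)"
  proof -
    \<comment> \<open>The pair (3, 7) belongs to the first case and so gets the bound 20, which
      implies the 21 asked for.\<close>
    consider "s \<in> {3, 4, 6}" "4 \<le> k" | "s = 5" | "s = 7" "8 \<le> k" | "8 \<le> s" "8 \<le> k"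
      using assms(1,2) exc by force
    then show ?thesis
    proof cases
      case 1
      then show ?thesis
        using card_bound_constant small[of k] by (auto simp: chord_values)
    next
      case 2
      then show ?thesis
        using card_bound_5 small[of 5] chord_5 by simp
    next
      case 3
      then show ?thesis
        using card_bound_7_tail small[of 7] tiny[of k] by (simp add: chord_7)
    next
      case 4
      then show ?thesis
        using card_bound_tail tiny by simp
    qed
  qed
  show ?thesis
    using degree_over_Q_le_mono[OF I(2)] A F other by (cases "s = 3 \<and> k = 3" ; cases
        "s = 7 \<and> k = 7" ) auto
qed

end
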